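(* Let $k$ be a field and let $A$ be a unital cdg $k$-algebra with non-zero curvature. Then the bar derived category of $A$ vanishes: $D_{\mathrm{bar}}(A)=0$.
   Context: A unital cdg $k$-algebra is a $\mathbb{Z}$-graded associative unital $k$-algebra $A$ with a degree $1$ graded derivation $d_A$ and an element $c\in A^2$ (the curvature) with $d_A(c)=0$ and $d_A^2(a)=ca-ac$. A unital cdg $A$-module is a unital graded left $A$-module $M$ with a degree $1$ map $d_M$ such that $d_M(am)=d_A(a)m+(-1)^{|a|}a\,d_M(m)$ and $d_M^2(m)=cm$. $\underline{\mathsf{Mod}}(A)$ is the triangulated homotopy category: degree $0$ $A$-linear maps commuting with predifferentials modulo those of the form $dh+hd$ with $h$ graded $A$-linear of degree $-1$. Bar construction: let $s:A\to A[1]$ be the degree $-1$ identity map. $BA=\bigoplus_{n\ge0}(A[1])^{\otimes_k n}$ with the deconcatenation comultiplication $\Delta_{BA}$ and the codifferential $d_{BA}$ given by the unique coderivation with components $b_0(1)=s(c)$, $b_1(sa)=-s(d_Aa)$, $b_2(sa\otimes sb)=(-1)^{|a|+1}s(ab)$ into $A[1]$ (all others zero); it is a counital dg $k$-coalgebra. Let $\tau_A:BA\to A$ be the projection $BA\to A[1]$ followed by $sa\mapsto a$. For a unital cdg $A$-module $M$, $R_{\tau_A}M$ is the graded comodule $(BA\otimes_kM,\Delta_{BA}\otimes\mathbf 1_M)$ with codifferential $$d_{BA}\otimes\mathbf 1_M+\mathbf 1_{BA}\otimes d_M-(\mathbf 1_{BA}\otimes\mu_M)(\mathbf 1_{BA}\otimes\tau_A\otimes\mathbf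 1_M)(\Delta_{BA}\otimes\mathbf 1_M),$$ where $\mu_M:A\otimes_k M\to M$ is the action. The module $M$ is called bar acyclic if it is contractible as a curved $A_\infty$-module over $A$, equivalently if there is a morphism of graded $BA$-comodules $h:R_{\tau_A}M\to R_{\tau_A}M$ of degree $-1$ with $hd+dh=\mathbf 1$, $d$ the codifferential of $R_{\tau_A}M$. The bar derived category $D_{\mathrm{bar}}(A)$ is the triangle quotient of $\underline{\mathsf{Mod}}(A)$ by the full subcategory of bar acyclic modules. *)

theory Defs
  imports Complex_Main "HOL-Library.Function_Algebras" "HOL-Library.Product_Plus"
begin

section \<open>Graded vector spaces\<close>

text \<open>
  A \<open>\<int>\<close>-graded \<open>k\<close>-vector space is an internal direct sum of subspaces \<open>gr V n\<close> of an ambient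
  \<open>k\<close>-vector space, the ambient addition being that of the type and the ambient scalar
  multiplication being \<open>smult V\<close>.  As usual in graded algebra, structure maps are only ever applied to
  homogeneous elements; their values elsewhere are irrelevant.
\<close>

record ('k, 'v) gspace =
  gr :: "int \<Rightarrow> 'v set"
  smult :: "'k \<Rightarrow> 'v \<Rightarrow> 'v"

definition graded_space :: "('k::field, 'v::ab_group_add, 'z) gspace_scheme \<Rightarrow> bool" where
  "graded_space V \<longleftrightarrow>
     vector_space (smult V) \<and>
     (\<forall>n. module.subspace (smult V) (gr V n)) \<and>
     (\<forall>I x. finite I \<longrightarrow> (\<forall>n\<in>I. x n \<in> gr V n) \<longrightarrow> (\<Sum>n\<in>I. x n) = 0 \<longrightarrow> (\<forall>n\<in>I. x n = 0))"

text \<open>The degree of a non-zero homogeneous element (unspecified for \<open>0\<close>, where no sign matters).\<close>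

definition deg :: "('k, 'v, 'z) gspace_scheme \<Rightarrow> 'v \<Rightarrow> int" where
  "deg V x = (THE n. x \<in> gr V n)"

definition sg :: "int \<Rightarrow> 'v::ab_group_add \<Rightarrow> 'v" where
  "sg n x = (if even n then x else - x)"

definition gmap :: "('k, 'v::ab_group_add, 'y) gspace_scheme \<Rightarrow>
    ('k, 'w::ab_group_add, 'z) gspace_scheme \<Rightarrow> int \<Rightarrow> ('v \<Rightarrow> 'w) \<Rightarrow> bool" where
  "gmap V W r f \<longleftrightarrow>
     (\<forall>n. \<forall>x\<in>gr V n. f x \<in> gr W (n + r) \<and>
        (\<forall>y\<in>gr V n. f (x + y) = f x + f y) \<and> (\<forall>c. f (smult V c x) = smult W c (f x)))"


section \<open>Curved dg algebras and modules\<close>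

record ('k, 'a) cdg_alg = "('k, 'a) gspace" +
  amul :: "'a \<Rightarrow> 'a \<Rightarrow> 'a"
  aone :: "'a"
  adiff :: "'a \<Rightarrow> 'a"
  curv :: "'a"

record ('k, 'a, 'm) cdg_mod = "('k, 'm) gspace" +
  act :: "'a \<Rightarrow> 'm \<Rightarrow> 'm"
  mdiff :: "'m \<Rightarrow> 'm"

definition gbilinear :: "('k, 'u::ab_group_add, 'x) gspace_scheme \<Rightarrow>
    ('k, 'v::ab_group_add, 'y) gspace_scheme \<Rightarrow> ('k, 'w::ab_group_add, 'z) gspace_scheme \<Rightarrow>
    ('u \<Rightarrow> 'v \<Rightarrow> 'w) \<Rightarrow> bool" where
  "gbilinear U V W m \<longleftrightarrow>
     (\<forall>p. \<forall>x\<in>gr U p. gmap V W p (m x)) \<and> (\<forall>q. \<forall>y\<in>gr V q. gmap U W q (\<lambda>x. m x y))"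

definition cdg_algebra :: "('k::field, 'a::ab_group_add) cdg_alg \<Rightarrow> bool" where
  "cdg_algebra A \<longleftrightarrow>
     graded_space A \<and>
     gbilinear A A A (amul A) \<and>
     (\<forall>p q r. \<forall>a\<in>gr A p. \<forall>b\<in>gr A q. \<forall>e\<in>gr A r.
        amul A (amul A a b) e = amul A a (amul A b e)) \<and>
     aone A \<in> gr A 0 \<and>
     (\<forall>p. \<forall>a\<in>gr A p. amul A (aone A) a = a \<and> amul A a (aone A) = a) \<and>
     gmap A A 1 (adiff A) \<and>
     (\<forall>p q. \<forall>a\<in>gr A p. \<forall>b\<in>gr A q.
        adiff A (amul A a b) = amul A (adiff A a) b + sg p (amul A a (adiff A b))) \<and>
     curv A \<in> gr A 2 \<and>
     adiff A (curv A) = 0 \<and>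
     (\<forall>p. \<forall>a\<in>gr A p. adiff A (adiff A a) = amul A (curv A) a - amul A a (curv A))"

definition cdg_module ::
    "('k::field, 'a::ab_group_add) cdg_alg \<Rightarrow> ('k, 'a, 'm::ab_group_add) cdg_mod \<Rightarrow> bool" where
  "cdg_module A M \<longleftrightarrow>
     graded_space M \<and>
     gbilinear A M M (act M) \<and>
     (\<forall>p q r. \<forall>a\<in>gr A p. \<forall>b\<in>gr A q. \<forall>m\<in>gr M r.
        act M (amul A a b) m = act M a (act M b m)) \<and>
     (\<forall>q. \<forall>m\<in>gr M q. act M (aone A) m = m) \<and>
     gmap M M 1 (mdiff M) \<and>
     (\<forall>p q. \<forall>a\<in>gr A p. \<forall>m\<in>gr M q.
        mdiff M (act M a m) = act M (adiff A a) m + sg p (act M a (mdiff M m))) \<and>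
     (\<forall>q. \<forall>m\<in>gr M q. mdiff M (mdiff M m) = act M (curv A) m)"


section \<open>Tensor products\<close>

text \<open>
  Over a field, \<open>V \<otimes> W\<close> embeds into the dual of the space of bilinear forms on \<open>V \<times> W\<close>,
  with \<open>x \<otimes> y\<close> going to evaluation at \<open>(x, y)\<close>; we take its image as the tensor product (see
  \<open>tens_universal\<close> below).  A form is bilinear if it is bilinear on each \<open>gr V p \<times> gr W q\<close>.
\<close>

definition fscale :: "'k::field \<Rightarrow> ('x \<Rightarrow> 'k) \<Rightarrow> ('x \<Rightarrow> 'k)" where
  "fscale c f = (\<lambda>x. c * f x)"

interpretation fs: vector_space "fscale :: 'k::field \<Rightarrow> ('x \<Rightarrow> 'k) \<Rightarrow> ('x \<Rightarrow> 'k)"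
  by unfold_locales (auto simp: fscale_def fun_eq_iff algebra_simps)

definition bilin_form :: "('k::field, 'v::ab_group_add, 'y) gspace_scheme \<Rightarrow>
    ('k, 'w::ab_group_add, 'z) gspace_scheme \<Rightarrow> ('v \<Rightarrow> 'w \<Rightarrow> 'k) \<Rightarrow> bool" where
  "bilin_form V W \<phi> \<longleftrightarrow>
     (\<forall>p q. \<forall>x\<in>gr V p. \<forall>x'\<in>gr V p. \<forall>y\<in>gr W q. \<forall>y'\<in>gr W q. \<forall>c.
        \<phi> (x + x') y = \<phi> x y + \<phi> x' y \<and> \<phi> (smult V c x) y = c * \<phi> x y \<and>
        \<phi> x (y + y') = \<phi> x y + \<phi> x y' \<and> \<phi> x (smult W c y) = c * \<phi> x y)"

definition tens :: "('k::field, 'v::ab_group_add, 'y) gspace_scheme \<Rightarrow>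
    ('k, 'w::ab_group_add, 'z) gspace_scheme \<Rightarrow> 'v \<Rightarrow> 'w \<Rightarrow> ('v \<Rightarrow> 'w \<Rightarrow> 'k) \<Rightarrow> 'k" where
  "tens V W x y = (\<lambda>\<phi>. if bilin_form V W \<phi> then \<phi> x y else 0)"

definition tensor :: "('k::field, 'v::ab_group_add, 'y) gspace_scheme \<Rightarrow>
    ('k, 'w::ab_group_add, 'z) gspace_scheme \<Rightarrow> ('k, ('v \<Rightarrow> 'w \<Rightarrow> 'k) \<Rightarrow> 'k) gspace" where
  "tensor V W =
     \<lparr>gr = (\<lambda>n. fs.span {tens V W x y | x y p q. x \<in> gr V p \<and> y \<in> gr W q \<and> p + q = n}),
      smult = fscale\<rparr>"

text \<open>
  \<open>tlift F\<close> is the linear map with \<open>x \<otimes> y \<mapsto> F x y\<close>, for bilinear \<open>F\<close> with values in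
  functionals (see \<open>tlift_tens\<close>).
\<close>

definition tlift :: "('v \<Rightarrow> 'w \<Rightarrow> 'x \<Rightarrow> 'k) \<Rightarrow> (('v \<Rightarrow> 'w \<Rightarrow> 'k) \<Rightarrow> 'k) \<Rightarrow> 'x \<Rightarrow> 'k" where
  "tlift F t = (\<lambda>\<psi>. t (\<lambda>x y. F x y \<psi>))"

text \<open>
  \<open>f \<otimes> g : V \<otimes> W \<rightarrow> V' \<otimes> W'\<close> for \<open>g\<close> homogeneous of degree \<open>r\<close>, with the Koszul sign
  \<open>(f \<otimes> g)(x \<otimes> y) = (-1)\<^bsup>r|x|\<^esup> f x \<otimes> g y\<close>.
\<close>

definition tmap :: "('k::field, 'v::ab_group_add, 'b) gspace_scheme \<Rightarrow>
    ('k, 'v'::ab_group_add, 'c) gspace_scheme \<Rightarrow> ('k, 'w'::ab_group_add, 'd) gspace_scheme \<Rightarrow>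
    int \<Rightarrow> ('v \<Rightarrow> 'v') \<Rightarrow> ('w \<Rightarrow> 'w') \<Rightarrow> (('v \<Rightarrow> 'w \<Rightarrow> 'k) \<Rightarrow> 'k) \<Rightarrow> ('v' \<Rightarrow> 'w' \<Rightarrow> 'k) \<Rightarrow> 'k" where
  "tmap V V' W' r f g = tlift (\<lambda>x y. sg (r * deg V x) (tens V' W' (f x) (g y)))"


section \<open>The bar construction\<close>

text \<open>
  \<open>BA\<close> is built in the same way, as the span of the evaluations of multilinear forms at
  words \<open>sa\<^sub>1 \<otimes> \<dots> \<otimes> sa\<^sub>n\<close>.  A letter \<open>sa\<close> is represented by \<open>a\<close> itself, so it has degree \<open>|a| - 1\<close>.
\<close>

definition multilin_form ::
    "('k::field, 'a::ab_group_add, 'z) gspace_scheme \<Rightarrow> ('a list \<Rightarrow> 'k) \<Rightarrow> bool" where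
  "multilin_form A \<phi> \<longleftrightarrow>
     (\<forall>u v p. set u \<union> set v \<subseteq> (\<Union>n. gr A n) \<longrightarrow>
        (\<forall>a\<in>gr A p. \<forall>b\<in>gr A p. \<forall>c.
           \<phi> (u @ (a + b) # v) = \<phi> (u @ a # v) + \<phi> (u @ b # v) \<and>
           \<phi> (u @ smult A c a # v) = c * \<phi> (u @ a # v)))"

definition word ::
    "('k::field, 'a::ab_group_add, 'z) gspace_scheme \<Rightarrow> 'a list \<Rightarrow> ('a list \<Rightarrow> 'k) \<Rightarrow> 'k" where
  "word A w = (\<lambda>\<phi>. if multilin_form A \<phi> then \<phi> w else 0)"

definition bar :: "('k::field, 'a::ab_group_add, 'z) gspace_scheme \<Rightarrow>
    ('k, ('a list \<Rightarrow> 'k) \<Rightarrow> 'k) gspace" where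
  "bar A =
     \<lparr>gr = (\<lambda>n. fs.span {word A w | w ns.
                  list_all2 (\<lambda>a p. a \<in> gr A p) w ns \<and> (\<Sum>p\<leftarrow>ns. p - 1) = n}),
      smult = fscale\<rparr>"

text \<open>The linear map on \<open>BA\<close> with given values on words (see \<open>bar_lift_word\<close>).\<close>

definition bar_lift :: "('a list \<Rightarrow> 'x \<Rightarrow> 'k) \<Rightarrow> (('a list \<Rightarrow> 'k) \<Rightarrow> 'k) \<Rightarrow> 'x \<Rightarrow> 'k" where
  "bar_lift F t = (\<lambda>\<psi>. t (\<lambda>w. F w \<psi>))"

definition bar_comult :: "('k::field, 'a::ab_group_add, 'z) gspace_scheme \<Rightarrow>
    (('a list \<Rightarrow> 'k) \<Rightarrow> 'k) \<Rightarrow>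
    ((('a list \<Rightarrow> 'k) \<Rightarrow> 'k) \<Rightarrow> (('a list \<Rightarrow> 'k) \<Rightarrow> 'k) \<Rightarrow> 'k) \<Rightarrow> 'k" where
  "bar_comult A = bar_lift (\<lambda>w. \<Sum>i\<le>length w.
     tens (bar A) (bar A) (word A (take i w)) (word A (drop i w)))"

text \<open>The components \<open>b\<^sub>n : (A[1])\<^bsup>\<otimes>n\<^esup> \<rightarrow> A[1]\<close>.\<close>

fun bar_b :: "('k, 'a::ab_group_add) cdg_alg \<Rightarrow> 'a list \<Rightarrow> 'a" where
  "bar_b A [] = curv A"
| "bar_b A [a] = - adiff A a"
| "bar_b A [a, b] = sg (deg A a + 1) (amul A a b)"
| "bar_b A (a # b # e # w) = 0"

definition wdeg :: "('k, 'a, 'z) gspace_scheme \<Rightarrow> 'a list \<Rightarrow> int" where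
  "wdeg A w = (\<Sum>a\<leftarrow>w. deg A a - 1)"

text \<open>
  The coderivation with components \<open>b\<^sub>n\<close> is \<open>\<Sum> 1\<^bsup>\<otimes>i\<^esup> \<otimes> b\<^sub>j \<otimes> 1\<^bsup>\<otimes>l\<^esup>\<close>; the sign is the Koszul sign
  of moving \<open>b\<^sub>j\<close>, of degree \<open>1\<close>, past the first \<open>i\<close> letters.
\<close>

definition bar_diff :: "('k::field, 'a::ab_group_add) cdg_alg \<Rightarrow>
    (('a list \<Rightarrow> 'k) \<Rightarrow> 'k) \<Rightarrow> ('a list \<Rightarrow> 'k) \<Rightarrow> 'k" where
  "bar_diff A = bar_lift (\<lambda>w. \<Sum>i\<le>length w. \<Sum>j\<le>length w - i.
     sg (wdeg A (take i w))
       (word A (take i w @ bar_b A (take j (drop i w)) # drop (i + j) w)))"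

text \<open>\<open>\<tau>\<^sub>A\<close>: the word-length-one part of \<open>t\<close> is \<open>sa\<close> for a unique homogeneous \<open>a\<close>.\<close>

definition bar_tau ::
    "('k::field, 'a::ab_group_add) cdg_alg \<Rightarrow> (('a list \<Rightarrow> 'k) \<Rightarrow> 'k) \<Rightarrow> 'a" where
  "bar_tau A t = (THE a. a \<in> (\<Union>n. gr A n) \<and>
     bar_lift (\<lambda>w. if length w = 1 then word A w else 0) t = word A [a])"


section \<open>The comodule of a module; bar acyclicity\<close>

abbreviation bar_mod :: "('k::field, 'a::ab_group_add) cdg_alg \<Rightarrow>
    ('k, 'a, 'm::ab_group_add) cdg_mod \<Rightarrow> _" where
  "bar_mod A M \<equiv> tensor (bar A) M"

text \<open>\<open>\<Delta> \<otimes> 1\<close>, with \<open>(BA \<otimes> BA) \<otimes> M\<close> reassociated to \<open>BA \<otimes> (BA \<otimes> M)\<close>.\<close>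

definition bar_coact where
  "bar_coact A M = tlift (\<lambda>x m.
     tlift (\<lambda>y z. tens (bar A) (bar_mod A M) y (tens (bar A) M z m)) (bar_comult A x))"

text \<open>
  The twisting term is \<open>(1 \<otimes> \<mu>)(1 \<otimes> \<tau> \<otimes> 1)(x \<otimes> y \<otimes> m) = (-1)\<^bsup>|x|\<^esup> x \<otimes> \<tau>(y) m\<close>, as \<open>\<tau>\<close> has degree \<open>1\<close>.
\<close>

definition bar_twist where
  "bar_twist A M = tlift (\<lambda>x. tlift (\<lambda>y m.
     sg (deg (bar A) x) (tens (bar A) M x (act M (bar_tau A y) m))))"

definition bar_mod_diff where
  "bar_mod_diff A M t =
     tmap (bar A) (bar A) M 0 (bar_diff A) id t + tmap (bar A) (bar A) M 1 id (mdiff M) t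
     - bar_twist A M (bar_coact A M t)"

definition comodule_map :: "('k::field, 'a::ab_group_add) cdg_alg \<Rightarrow>
    ('k, 'a, 'm::ab_group_add) cdg_mod \<Rightarrow> ('k, 'a, 'n::ab_group_add) cdg_mod \<Rightarrow> int \<Rightarrow> _ \<Rightarrow> bool" where
  "comodule_map A M N r h \<longleftrightarrow>
     gmap (bar_mod A M) (bar_mod A N) r h \<and>
     (\<forall>n. \<forall>t\<in>gr (bar_mod A M) n.
        bar_coact A N (h t) = tmap (bar A) (bar A) (bar_mod A N) r id h (bar_coact A M t))"

definition bar_acyclic ::
    "('k::field, 'a::ab_group_add) cdg_alg \<Rightarrow> ('k, 'a, 'm::ab_group_add) cdg_mod \<Rightarrow> bool" where
  "bar_acyclic A M \<longleftrightarrow>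
     (\<exists>h. comodule_map A M M (-1) h \<and>
        (\<forall>n. \<forall>t\<in>gr (bar_mod A M) n.
           h (bar_mod_diff A M t) + bar_mod_diff A M (h t) = t))"


section \<open>Categories and localization\<close>

text \<open>\<open>Cmp C X Y Z g f\<close> is the composite of \<open>f : X \<rightarrow> Y\<close> and \<open>g : Y \<rightarrow> Z\<close>.\<close>

record ('o, 'f) category =
  Obj :: "'o set"
  Hom :: "'o \<Rightarrow> 'o \<Rightarrow> 'f set"
  Ident :: "'o \<Rightarrow> 'f"
  Cmp :: "'o \<Rightarrow> 'o \<Rightarrow> 'o \<Rightarrow> 'f \<Rightarrow> 'f \<Rightarrow> 'f"

definition zero_object :: "('o, 'f) category \<Rightarrow> 'o \<Rightarrow> bool" where
  "zero_object C X \<longleftrightarrow>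
     X \<in> Obj C \<and> (\<forall>Y\<in>Obj C. (\<exists>!f. f \<in> Hom C X Y) \<and> (\<exists>!f. f \<in> Hom C Y X))"

definition zero_category :: "('o, 'f) category \<Rightarrow> bool" where
  "zero_category C \<longleftrightarrow> (\<forall>X\<in>Obj C. zero_object C X)"

text \<open>
  The localization of \<open>C\<close> at a class \<open>S\<close> of morphisms, after Gabriel and Zisman: morphisms are
  composable zigzags, listed from source to target, modulo the evident congruence.  \<open>Bwd X s Y\<close> is the
  formal inverse of \<open>s : X \<rightarrow> Y\<close>.
\<close>

datatype ('o, 'f) zstep = Fwd 'o 'f 'o | Bwd 'o 'f 'o

inductive zpath :: "('o, 'f) category \<Rightarrow> ('o \<Rightarrow> 'o \<Rightarrow> 'f set) \<Rightarrow> 'o \<Rightarrow> 'o \<Rightarrow> ('o, 'f) zstep list \<Rightarrow> bool"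
  for C S where
  nil: "X \<in> Obj C \<Longrightarrow> zpath C S X X []"
| fwd: "X \<in> Obj C \<Longrightarrow> Y \<in> Obj C \<Longrightarrow> f \<in> Hom C X Y \<Longrightarrow> zpath C S Y Z p \<Longrightarrow>
    zpath C S X Z (Fwd X f Y # p)"
| bwd: "X \<in> Obj C \<Longrightarrow> Y \<in> Obj C \<Longrightarrow> s \<in> S X Y \<Longrightarrow> zpath C S X Z p \<Longrightarrow>
    zpath C S Y Z (Bwd X s Y # p)"

inductive zeq :: "('o, 'f) category \<Rightarrow> ('o \<Rightarrow> 'o \<Rightarrow> 'f set) \<Rightarrow> 'o \<Rightarrow> 'o \<Rightarrow>
    ('o, 'f) zstep list \<Rightarrow> ('o, 'f) zstep list \<Rightarrow> bool"
  for C S where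
  refl: "zpath C S X Y p \<Longrightarrow> zeq C S X Y p p"
| sym: "zeq C S X Y p q \<Longrightarrow> zeq C S X Y q p"
| trans: "zeq C S X Y p q \<Longrightarrow> zeq C S X Y q r \<Longrightarrow> zeq C S X Y p r"
| append: "zeq C S X Y p q \<Longrightarrow> zeq C S Y Z p' q' \<Longrightarrow> zeq C S X Z (p @ p') (q @ q')"
| ident: "X \<in> Obj C \<Longrightarrow> zeq C S X X [Fwd X (Ident C X) X] []"
| cmp: "X \<in> Obj C \<Longrightarrow> Y \<in> Obj C \<Longrightarrow> Z \<in> Obj C \<Longrightarrow> f \<in> Hom C X Y \<Longrightarrow> g \<in> Hom C Y Z \<Longrightarrow>
    zeq C S X Z [Fwd X f Y, Fwd Y g Z] [Fwd X (Cmp C X Y Z g f) Z]"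
| inv_right: "X \<in> Obj C \<Longrightarrow> Y \<in> Obj C \<Longrightarrow> s \<in> S X Y \<Longrightarrow> zeq C S X X [Fwd X s Y, Bwd X s Y] []"
| inv_left: "X \<in> Obj C \<Longrightarrow> Y \<in> Obj C \<Longrightarrow> s \<in> S X Y \<Longrightarrow> zeq C S Y Y [Bwd X s Y, Fwd X s Y] []"

definition localization :: "('o, 'f) category \<Rightarrow> ('o \<Rightarrow> 'o \<Rightarrow> 'f set) \<Rightarrow>
    ('o, ('o, 'f) zstep list set) category" where
  "localization C S =
     \<lparr>Obj = Obj C,
      Hom = (\<lambda>X Y. {p. zpath C S X Y p} // {(p, q). zeq C S X Y p q}),
      Ident = (\<lambda>X. {p. zeq C S X X [] p}),
      Cmp = (\<lambda>X Y Z G F. {r. \<exists>p\<in>F. \<exists>q\<in>G. zeq C S X Z (p @ q) r})\<rparr>"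


section \<open>The homotopy category and the bar derived category\<close>

definition closed_map :: "('k::field, 'a::ab_group_add) cdg_alg \<Rightarrow>
    ('k, 'a, 'm::ab_group_add) cdg_mod \<Rightarrow> ('k, 'a, 'n::ab_group_add) cdg_mod \<Rightarrow> ('m \<Rightarrow> 'n) \<Rightarrow> bool" where
  "closed_map A M N f \<longleftrightarrow>
     gmap M N 0 f \<and>
     (\<forall>p q. \<forall>a\<in>gr A p. \<forall>m\<in>gr M q. f (act M a m) = act N a (f m)) \<and>
     (\<forall>q. \<forall>m\<in>gr M q. f (mdiff M m) = mdiff N (f m))"

text \<open>\<open>A\<close>-linearity of a map of degree \<open>-1\<close> involves the Koszul sign \<open>(-1)\<^bsup>|a|\<^esup>\<close>.\<close>

definition homotopic :: "('k::field, 'a::ab_group_add) cdg_alg \<Rightarrow>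
    ('k, 'a, 'm::ab_group_add) cdg_mod \<Rightarrow> ('k, 'a, 'n::ab_group_add) cdg_mod \<Rightarrow>
    ('m \<Rightarrow> 'n) \<Rightarrow> ('m \<Rightarrow> 'n) \<Rightarrow> bool" where
  "homotopic A M N f g \<longleftrightarrow>
     closed_map A M N f \<and> closed_map A M N g \<and>
     (\<exists>h. gmap M N (-1) h \<and>
        (\<forall>p q. \<forall>a\<in>gr A p. \<forall>m\<in>gr M q. h (act M a m) = sg p (act N a (h m))) \<and>
        (\<forall>q. \<forall>m\<in>gr M q. f m - g m = mdiff N (h m) + h (mdiff M m)))"

text \<open>
  The homotopy category of cdg modules.  All objects of one category are realised in one type \<open>'m\<close>;
  as \<open>'m\<close> is an arbitrary type of class \<open>ab_group_add\<close>, this amounts to fixing a universe.  (If the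
  group \<open>'m\<close> admits no \<open>k\<close>-vector space structure at all, there are no objects.)
\<close>

definition Mod_htpy :: "'m::ab_group_add itself \<Rightarrow> ('k::field, 'a::ab_group_add) cdg_alg \<Rightarrow>
    (('k, 'a, 'm) cdg_mod, ('m \<Rightarrow> 'm) set) category" where
  "Mod_htpy u A =
     \<lparr>Obj = {M. cdg_module A M},
      Hom = (\<lambda>M N. {f. closed_map A M N f} // {(f, g). homotopic A M N f g}),
      Ident = (\<lambda>M. {f. homotopic A M M id f}),
      Cmp = (\<lambda>L M N G F. {e. \<exists>f\<in>F. \<exists>g\<in>G. homotopic A L N (g \<circ> f) e})\<rparr>"

text \<open>
  The cone of \<open>f : M \<rightarrow> N\<close> is \<open>N \<oplus> M[1]\<close> with \<open>d(y, x) = (dy + f x, -dx)\<close> and \<open>a\<close> acting on \<open>M[1]\<close>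
  as \<open>(-1)\<^bsup>|a|\<^esup> a\<close>.
\<close>

definition cdg_cone :: "('k::field, 'a::ab_group_add) cdg_alg \<Rightarrow>
    ('k, 'a, 'm::ab_group_add) cdg_mod \<Rightarrow> ('k, 'a, 'n::ab_group_add) cdg_mod \<Rightarrow> ('m \<Rightarrow> 'n) \<Rightarrow>
    ('k, 'a, 'n \<times> 'm) cdg_mod" where
  "cdg_cone A M N f =
     \<lparr>gr = (\<lambda>n. gr N n \<times> gr M (n + 1)),
      smult = (\<lambda>c (y, x). (smult N c y, smult M c x)),
      act = (\<lambda>a (y, x). (act N a y, sg (deg A a) (act M a x))),
      mdiff = (\<lambda>(y, x). (mdiff N y + f x, - mdiff M x))\<rparr>"

text \<open>
  The Verdier quotient by a triangulated subcategory is the localization at the morphisms whose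
  cone lies in the subcategory.
\<close>

definition D_bar :: "'m::ab_group_add itself \<Rightarrow> ('k::field, 'a::ab_group_add) cdg_alg \<Rightarrow>
    (('k, 'a, 'm) cdg_mod, (('k, 'a, 'm) cdg_mod, ('m \<Rightarrow> 'm) set) zstep list set) category" where
  "D_bar u A = localization (Mod_htpy u A)
     (\<lambda>M N. {F \<in> Hom (Mod_htpy u A) M N. \<exists>f\<in>F. bar_acyclic A (cdg_cone A M N f)})"


section \<open>Sanity of the tensor model\<close>

lemma tlift_tens:
  assumes "\<And>\<psi>. bilin_form V W (\<lambda>x y. F x y \<psi>)"
  shows "tlift F (tens V W x y) = F x y"
  using assms by (simp add: tlift_def tens_def)

lemma bar_lift_word:
  assumes "\<And>\<psi>. multilin_form A (\<lambda>w. F w \<psi>)"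
  shows "bar_lift F (word A w) = F w"
  using assms by (simp add: bar_lift_def word_def)

lemma linear_form_separates:
  fixes s :: "'k::field \<Rightarrow> 'u::ab_group_add \<Rightarrow> 'u"
  assumes "vector_space s" and "z \<noteq> 0"
  shows "\<exists>l. Vector_Spaces.linear s (*) l \<and> l z = (1::'k)"
proof -
  interpret V: vector_space s by fact
  interpret K: vector_space "(*) :: 'k \<Rightarrow> 'k \<Rightarrow> 'k"
    by unfold_locales (auto simp: algebra_simps)
  interpret P: vector_space_pair s "(*) :: 'k \<Rightarrow> 'k \<Rightarrow> 'k" ..
  have "V.independent {z}" using assms(2) by simp
  from P.linear_independent_extend[OF this, of "\<lambda>_. 1"] show ?thesis by auto
qed

text \<open>Every bilinear map factors through \<open>tens\<close>: it respects all linear relations between tensors.\<close>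

lemma tens_universal:
  fixes V :: "('k::field, 'v::ab_group_add, 'y) gspace_scheme"
    and U :: "('k, 'u::ab_group_add, 'x) gspace_scheme"
  assumes U: "vector_space (smult U)" and \<beta>: "gbilinear V W U \<beta>"
    and rel: "(\<Sum>i\<in>I. fscale (c i) (tens V W (x i) (y i))) = 0"
  shows "(\<Sum>i\<in>I. smult U (c i) (\<beta> (x i) (y i))) = 0"
proof (rule ccontr)
  assume "(\<Sum>i\<in>I. smult U (c i) (\<beta> (x i) (y i))) \<noteq> 0" (is "?z \<noteq> 0")
  then obtain l where l: "Vector_Spaces.linear (smult U) (*) l" and lz: "l ?z = (1::'k)"
    using linear_form_separates[OF U] by blast
  interpret l: Vector_Spaces.linear "smult U" "(*)" l by fact
  have b: "bilin_form V W (\<lambda>x y. l (\<beta> x y))"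
    using \<beta> unfolding bilin_form_def gbilinear_def gmap_def by (auto simp: l.add l.scale)
  have ev: "(\<Sum>i\<in>J. h i) \<phi> = (\<Sum>i\<in>J. h i \<phi>)" for J \<phi> and h :: "_ \<Rightarrow> ('v \<Rightarrow> 'w \<Rightarrow> 'k) \<Rightarrow> 'k"
    by (induction J rule: infinite_finite_induct) auto
  have "(\<Sum>i\<in>I. fscale (c i) (tens V W (x i) (y i))) (\<lambda>x y. l (\<beta> x y)) = l ?z"
    using b by (simp add: ev fscale_def tens_def l.sum l.scale)
  with rel lz show False by simp
qed

end

theory Submission
  imports Defs
begin


text \<open>
  A localization vanishes as soon as it inverts the zero endomorphism of every object, because an
  invertible idempotent is an identity.  In the bar derived category the zero endomorphism of \<open>M\<close> is
  inverted if its cone \<open>M \<oplus> M[1]\<close> is bar acyclic.  So it suffices that \<^emph>\<open>every\<close> cdg module over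
  an algebra with non-zero curvature \<open>c\<close> is bar acyclic (\<open>bar_acyclic_of_curvature\<close>).

  To see this, choose a linear functional \<open>\<xi>\<close> on \<open>A\<close> that is supported in degree \<open>2\<close> and has
  \<open>\<xi>(c) = 1\<close>.  Cutting off the last letter with \<open>\<xi>\<close>,
  \<open>h(a\<^sub>1 \<dots> a\<^sub>n \<otimes> m) = \<plusminus> \<xi>(a\<^sub>n) a\<^sub>1 \<dots> a\<^bsub>n-1\<^esub> \<otimes> m\<close>, is a comodule map of degree \<open>-1\<close>.  Since the
  codifferential \<open>d\<close> inserts \<open>c\<close> in all places of a word, in particular in the last one, the
  operator \<open>G = dh + hd\<close> contains the summand \<open>\<xi>(c) 1 = 1\<close>.  The other summands in which no letter is
  lost cancel, so that \<open>1 - G\<close> shortens words and is locally nilpotent.  Hence \<open>G\<close> is invertible, its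
  inverse \<open>P\<close> is again a comodule map, and \<open>P\<close> commutes with \<open>d\<close> because \<open>G\<close> does, by \<open>d\<^sup>2 = 0\<close>.
  Therefore \<open>hP\<close> is a contraction: \<open>d(hP) + (hP)d = (dh + hd)P = 1\<close>.

  The computations are organised by prepending a letter to a word.  The codifferential, the
  comultiplication and \<open>h\<close> all satisfy a recursion on the first letter (\<open>d_L\<close>, \<open>coact_L\<close>, \<open>h_L\<close>), and
  the identities \<open>d\<^sup>2 = 0\<close>, \<open>G(1 \<otimes> m) = 1 \<otimes> m\<close>, \<open>G(a t) = a G(t) + 1 \<otimes> m'\<close> and the compatibility with
  the coaction follow from these recursions by induction on words, without sums over positions.
\<close>

section \<open>Signs and linear maps between spaces of functionals\<close>

text \<open>
  Functionals are treated as vectors throughout; evaluating sums of them pointwise would hide the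
  linear combinations that the rewriting works with.
\<close>

declare plus_fun_apply [simp del] zero_fun_apply [simp del] minus_apply [simp del]
  uminus_apply [simp del]

lemmas fun_simps = plus_fun_apply zero_fun_apply minus_apply uminus_apply

lemma sg_zero [simp]: "sg n 0 = 0"
  by (simp add: sg_def)

lemma sg_sg [simp]: "sg m (sg n x) = sg (m + n) x"
  by (simp add: sg_def)

lemma sg_zero_left [simp]: "sg 0 x = x"
  by (simp add: sg_def)

lemma sg_distrib: "sg n (x + y) = sg n x + sg n y"
  by (simp add: sg_def)

lemma sg_fscale: "sg n (fscale c f) = fscale c (sg n f)"
  by (simp add: sg_def fscale_def fun_eq_iff fun_simps)

text \<open>
  Tensor products and \<open>BA\<close> are spaces of functionals, and an operator made from \<open>tlift\<close> and
  \<open>bar_lift\<close> is linear on \<^emph>\<open>all\<close> functionals, whether or not the map it is made from is multilinear.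
  Thus two such operators agree on a homogeneous component once they agree on generators;
  multilinearity is only needed for the values on generators.
\<close>

definition lin :: "(('x \<Rightarrow> 'k::field) \<Rightarrow> ('y \<Rightarrow> 'k)) \<Rightarrow> bool" where
  "lin f \<longleftrightarrow> (\<forall>s t. f (s + t) = f s + f t) \<and> (\<forall>c t. f (fscale c t) = fscale c (f t))"

lemma lin_add: "lin f \<Longrightarrow> f (s + t) = f s + f t"
  by (simp add: lin_def)

lemma lin_scale: "lin f \<Longrightarrow> f (fscale c t) = fscale c (f t)"
  by (simp add: lin_def)

lemma lin_zero: "lin f \<Longrightarrow> f 0 = 0"
  using lin_add[of f 0 0] by simp

lemma lin_minus: "lin f \<Longrightarrow> f (- t) = - f t"
  using lin_add[of f t "- t"] lin_zero[of f] by (simp add: eq_neg_iff_add_eq_0 add.commute)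

lemma lin_diff: "lin f \<Longrightarrow> f (s - t) = f s - f t"
  using lin_add[of f s "- t"] lin_minus[of f t] by simp

lemma lin_sg: "lin f \<Longrightarrow> f (sg n t) = sg n (f t)"
  using lin_minus[of f t] by (simp add: sg_def)

lemma lin_sum:
  assumes "lin f"
  shows "f (\<Sum>i\<in>I. t i) = (\<Sum>i\<in>I. f (t i))"
  by (induction I rule: infinite_finite_induct) (simp_all add: lin_zero[OF assms] lin_add[OF assms])

lemmas lin_simps = lin_add lin_scale lin_zero lin_minus lin_diff lin_sg lin_sum

lemma lin_ident: "lin (\<lambda>t. t)"
  by (simp add: lin_def)

lemma lin_null: "lin (\<lambda>t. 0)"
  by (simp add: lin_def)

lemma lin_compose: "lin f \<Longrightarrow> lin g \<Longrightarrow> lin (\<lambda>t. f (g t))"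
  by (simp add: lin_def)

lemma lin_plus: "lin f \<Longrightarrow> lin g \<Longrightarrow> lin (\<lambda>t. f t + g t)"
  by (simp add: lin_def fs.scale_right_distrib)

lemma lin_sub: "lin f \<Longrightarrow> lin g \<Longrightarrow> lin (\<lambda>t. f t - g t)"
  by (simp add: lin_def fs.scale_right_diff_distrib)

lemma lin_sgn: "lin f \<Longrightarrow> lin (\<lambda>t. sg n (f t))"
  by (simp add: lin_def sg_distrib sg_fscale)

lemma lin_fscale: "lin f \<Longrightarrow> lin (\<lambda>t. fscale c (f t))"
  by (simp add: lin_def fs.scale_right_distrib mult.commute)

lemma lin_tlift: "lin (tlift F)"
  by (simp add: lin_def tlift_def fscale_def fun_eq_iff fun_simps)

lemma lin_bar_lift: "lin (bar_lift F)"
  by (simp add: lin_def bar_lift_def fscale_def fun_eq_iff fun_simps)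

lemma lin_tmap: "lin (tmap V V' W' r f g)"
  unfolding tmap_def by (rule lin_tlift)

lemmas lin_intros = lin_ident lin_null lin_compose lin_plus lin_sub lin_sgn lin_fscale
  lin_tlift lin_bar_lift lin_tmap

lemma lin_eq_on_span:
  assumes f: "lin f" and g: "lin g" and "\<And>x. x \<in> S \<Longrightarrow> f x = g x" and "t \<in> fs.span S"
  shows "f t = g t"
  using assms(4)
  by (induction rule: fs.span_induct_alt) (simp_all only: assms(3) lin_simps[OF f] lin_simps[OF g])

lemma lin_span_mem:
  assumes f: "lin f" and "\<And>x. x \<in> S \<Longrightarrow> f x \<in> fs.span T" and "t \<in> fs.span S"
  shows "f t \<in> fs.span T"
  using assms(3)
  by (induction rule: fs.span_induct_alt)
    (simp_all only: assms(2) lin_simps[OF f] fs.span_zero fs.span_add fs.span_scale)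

lemma span_sg: "x \<in> fs.span S \<Longrightarrow> sg n x \<in> fs.span S"
  by (simp add: sg_def fs.span_neg)


section \<open>Graded spaces and tensors\<close>

definition homog :: "('k, 'v, 'z) gspace_scheme \<Rightarrow> 'v set" where
  "homog V = (\<Union>n. gr V n)"

lemma homogI: "x \<in> gr V n \<Longrightarrow> x \<in> homog V"
  by (auto simp: homog_def)

lemma homogE: assumes "x \<in> homog V" obtains n where "x \<in> gr V n"
  using assms by (auto simp: homog_def)

lemma
  assumes "graded_space V"
  shows gr_zero: "0 \<in> gr V n"
    and gr_add: "x \<in> gr V n \<Longrightarrow> y \<in> gr V n \<Longrightarrow> x + y \<in> gr V n"
    and gr_scale: "x \<in> gr V n \<Longrightarrow> smult V c x \<in> gr V n"
    and gr_neg: "x \<in> gr V n \<Longrightarrow> - x \<in> gr V n"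
    and gr_diff: "x \<in> gr V n \<Longrightarrow> y \<in> gr V n \<Longrightarrow> x - y \<in> gr V n"
    and gr_sg: "x \<in> gr V n \<Longrightarrow> sg r x \<in> gr V n"
    and smult_neg: "smult V (- 1) x = - x"
proof -
  interpret vector_space "smult V" using assms by (simp add: graded_space_def)
  have s: "subspace (gr V n)" for n using assms by (simp add: graded_space_def)
  show "0 \<in> gr V n" by (rule subspace_0[OF s])
  show "x \<in> gr V n \<Longrightarrow> y \<in> gr V n \<Longrightarrow> x + y \<in> gr V n" by (rule subspace_add[OF s])
  show "x \<in> gr V n \<Longrightarrow> smult V c x \<in> gr V n" by (rule subspace_scale[OF s])
  show neg: "x \<in> gr V n \<Longrightarrow> - x \<in> gr V n" by (rule subspace_neg[OF s])
  show "x \<in> gr V n \<Longrightarrow> y \<in> gr V n \<Longrightarrow> x - y \<in> gr V n" by (rule subspace_diff[OF s])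
  show "x \<in> gr V n \<Longrightarrow> sg r x \<in> gr V n" by (simp add: sg_def neg)
  show "smult V (- 1) x = - x" by simp
qed

lemma gr_unique:
  assumes V: "graded_space V" and x: "x \<in> gr V p" "x \<in> gr V q" "x \<noteq> 0"
  shows "p = q"
proof (rule ccontr)
  assume ne: "p \<noteq> q"
  let ?x = "\<lambda>n. if n = p then x else - x"
  have "\<forall>I x. finite I \<longrightarrow> (\<forall>n\<in>I. x n \<in> gr V n) \<longrightarrow> (\<Sum>n\<in>I. x n) = 0 \<longrightarrow> (\<forall>n\<in>I. x n = 0)"
    using V unfolding graded_space_def by blast
  then have *: "finite {p, q} \<longrightarrow> (\<forall>n\<in>{p, q}. ?x n \<in> gr V n) \<longrightarrow> (\<Sum>n\<in>{p, q}. ?x n) = 0 \<longrightarrow>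
      (\<forall>n\<in>{p, q}. ?x n = 0)" by (elim allE)
  have "\<forall>n\<in>{p, q}. ?x n \<in> gr V n" using x(1,2) gr_neg[OF V x(2)] by simp
  moreover have "(\<Sum>n\<in>{p, q}. ?x n) = 0" using ne by simp
  ultimately have "\<forall>n\<in>{p, q}. ?x n = 0" using * by blast
  then show False using x(3) by auto
qed

lemma deg_eq: "graded_space V \<Longrightarrow> x \<in> gr V p \<Longrightarrow> x \<noteq> 0 \<Longrightarrow> deg V x = p"
  unfolding deg_def by (rule the_equality) (auto intro: gr_unique)

lemma gmapD:
  assumes "gmap V W r f" "x \<in> gr V n"
  shows "f x \<in> gr W (n + r)" "y \<in> gr V n \<Longrightarrow> f (x + y) = f x + f y"
    "f (smult V c x) = smult W c (f x)"
  using assms by (auto simp: gmap_def)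

lemma gmap_zero: "gmap V W r f \<Longrightarrow> 0 \<in> gr V n \<Longrightarrow> f 0 = 0"
  using gmapD(2)[of V W r f 0 n 0] by simp

lemma gmap_neg: "gmap V W r f \<Longrightarrow> graded_space V \<Longrightarrow> x \<in> gr V n \<Longrightarrow> f (- x) = - f x"
  using gmapD(2)[of V W r f x n "- x"] gmap_zero[of V W r f n] gr_neg[of V x n] gr_zero[of V n]
  by (simp add: eq_neg_iff_add_eq_0 add.commute)

lemma gmap_sg: "gmap V W r f \<Longrightarrow> graded_space V \<Longrightarrow> x \<in> gr V n \<Longrightarrow> f (sg s x) = sg s (f x)"
  by (simp add: sg_def gmap_neg)

lemma gmap_id: "gmap V V 0 id"
  by (simp add: gmap_def)

lemma tens_add_left:
  "x \<in> gr V p \<Longrightarrow> x' \<in> gr V p \<Longrightarrow> y \<in> gr W q \<Longrightarrow> tens V W (x + x') y = tens V W x y + tens V W x' y"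
  by (auto simp: tens_def fun_eq_iff fun_simps bilin_form_def)

lemma tens_scale_left:
  "x \<in> gr V p \<Longrightarrow> y \<in> gr W q \<Longrightarrow> tens V W (smult V c x) y = fscale c (tens V W x y)"
  by (auto simp: tens_def fun_eq_iff fun_simps bilin_form_def fscale_def)

lemma tens_add_right:
  "x \<in> gr V p \<Longrightarrow> y \<in> gr W q \<Longrightarrow> y' \<in> gr W q \<Longrightarrow> tens V W x (y + y') = tens V W x y + tens V W x y'"
  by (auto simp: tens_def fun_eq_iff fun_simps bilin_form_def)

lemma tens_scale_right:
  "x \<in> gr V p \<Longrightarrow> y \<in> gr W q \<Longrightarrow> tens V W x (smult W c y) = fscale c (tens V W x y)"
  by (auto simp: tens_def fun_eq_iff fun_simps bilin_form_def fscale_def)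

lemma tens_zero_left: "0 \<in> gr V p \<Longrightarrow> y \<in> gr W q \<Longrightarrow> tens V W 0 y = 0"
  using tens_add_left[of 0 V p 0 y W q] by simp

lemma tens_zero_right: "x \<in> gr V p \<Longrightarrow> 0 \<in> gr W q \<Longrightarrow> tens V W x 0 = 0"
  using tens_add_right[of x V p 0 W q 0] by simp

lemma gr_tensor:
  "gr (tensor V W) n = fs.span {tens V W x y | x y p q. x \<in> gr V p \<and> y \<in> gr W q \<and> p + q = n}"
  by (simp add: tensor_def)

lemma smult_tensor [simp]: "smult (tensor V W) = fscale"
  by (simp add: tensor_def)

lemma tens_in_gr: "x \<in> gr V p \<Longrightarrow> y \<in> gr W q \<Longrightarrow> tens V W x y \<in> gr (tensor V W) (p + q)"
  unfolding gr_tensor by (rule fs.span_base) blast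

lemma tensor_zero: "0 \<in> gr (tensor V W) n"
  by (simp add: gr_tensor fs.span_zero)

lemma tensor_eqI:
  assumes "t \<in> gr (tensor V W) n" "lin f" "lin g"
    and "\<And>x y p q. x \<in> gr V p \<Longrightarrow> y \<in> gr W q \<Longrightarrow> f (tens V W x y) = g (tens V W x y)"
  shows "f t = g t"
  using assms(1) unfolding gr_tensor
  by (rule lin_eq_on_span[OF assms(2,3), rotated]) (use assms(4) in blast)

lemma lin_gmap:
  assumes "lin f" "\<And>n t. t \<in> gr (tensor V W) n \<Longrightarrow> f t \<in> gr (tensor V' W') (n + r)"
  shows "gmap (tensor V W) (tensor V' W') r f"
  using assms(2) by (auto simp: gmap_def lin_simps[OF assms(1)])

definition bilinear_map :: "('k::field, 'v::ab_group_add, 'y) gspace_scheme \<Rightarrow>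
    ('k, 'w::ab_group_add, 'z) gspace_scheme \<Rightarrow> ('v \<Rightarrow> 'w \<Rightarrow> 'x \<Rightarrow> 'k) \<Rightarrow> bool" where
  "bilinear_map V W F \<longleftrightarrow>
     (\<forall>p q. \<forall>x\<in>gr V p. \<forall>y\<in>gr W q.
        (\<forall>x'\<in>gr V p. F (x + x') y = F x y + F x' y) \<and>
        (\<forall>c. F (smult V c x) y = fscale c (F x y)) \<and>
        (\<forall>y'\<in>gr W q. F x (y + y') = F x y + F x y') \<and>
        (\<forall>c. F x (smult W c y) = fscale c (F x y)))"

lemma tlift_bilinear: "bilinear_map V W F \<Longrightarrow> tlift F (tens V W x y) = F x y"
  by (rule tlift_tens)
    (unfold bilinear_map_def bilin_form_def, simp add: fscale_def fun_simps)

lemma bilinear_mapI: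
  assumes "\<And>p q x x' y. x \<in> gr V p \<Longrightarrow> x' \<in> gr V p \<Longrightarrow> y \<in> gr W q \<Longrightarrow> F (x + x') y = F x y + F x' y"
    and "\<And>p q x y c. x \<in> gr V p \<Longrightarrow> y \<in> gr W q \<Longrightarrow> F (smult V c x) y = fscale c (F x y)"
    and "\<And>p q x y y'. x \<in> gr V p \<Longrightarrow> y \<in> gr W q \<Longrightarrow> y' \<in> gr W q \<Longrightarrow> F x (y + y') = F x y + F x y'"
    and "\<And>p q x y c. x \<in> gr V p \<Longrightarrow> y \<in> gr W q \<Longrightarrow> F x (smult W c y) = fscale c (F x y)"
  shows "bilinear_map V W F"
  using assms unfolding bilinear_map_def by blast

lemma sg_deg_tens:
  assumes "graded_space V" "x \<in> gr V p" "y \<in> gr W q"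
  shows "sg (r * deg V x) (tens V W x y) = sg (r * p) (tens V W x y)"
  using assms tens_zero_left[of V p y W q] by (cases "x = 0") (auto simp: deg_eq)

text \<open>
  The sign involves \<open>deg V x\<close>, which is unspecified at \<open>x = 0\<close>; this does no harm as the tensor it
  multiplies is then zero.
\<close>

lemma tmap_tens:
  assumes V: "graded_space V" and f: "gmap V V' e f" and g: "gmap W W' s g"
    and x: "x \<in> gr V p" and y: "y \<in> gr W q"
  shows "tmap V V' W' r f g (tens V W x y) = sg (r * p) (tens V' W' (f x) (g y))"
proof -
  let ?F = "\<lambda>x y. sg (r * deg V x) (tens V' W' (f x) (g y))"
  have F: "?F x y = sg (r * p) (tens V' W' (f x) (g y))"
    if "x \<in> gr V p" "y \<in> gr W q" for x y p q
  proof (cases "x = 0")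
    case True
    then show ?thesis
      using tens_zero_left[of V' "p + e" "g y" W' "q + s"] gmap_zero[OF f] gmapD(1)[OF f that(1)]
        gmapD(1)[OF g that(2)] that by simp
  qed (simp add: deg_eq[OF V that(1)])
  have "bilinear_map V W ?F"
  proof (rule bilinear_mapI)
    fix p q x x' y assume *: "x \<in> gr V p" "x' \<in> gr V p" "y \<in> gr W q"
    show "?F (x + x') y = ?F x y + ?F x' y"
      unfolding F[OF gr_add[OF V *(1,2)] *(3)] F[OF *(1,3)] F[OF *(2,3)]
      by (simp only: gmapD(2)[OF f *(1,2)] tens_add_left[OF gmapD(1)[OF f *(1)] gmapD(1)[OF f *(2)] gmapD(1)[OF g *(3)]]
          sg_distrib)
  next
    fix p q x y c assume *: "x \<in> gr V p" "y \<in> gr W q"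
    show "?F (smult V c x) y = fscale c (?F x y)"
      unfolding F[OF gr_scale[OF V *(1)] *(2)] F[OF *]
      by (simp only: gmapD(3)[OF f *(1)] tens_scale_left[OF gmapD(1)[OF f *(1)] gmapD(1)[OF g *(2)]] sg_fscale)
    show "?F x (smult W c y) = fscale c (?F x y)"
      unfolding gmapD(3)[OF g *(2)]
      by (simp only: tens_scale_right[OF gmapD(1)[OF f *(1)] gmapD(1)[OF g *(2)]] sg_fscale)
  next
    fix p q x y y' assume *: "x \<in> gr V p" "y \<in> gr W q" "y' \<in> gr W q"
    show "?F x (y + y') = ?F x y + ?F x y'"
      unfolding gmapD(2)[OF g *(2,3)]
      by (simp only: tens_add_right[OF gmapD(1)[OF f *(1)] gmapD(1)[OF g *(2)] gmapD(1)[OF g *(3)]]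
          sg_distrib)
  qed
  then show ?thesis unfolding tmap_def by (simp only: tlift_bilinear F[OF x y])
qed


section \<open>Words and the bar construction\<close>

text \<open>
  A relation instead of the function \<open>wdeg\<close>: the letter \<open>0\<close> is homogeneous of every degree, and it
  does occur, as a value of the differential or of a product.
\<close>

inductive hword :: "('k, 'a, 'z) gspace_scheme \<Rightarrow> 'a list \<Rightarrow> int \<Rightarrow> bool" for A where
  hword_Nil: "hword A [] 0"
| hword_Cons: "a \<in> gr A p \<Longrightarrow> hword A w n \<Longrightarrow> hword A (a # w) (p - 1 + n)"

lemma hword_iff:
  "hword A w n \<longleftrightarrow> (\<exists>ns. list_all2 (\<lambda>a p. a \<in> gr A p) w ns \<and> (\<Sum>p\<leftarrow>ns. p - 1) = n)"
proof
  assume "hword A w n"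
  then show "\<exists>ns. list_all2 (\<lambda>a p. a \<in> gr A p) w ns \<and> (\<Sum>p\<leftarrow>ns. p - 1) = n"
  proof induction
    case (hword_Cons a p w n)
    then obtain ns where "list_all2 (\<lambda>a p. a \<in> gr A p) w ns" "(\<Sum>p\<leftarrow>ns. p - 1) = n" by blast
    with hword_Cons(1) show ?case by (intro exI[of _ "p # ns"]) simp
  qed simp
next
  assume "\<exists>ns. list_all2 (\<lambda>a p. a \<in> gr A p) w ns \<and> (\<Sum>p\<leftarrow>ns. p - 1) = n"
  then obtain ns where "list_all2 (\<lambda>a p. a \<in> gr A p) w ns" "(\<Sum>p\<leftarrow>ns. p - 1) = n" by blast
  then show "hword A w n"
    by (induction arbitrary: n rule: list_all2_induct) (auto intro: hword.intros)
qed

lemma gr_bar: "gr (bar A) n = fs.span {word A w | w. hword A w n}"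
proof -
  have "{word A w | w. hword A w n} =
      {word A w | w ns. list_all2 (\<lambda>a p. a \<in> gr A p) w ns \<and> (\<Sum>p\<leftarrow>ns. p - 1) = n}"
    unfolding hword_iff by blast
  then show ?thesis by (simp add: bar_def)
qed

lemma smult_bar [simp]: "smult (bar A) = fscale"
  by (simp add: bar_def)

lemma word_in_gr: "hword A w n \<Longrightarrow> word A w \<in> gr (bar A) n"
  unfolding gr_bar by (rule fs.span_base) blast

lemma hword_homog: "hword A w n \<Longrightarrow> set w \<subseteq> homog A"
  by (induction rule: hword.induct) (auto intro: homogI)

lemma homog_hword: "set w \<subseteq> homog A \<Longrightarrow> \<exists>n. hword A w n"
  by (induction w) (auto intro: hword.intros elim!: homogE)

lemma hword_single: "a \<in> gr A p \<Longrightarrow> hword A [a] (p - 1)"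
  using hword_Cons[OF _ hword_Nil] by fastforce

text \<open>
  The condition under which \<open>bar_lift\<close> has prescribed values on words.
\<close>

definition multilinear :: "('k::field, 'a::ab_group_add, 'z) gspace_scheme \<Rightarrow>
    ('a list \<Rightarrow> 'x \<Rightarrow> 'k) \<Rightarrow> bool" where
  "multilinear A F \<longleftrightarrow>
     (\<forall>u v p. set u \<subseteq> homog A \<longrightarrow> set v \<subseteq> homog A \<longrightarrow>
        (\<forall>a\<in>gr A p. \<forall>b\<in>gr A p. F (u @ (a + b) # v) = F (u @ a # v) + F (u @ b # v)) \<and>
        (\<forall>a\<in>gr A p. \<forall>c. F (u @ smult A c a # v) = fscale c (F (u @ a # v))))"

lemma multilinearI:
  assumes "\<And>u v p a b. set u \<subseteq> homog A \<Longrightarrow> set v \<subseteq> homog A \<Longrightarrow> a \<in> gr A p \<Longrightarrow> b \<in> gr A p \<Longrightarrow>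
      F (u @ (a + b) # v) = F (u @ a # v) + F (u @ b # v)"
    and "\<And>u v p a c. set u \<subseteq> homog A \<Longrightarrow> set v \<subseteq> homog A \<Longrightarrow> a \<in> gr A p \<Longrightarrow>
      F (u @ smult A c a # v) = fscale c (F (u @ a # v))"
  shows "multilinear A F"
  using assms unfolding multilinear_def by blast

lemma multilinearD:
  assumes "multilinear A F" "set u \<subseteq> homog A" "set v \<subseteq> homog A" "a \<in> gr A p"
  shows "b \<in> gr A p \<Longrightarrow> F (u @ (a + b) # v) = F (u @ a # v) + F (u @ b # v)"
    and "F (u @ smult A c a # v) = fscale c (F (u @ a # v))"
  using assms unfolding multilinear_def by blast+

lemma bar_lift_multilinear: "multilinear A F \<Longrightarrow> bar_lift F (word A w) = F w"
  by (rule bar_lift_word)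
    (unfold multilinear_def multilin_form_def homog_def, simp add: fscale_def fun_simps)

lemma multilinear_word: "multilinear A (word A)"
  by (rule multilinearI)
    (auto simp: word_def fun_eq_iff fun_simps fscale_def multilin_form_def homog_def)

lemma multilinear_plus: "multilinear A F \<Longrightarrow> multilinear A G \<Longrightarrow> multilinear A (\<lambda>w. F w + G w)"
  by (simp add: multilinear_def fs.scale_right_distrib)

lemma multilinear_sub: "multilinear A F \<Longrightarrow> multilinear A G \<Longrightarrow> multilinear A (\<lambda>w. F w - G w)"
  by (simp add: multilinear_def fs.scale_right_diff_distrib)

lemma multilinear_lin: "lin f \<Longrightarrow> multilinear A F \<Longrightarrow> multilinear A (\<lambda>w. f (F w))"
  by (simp add: multilinear_def lin_def)

lemma multilinear_append: 
  assumes "multilinear A F" "set x \<subseteq> homog A"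
  shows "multilinear A (\<lambda>w. F (x @ w))"
  using assms multilinearD[OF assms(1), of "x @ u" for u]
  by (intro multilinearI) (simp_all del: append_assoc add: append_assoc[symmetric])

lemma word_zero:
  assumes A: "graded_space A" and "set u \<subseteq> homog A" "set v \<subseteq> homog A"
  shows "word A (u @ 0 # v) = 0"
  using multilinearD(1)[OF multilinear_word assms(2,3), of 0 _ 0] gr_zero[OF A] by simp

text \<open>
  Multilinearity of a function defined by recursion on the first letter: the recursive call may be
  fed into an operator \<open>K a\<close> that depends linearly on that letter.
\<close>

lemma multilinear_rec:
  assumes step: "\<And>a w. a \<in> homog A \<Longrightarrow> set w \<subseteq> homog A \<Longrightarrow> F (a # w) = K a (F w) + R a w"
    and K: "\<And>a. a \<in> homog A \<Longrightarrow> lin (K a)"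
    and K_add: "\<And>p a b w. a \<in> gr A p \<Longrightarrow> b \<in> gr A p \<Longrightarrow> set w \<subseteq> homog A \<Longrightarrow>
        K (a + b) (F w) = K a (F w) + K b (F w)"
    and K_scale: "\<And>p a c w. a \<in> gr A p \<Longrightarrow> set w \<subseteq> homog A \<Longrightarrow>
        K (smult A c a) (F w) = fscale c (K a (F w))"
    and R: "\<And>a. a \<in> homog A \<Longrightarrow> multilinear A (R a)"
    and R_add: "\<And>p a b w. a \<in> gr A p \<Longrightarrow> b \<in> gr A p \<Longrightarrow> set w \<subseteq> homog A \<Longrightarrow>
        R (a + b) w = R a w + R b w"
    and R_scale: "\<And>p a c w. a \<in> gr A p \<Longrightarrow> set w \<subseteq> homog A \<Longrightarrow>
        R (smult A c a) w = fscale c (R a w)"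
    and A: "graded_space A"
  shows "multilinear A F"
proof (rule multilinearI)
  fix u v p a b
  assume "set u \<subseteq> homog A" and v: "set v \<subseteq> homog A" and ab: "a \<in> gr A p" "b \<in> gr A p"
  then show "F (u @ (a + b) # v) = F (u @ a # v) + F (u @ b # v)"
  proof (induction u)
    case Nil
    show ?case
      using step[OF homogI[OF gr_add[OF A ab]] v] step[OF homogI[OF ab(1)] v]
        step[OF homogI[OF ab(2)] v] K_add[OF ab v] R_add[OF ab v]
      by (simp add: ac_simps)
  next
    case (Cons x u)
    then have x: "x \<in> homog A" and u: "set u \<subseteq> homog A" by auto
    have h: "set (u @ c # v) \<subseteq> homog A" if "c \<in> gr A p" for c
      using u v homogI[OF that] by auto
    show ?case
      using step[OF x h[OF gr_add[OF A ab]]] step[OF x h[OF ab(1)]] step[OF x h[OF ab(2)]]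
        Cons.IH[OF u v ab] multilinearD(1)[OF R[OF x] u v ab] lin_add[OF K[OF x]]
      by (simp add: ac_simps)
  qed
next
  fix u v p a c
  assume "set u \<subseteq> homog A" and v: "set v \<subseteq> homog A" and a: "a \<in> gr A p"
  then show "F (u @ smult A c a # v) = fscale c (F (u @ a # v))"
  proof (induction u)
    case Nil
    show ?case
      using step[OF homogI[OF gr_scale[OF A a]] v] step[OF homogI[OF a] v]
        K_scale[OF a v] R_scale[OF a v]
      by (simp add: fs.scale_right_distrib)
  next
    case (Cons x u)
    then have x: "x \<in> homog A" and u: "set u \<subseteq> homog A" by auto
    have h: "set (u @ c # v) \<subseteq> homog A" if "c \<in> gr A p" for c
      using u v homogI[OF that] by auto
    show ?case
      using step[OF x h[OF gr_scale[OF A a]]] step[OF x h[OF a]]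
        Cons.IH[OF u v a] multilinearD(2)[OF R[OF x] u v a] lin_scale[OF K[OF x]]
      by (simp add: fs.scale_right_distrib)
  qed
qed

lemma wdeg_eq:
  assumes "graded_space A" "hword A w n" "word A w \<noteq> 0"
  shows "wdeg A w = n"
  using assms(2,3)
proof induction
  case (hword_Cons a p w n)
  have "a \<noteq> 0"
    using hword_Cons.prems word_zero[OF assms(1), of "[]" w] hword_homog[OF hword_Cons(2)] by auto
  moreover have "word A w \<noteq> 0"
  proof
    assume 0: "word A w = 0"
    have "multilinear A (\<lambda>w. word A (a # w))"
      using multilinear_append[OF multilinear_word, of "[a]" A] homogI[OF hword_Cons(1)] by simp
    then have "word A (a # w) = bar_lift (\<lambda>w. word A (a # w)) (word A w)"
      by (simp add: bar_lift_multilinear)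
    with 0 hword_Cons.prems show False using lin_zero[OF lin_bar_lift] by metis
  qed
  ultimately show ?case
    using hword_Cons.IH deg_eq[OF assms(1) hword_Cons(1)] by (simp add: wdeg_def)
qed (simp add: wdeg_def)

text \<open>
  Different degrees of \<open>BA\<close> are separated by the projections that keep the words of one degree.
  Consequently the Koszul signs, which are defined by the degree function of \<open>BA\<close>, are the expected
  ones on words.
\<close>

lemma graded_bar:
  fixes A :: "('k::field, 'a::ab_group_add, 'z) gspace_scheme"
  assumes A: "graded_space A"
  shows "graded_space (bar A)"
proof -
  define F where "F n w = (if wdeg A w = n then word A w else 0)" for n w
  have wz: "wdeg A (u @ a # v) = wdeg A (u @ b # v) \<or> a = 0 \<or> b = 0"
    if "a \<in> gr A p" "b \<in> gr A p" for u v p and a b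
    using deg_eq[OF A that(1)] deg_eq[OF A that(2)]
    by (cases "a = 0"; cases "b = 0") (simp_all add: wdeg_def)
  have F: "multilinear A (F n)" for n
  proof (rule multilinearI)
    fix u v p a b
    assume uv: "set u \<subseteq> homog A" "set v \<subseteq> homog A" and ab: "a \<in> gr A p" "b \<in> gr A p"
    note z = word_zero[OF A uv]
    note s = multilinearD(1)[OF multilinear_word uv ab]
    show "F n (u @ (a + b) # v) = F n (u @ a # v) + F n (u @ b # v)"
      using wz[OF ab, of u v] wz[OF gr_add[OF A ab] ab(1), of u v]
        wz[OF gr_add[OF A ab] ab(2), of u v] z s
      unfolding F_def by (cases "a = 0"; cases "b = 0"; cases "a + b = 0") (auto split: if_splits)
  next
    fix u v p a c
    assume uv: "set u \<subseteq> homog A" "set v \<subseteq> homog A" and a: "a \<in> gr A p"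
    note z = word_zero[OF A uv]
    note s = multilinearD(2)[OF multilinear_word uv a, of c]
    show "F n (u @ smult A c a # v) = fscale c (F n (u @ a # v))"
      using wz[OF gr_scale[OF A a, of c] a, of u v] z s
      unfolding F_def by (cases "a = 0"; cases "smult A c a = 0") (auto split: if_splits)
  qed
  have P: "bar_lift (F n) x = (if m = n then x else 0)" if "x \<in> gr (bar A) m" for n m x
    using that unfolding gr_bar
  proof (rule lin_eq_on_span[rotated 3])
    show "lin (\<lambda>x. if m = n then x else 0 :: ('a list \<Rightarrow> 'k) \<Rightarrow> 'k)"
      by (cases "m = n") (simp_all add: lin_intros)
    show "bar_lift (F n) t = (if m = n then t else 0)" if "t \<in> {word A w |w. hword A w m}" for t
    proof -
      from that obtain w where w: "t = word A w" "hword A w m" by blast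
      then show ?thesis
        using wdeg_eq[OF A w(2)] bar_lift_multilinear[OF F, of n w] by (auto simp: F_def)
    qed
  qed (rule lin_bar_lift)
  show ?thesis
    unfolding graded_space_def
  proof (intro conjI allI impI)
    show "vector_space (smult (bar A))" by (simp add: fs.vector_space_axioms)
    show "module.subspace (smult (bar A)) (gr (bar A) n)" for n
      by (simp add: gr_bar fs.subspace_span)
    fix I x
    assume I: "finite I" and x: "\<forall>n\<in>I. x n \<in> gr (bar A) n" and s: "(\<Sum>n\<in>I. x n) = 0"
    show "\<forall>n\<in>I. x n = 0"
    proof
      fix n assume n: "n \<in> I"
      have "0 = bar_lift (F n) (\<Sum>n\<in>I. x n)" by (simp add: s lin_zero[OF lin_bar_lift])
      also have "\<dots> = (\<Sum>m\<in>I. bar_lift (F n) (x m))" by (rule lin_sum[OF lin_bar_lift])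
      also have "\<dots> = (\<Sum>m\<in>I. if m = n then x m else 0)" by (rule sum.cong) (use x P in auto)
      also have "\<dots> = x n" using I n by simp
      finally show "x n = 0" by simp
    qed
  qed
qed


lemma bar_eqI:
  assumes "t \<in> gr (bar A) n" "lin f" "lin g"
    and "\<And>w. hword A w n \<Longrightarrow> f (word A w) = g (word A w)"
  shows "f t = g t"
  using assms(1) unfolding gr_bar
  by (rule lin_eq_on_span[OF assms(2,3), rotated]) (use assms(4) in blast)

lemma gmap_barI:
  assumes "lin f" "\<And>w n. hword A w n \<Longrightarrow> f (word A w) \<in> gr W (n + r)"
    and "\<And>m. gr W m = fs.span (S m)" "smult W = fscale"
  shows "gmap (bar A) W r f"
proof -
  have "f x \<in> gr W (n + r)" if "x \<in> gr (bar A) n" for x n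
    using that unfolding gr_bar assms(3)
    by (rule lin_span_mem[OF assms(1), rotated]) (use assms(2) in \<open>auto simp flip: assms(3)\<close>)
  then show ?thesis
    using assms(4) by (simp add: gmap_def lin_simps[OF assms(1)])
qed

lemma tmap_gr:
  assumes V: "graded_space V" and f: "gmap V V' e f" and g: "gmap W W' s g"
    and t: "t \<in> gr (tensor V W) n"
  shows "tmap V V' W' r f g t \<in> gr (tensor V' W') (n + e + s)"
  using t unfolding gr_tensor[of V W]
proof (rule lin_span_mem[OF lin_tmap, where T = "{tens V' W' x y | x y p q. x \<in> gr V' p \<and> y \<in> gr W' q \<and> p + q = n + e + s}",
      folded gr_tensor, rotated])
  fix t assume "t \<in> {tens V W x y |x y p q. x \<in> gr V p \<and> y \<in> gr W q \<and> p + q = n}"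
  then obtain x y p q where t: "t = tens V W x y" "x \<in> gr V p" "y \<in> gr W q" "p + q = n" by blast
  have "tens V' W' (f x) (g y) \<in> gr (tensor V' W') (p + e + (q + s))"
    by (rule tens_in_gr[OF gmapD(1)[OF f t(2)] gmapD(1)[OF g t(3)]])
  then have "tens V' W' (f x) (g y) \<in> gr (tensor V' W') (n + e + s)"
    by (metis t(4) add.assoc add.commute)
  then show "tmap V V' W' r f g t \<in> gr (tensor V' W') (n + e + s)"
    unfolding t(1) tmap_tens[OF V f g t(2,3)] gr_tensor by (rule span_sg)
qed


section \<open>Prepending a letter\<close>

definition bar_cons :: "('k::field, 'a::ab_group_add, 'z) gspace_scheme \<Rightarrow> 'a \<Rightarrow>
    (('a list \<Rightarrow> 'k) \<Rightarrow> 'k) \<Rightarrow> ('a list \<Rightarrow> 'k) \<Rightarrow> 'k" where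
  "bar_cons A a = bar_lift (\<lambda>w. word A (a # w))"

text \<open>
  All words arise from the empty word by prepending letters.  The second factor \<open>W\<close> is a parameter
  because the operator is needed on \<open>BA \<otimes> BA\<close>, on \<open>BA \<otimes> M\<close> and on \<open>BA \<otimes> (BA \<otimes> M)\<close>.
\<close>

definition lcons where
  "lcons A W a = tmap (bar A) (bar A) W 0 (bar_cons A a) id"

lemma lin_bar_cons: "lin (bar_cons A a)"
  unfolding bar_cons_def by (rule lin_bar_lift)

lemma lin_lcons: "lin (lcons A W a)"
  unfolding lcons_def by (rule lin_tmap)

lemma multilinear_word_Cons: "a \<in> homog A \<Longrightarrow> multilinear A (\<lambda>w. word A (a # w))"
  using multilinear_append[OF multilinear_word, of "[a]" A] by simp

lemma bar_cons_word: "a \<in> homog A \<Longrightarrow> bar_cons A a (word A w) = word A (a # w)"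
  unfolding bar_cons_def by (rule bar_lift_multilinear) (rule multilinear_word_Cons)

lemma gmap_bar_cons: "a \<in> gr A p \<Longrightarrow> gmap (bar A) (bar A) (p - 1) (bar_cons A a)"
proof (rule gmap_barI[OF lin_bar_cons])
  fix w n assume a: "a \<in> gr A p" and "hword A w n"
  then show "bar_cons A a (word A w) \<in> gr (bar A) (n + (p - 1))"
    using word_in_gr[OF hword_Cons[OF a]] by (simp add: bar_cons_word homogI[OF a] add.commute)
qed (simp_all add: gr_bar)

lemma word_Cons_add:
  "a \<in> gr A p \<Longrightarrow> b \<in> gr A p \<Longrightarrow> set w \<subseteq> homog A \<Longrightarrow>
    word A ((a + b) # w) = word A (a # w) + word A (b # w)"
  using multilinearD(1)[OF multilinear_word, of "[]" A w a p b] by simp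

lemma word_Cons_scale:
  "a \<in> gr A p \<Longrightarrow> set w \<subseteq> homog A \<Longrightarrow> word A (smult A c a # w) = fscale c (word A (a # w))"
  using multilinearD(2)[OF multilinear_word, of "[]" A w a p c] by simp

lemma bar_cons_add:
  assumes A: "graded_space A" and ab: "a \<in> gr A p" "b \<in> gr A p" and t: "t \<in> gr (bar A) n"
  shows "bar_cons A (a + b) t = bar_cons A a t + bar_cons A b t"
  by (rule bar_eqI[OF t])
    (simp_all add: lin_intros lin_bar_cons bar_cons_word homogI[OF ab(1)] homogI[OF ab(2)]
      homogI[OF gr_add[OF A ab]] word_Cons_add[OF ab] hword_homog)

lemma bar_cons_scale:
  assumes A: "graded_space A" and a: "a \<in> gr A p" and t: "t \<in> gr (bar A) n"
  shows "bar_cons A (smult A c a) t = fscale c (bar_cons A a t)"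
  by (rule bar_eqI[OF t])
    (simp_all add: lin_intros lin_bar_cons bar_cons_word homogI[OF a]
      homogI[OF gr_scale[OF A a]] word_Cons_scale[OF a] hword_homog)

lemma lcons_tens:
  assumes "graded_space A" "a \<in> gr A p" "x \<in> gr (bar A) n" "y \<in> gr W q"
  shows "lcons A W a (tens (bar A) W x y) = tens (bar A) W (bar_cons A a x) y"
  unfolding lcons_def
  using tmap_tens[OF graded_bar[OF assms(1)] gmap_bar_cons[OF assms(2)] gmap_id assms(3,4), of 0]
  by simp

lemma lcons_gr:
  assumes "graded_space A" "a \<in> gr A p" "t \<in> gr (tensor (bar A) W) n"
  shows "lcons A W a t \<in> gr (tensor (bar A) W) (p - 1 + n)"
  unfolding lcons_def
  using tmap_gr[OF graded_bar[OF assms(1)] gmap_bar_cons[OF assms(2)] gmap_id assms(3), of 0]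
  by (simp add: algebra_simps)

lemma lcons_add:
  assumes A: "graded_space A" and ab: "a \<in> gr A p" "b \<in> gr A p" and t: "t \<in> gr (tensor (bar A) W) n"
  shows "lcons A W (a + b) t = lcons A W a t + lcons A W b t"
proof (rule tensor_eqI[OF t lin_lcons lin_plus[OF lin_lcons lin_lcons]])
  fix x y m q assume xy: "x \<in> gr (bar A) m" "y \<in> gr W q"
  show "lcons A W (a + b) (tens (bar A) W x y) =
      lcons A W a (tens (bar A) W x y) + lcons A W b (tens (bar A) W x y)"
    unfolding lcons_tens[OF A ab(1) xy] lcons_tens[OF A ab(2) xy]
      lcons_tens[OF A gr_add[OF A ab] xy] bar_cons_add[OF A ab xy(1)]
    by (rule tens_add_left[OF gmapD(1)[OF gmap_bar_cons[OF ab(1)] xy(1)]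
          gmapD(1)[OF gmap_bar_cons[OF ab(2)] xy(1)] xy(2)])
qed

lemma lcons_scale:
  assumes A: "graded_space A" and a: "a \<in> gr A p" and t: "t \<in> gr (tensor (bar A) W) n"
  shows "lcons A W (smult A c a) t = fscale c (lcons A W a t)"
proof (rule tensor_eqI[OF t lin_lcons lin_fscale[OF lin_lcons]])
  fix x y m q assume xy: "x \<in> gr (bar A) m" "y \<in> gr W q"
  show "lcons A W (smult A c a) (tens (bar A) W x y) = fscale c (lcons A W a (tens (bar A) W x y))"
    unfolding lcons_tens[OF A a xy] lcons_tens[OF A gr_scale[OF A a] xy] bar_cons_scale[OF A a xy(1)]
    by (rule tens_scale_left[OF gmapD(1)[OF gmap_bar_cons[OF a] xy(1)] xy(2), unfolded smult_bar])
qed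

section \<open>The comultiplication, the codifferential and the twisting cochain\<close>

lemma hword_append: "hword A u m \<Longrightarrow> hword A v n \<Longrightarrow> hword A (u @ v) (m + n)"
  by (induction rule: hword.induct) (auto simp: add.assoc intro: hword.intros)

lemma multilinear_tens:
  assumes F: "multilinear A F" and x: "x \<in> gr X p"
    and gr: "\<And>w n. hword A w n \<Longrightarrow> F w \<in> gr Y (n + r)" and Y: "smult Y = fscale"
  shows "multilinear A (\<lambda>w. tens X Y x (F w))"
proof -
  have gr': "\<exists>n. \<forall>a\<in>gr A p. F (u @ a # v) \<in> gr Y n"
    if uv: "set u \<subseteq> homog A" "set v \<subseteq> homog A" for u v p
  proof -
    obtain m n where "hword A u m" "hword A v n" using homog_hword uv by blast
    then show ?thesis using gr[OF hword_append[OF _ hword_Cons]] by blast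
  qed
  show ?thesis
  proof (rule multilinearI)
    fix u v p a b
    assume uv: "set u \<subseteq> homog A" "set v \<subseteq> homog A" and ab: "a \<in> gr A p" "b \<in> gr A p"
    show "tens X Y x (F (u @ (a + b) # v)) = tens X Y x (F (u @ a # v)) + tens X Y x (F (u @ b # v))"
      using gr'[OF uv, of p] ab tens_add_right[OF x] multilinearD(1)[OF F uv ab] by metis
  next
    fix u v p a c
    assume uv: "set u \<subseteq> homog A" "set v \<subseteq> homog A" and a: "a \<in> gr A p"
    show "tens X Y x (F (u @ smult A c a # v)) = fscale c (tens X Y x (F (u @ a # v)))"
      using gr'[OF uv, of p] a tens_scale_right[OF x, of _ Y _ c] multilinearD(2)[OF F uv a, of c] Y
      by metis
  qed
qed

lemma gr_word_Nil: "word A [] \<in> gr (bar A) 0"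
  by (rule word_in_gr[OF hword_Nil])

lemma lin_bar_comult: "lin (bar_comult A)"
  unfolding bar_comult_def by (rule lin_bar_lift)

text \<open>
  A word \<open>a w\<close> is cut either in front of \<open>a\<close> or at a place of \<open>w\<close>.  This recursion also proves, through
  \<open>multilinear_rec\<close>, that the sum over all cuts is multilinear.
\<close>

lemma
  assumes A: "graded_space A"
  shows bar_comult_Nil: "bar_comult A (word A []) = tens (bar A) (bar A) (word A []) (word A [])"
    and bar_comult_Cons: "a \<in> homog A \<Longrightarrow> set w \<subseteq> homog A \<Longrightarrow>
        bar_comult A (word A (a # w)) = tens (bar A) (bar A) (word A []) (word A (a # w)) +
          lcons A (bar A) a (bar_comult A (word A w))"
    and gmap_bar_comult: "gmap (bar A) (tensor (bar A) (bar A)) 0 (bar_comult A)"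
proof -
  let ?t = "tens (bar A) (bar A)"
  define C where "C w = (\<Sum>i\<le>length w. ?t (word A (take i w)) (word A (drop i w)))" for w
  have hd: "\<exists>p q. hword A (take i w) p \<and> hword A (drop i w) q \<and> p + q = n"
    if "hword A w n" for i w n
    using that
  proof (induction arbitrary: i)
    case hword_Nil
    then show ?case using hword.hword_Nil[of A] by force
  next
    case (hword_Cons a p w n)
    show ?case
    proof (cases i)
      case 0
      then show ?thesis
        using hword.hword_Nil hword.hword_Cons[OF hword_Cons(1,2)] by fastforce
    next
      case (Suc j)
      obtain q r where "hword A (take j w) q" "hword A (drop j w) r" "q + r = n"
        using hword_Cons.IH by blast
      then show ?thesis
        using hword.hword_Cons[OF hword_Cons(1), of "take j w" q] Suc
        by (intro exI[of _ "p - 1 + q"] exI[of _ r]) simp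
    qed
  qed
  have C_gr: "C w \<in> gr (tensor (bar A) (bar A)) n" if hw: "hword A w n" for w n
    unfolding C_def gr_tensor
  proof (rule fs.span_sum)
    fix i
    obtain p q where "hword A (take i w) p" "hword A (drop i w) q" "p + q = n"
      using hd[OF hw] by blast
    then show "?t (word A (take i w)) (word A (drop i w)) \<in>
        fs.span {?t x y |x y p q. x \<in> gr (bar A) p \<and> y \<in> gr (bar A) q \<and> p + q = n}"
      by (intro fs.span_base) (blast intro: word_in_gr)
  qed
  have step: "C (a # w) = lcons A (bar A) a (C w) + ?t (word A []) (word A (a # w))"
    if a: "a \<in> homog A" and w: "set w \<subseteq> homog A" for a w
  proof -
    obtain p where p: "a \<in> gr A p" using a by (rule homogE)
    obtain n where n: "hword A w n" using homog_hword[OF w] by blast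
    have "?t (word A (a # take i w)) (word A (drop i w)) =
        lcons A (bar A) a (?t (word A (take i w)) (word A (drop i w)))" for i
    proof -
      obtain r q where rq: "hword A (take i w) r" "hword A (drop i w) q" using hd[OF n] by blast
      show ?thesis
        using lcons_tens[OF A p word_in_gr[OF rq(1)] word_in_gr[OF rq(2)]]
        by (simp add: bar_cons_word[OF a])
    qed
    then show ?thesis
      unfolding C_def by (simp add: sum.atMost_Suc_shift lin_sum[OF lin_lcons] add.commute del: sum.atMost_Suc)
  qed
  have m: "multilinear A C"
  proof (rule multilinear_rec[OF step lin_lcons _ _ _ _ _ A])
    fix p a b w assume ab: "a \<in> gr A p" "b \<in> gr A p" and w: "set w \<subseteq> homog A"
    obtain n where n: "hword A w n" using homog_hword[OF w] by blast
    show "lcons A (bar A) (a + b) (C w) = lcons A (bar A) a (C w) + lcons A (bar A) b (C w)"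
      by (rule lcons_add[OF A ab C_gr[OF n]])
    show "?t (word A []) (word A ((a + b) # w)) =
        ?t (word A []) (word A (a # w)) + ?t (word A []) (word A (b # w))"
      unfolding word_Cons_add[OF ab w]
      by (rule tens_add_right[OF gr_word_Nil word_in_gr[OF hword_Cons[OF ab(1) n]]
            word_in_gr[OF hword_Cons[OF ab(2) n]]])
  next
    fix p a c w assume a: "a \<in> gr A p" and w: "set w \<subseteq> homog A"
    obtain n where n: "hword A w n" using homog_hword[OF w] by blast
    show "lcons A (bar A) (smult A c a) (C w) = fscale c (lcons A (bar A) a (C w))"
      by (rule lcons_scale[OF A a C_gr[OF n]])
    show "?t (word A []) (word A (smult A c a # w)) = fscale c (?t (word A []) (word A (a # w)))"
      unfolding word_Cons_scale[OF a w] 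
      using tens_scale_right[OF gr_word_Nil word_in_gr[OF hword_Cons[OF a n]], of _ c] by simp
  next
    fix a assume a: "a \<in> homog A"
    obtain p where p: "a \<in> gr A p" using a by (rule homogE)
    show "multilinear A (\<lambda>w. ?t (word A []) (word A (a # w)))"
      by (rule multilinear_tens[OF multilinear_word_Cons[OF a] gr_word_Nil _ smult_bar, where r = "p - 1"])
        (use word_in_gr[OF hword_Cons[OF p]] in \<open>simp add: add.commute\<close>)
  qed
  have v: "bar_comult A (word A w) = C w" for w
    unfolding bar_comult_def using bar_lift_multilinear[OF m] by (simp add: C_def[abs_def])
  show "bar_comult A (word A []) = ?t (word A []) (word A [])"
    by (simp add: v C_def)
  show "bar_comult A (word A (a # w)) = ?t (word A []) (word A (a # w)) +
      lcons A (bar A) a (bar_comult A (word A w))" if "a \<in> homog A" "set w \<subseteq> homog A"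
    by (simp add: v step[OF that] add.commute)
  show "gmap (bar A) (tensor (bar A) (bar A)) 0 (bar_comult A)"
    by (rule gmap_barI[OF lin_bar_comult _ gr_tensor]) (simp_all add: v C_gr)
qed


lemma multilinear_case:
  assumes "\<And>b. b \<in> homog A \<Longrightarrow> multilinear A (G b)"
    and "\<And>p a b w. a \<in> gr A p \<Longrightarrow> b \<in> gr A p \<Longrightarrow> set w \<subseteq> homog A \<Longrightarrow>
        G (a + b) w = G a w + G b w"
    and "\<And>p a c w. a \<in> gr A p \<Longrightarrow> set w \<subseteq> homog A \<Longrightarrow> G (smult A c a) w = fscale c (G a w)"
  shows "multilinear A (\<lambda>w. case w of [] \<Rightarrow> z | b # w' \<Rightarrow> G b w')"
proof (rule multilinearI)
  fix u v p a b
  assume *: "set u \<subseteq> homog A" "set v \<subseteq> homog A" "a \<in> gr A p" "b \<in> gr A p"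
  show "(case u @ (a + b) # v of [] \<Rightarrow> z | b # w' \<Rightarrow> G b w') =
      (case u @ a # v of [] \<Rightarrow> z | b # w' \<Rightarrow> G b w') + (case u @ b # v of [] \<Rightarrow> z | b # w' \<Rightarrow> G b w')"
    using * multilinearD(1)[OF assms(1)] assms(2) by (cases u) simp_all
next
  fix u v p a c
  assume *: "set u \<subseteq> homog A" "set v \<subseteq> homog A" "a \<in> gr A p"
  show "(case u @ smult A c a # v of [] \<Rightarrow> z | b # w' \<Rightarrow> G b w') =
      fscale c (case u @ a # v of [] \<Rightarrow> z | b # w' \<Rightarrow> G b w')"
    using * multilinearD(2)[OF assms(1)] assms(3) by (cases u) simp_all
qed

lemma sg_deg_bar_cons:
  assumes A: "graded_space A" and a: "a \<in> gr A p" and t: "t \<in> gr (bar A) n"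
  shows "sg (deg A a + r) (bar_cons A a t) = sg (p + r) (bar_cons A a t)"
proof (cases "a = 0")
  case True
  then have "bar_cons A a t = 0"
    using bar_cons_add[OF A gr_zero[OF A] gr_zero[OF A] t] by simp
  then show ?thesis by simp
qed (simp add: deg_eq[OF A a])

lemma sg_deg_word:
  assumes A: "graded_space A" and a: "a \<in> gr A p" and "a = 0 \<Longrightarrow> word A w = 0"
  shows "sg (deg A a + r) (word A w) = sg (p + r) (word A w)"
  using assms(3) by (cases "a = 0") (simp_all add: deg_eq[OF A a])

lemma word_Cons_neg:
  "graded_space A \<Longrightarrow> a \<in> gr A p \<Longrightarrow> set w \<subseteq> homog A \<Longrightarrow> word A (- a # w) = - word A (a # w)"
  using word_Cons_scale[of a A p w "- 1"] smult_neg[of A a]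
  by (simp add: fscale_def fun_eq_iff fun_simps)

lemma word_Cons_zero: "graded_space A \<Longrightarrow> set w \<subseteq> homog A \<Longrightarrow> word A (0 # w) = 0"
  using word_zero[of A "[]" w] by simp

lemma hword_single_iff: "hword A [a] n \<longleftrightarrow> a \<in> gr A (n + 1)"
  using hword_single[of a A "n + 1"] by (auto elim!: hword.cases)

text \<open>
  The two letters may have different degrees, so that a linear form on all of \<open>A\<close> is used to tell
  them apart.
\<close>

lemma word_single_inj:
  fixes A :: "('k::field, 'a::ab_group_add, 'z) gspace_scheme"
  assumes "graded_space A" "word A [a] = word A [b]"
  shows "a = b"
proof (rule ccontr)
  assume "a \<noteq> b"
  then obtain l where l: "Vector_Spaces.linear (smult A) (*) l" "l (a - b) = (1::'k)"
    using linear_form_separates[of "smult A" "a - b"] assms(1) by (auto simp: graded_space_def)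
  interpret l: Vector_Spaces.linear "smult A" "(*)" l by (rule l(1))
  let ?\<phi> = "\<lambda>w. if length w = 1 then l (hd w) else 0"
  have "multilin_form A ?\<phi>"
    by (auto simp: multilin_form_def l.add l.scale)
  then have "l a = l b"
    using fun_cong[OF assms(2), of ?\<phi>] by (simp add: word_def)
  with l(2) show False by (simp add: l.diff)
qed

lemma bar_tau_eq:
  assumes "graded_space A" "a \<in> homog A"
    and "bar_lift (\<lambda>w. if length w = 1 then word A w else 0) t = word A [a]"
  shows "bar_tau A t = a"
  unfolding bar_tau_def
  by (rule the_equality)
    (use assms word_single_inj[OF assms(1)] in \<open>auto simp: homog_def\<close>)

text \<open>
  The length-one part of a homogeneous element of \<open>BA\<close> is a single letter again, since the letters of
  one degree form a subspace.
\<close>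

lemma
  assumes A: "graded_space A"
  shows bar_tau_single: "a \<in> homog A \<Longrightarrow> bar_tau A (word A [a]) = a"
    and bar_tau_Nil: "bar_tau A (word A []) = 0"
    and bar_tau_long: "bar_tau A (word A (a # b # w)) = 0"
    and gmap_bar_tau: "gmap (bar A) A 1 (bar_tau A)"
proof -
  let ?F = "\<lambda>w. if length w = 1 then word A w else 0"
  have "multilinear A ?F"
    by (rule multilinearI) (auto simp: word_Cons_add word_Cons_scale)
  note P = bar_lift_multilinear[OF this]
  have 0: "0 \<in> homog A" using gr_zero[OF A] by (rule homogI)
  show "bar_tau A (word A [a]) = a" if "a \<in> homog A"
    by (rule bar_tau_eq[OF A that]) (simp add: P[unfolded One_nat_def])
  show "bar_tau A (word A []) = 0" "bar_tau A (word A (a # b # w)) = 0"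
    by (rule bar_tau_eq[OF A 0]; simp add: P[unfolded One_nat_def] word_Cons_zero[OF A])+
  have ex: "\<exists>a\<in>gr A (n + 1). bar_lift ?F t = word A [a]" if "t \<in> gr (bar A) n" for t n
    using that unfolding gr_bar
  proof (induction rule: fs.span_induct_alt)
    case base
    show ?case
      by (rule bexI[of _ 0])
        (simp_all add: gr_zero[OF A] lin_zero[OF lin_bar_lift] word_Cons_zero[OF A])
  next
    case (step c x y)
    from step(1) obtain w where w: "x = word A w" "hword A w n" by blast
    from step(2) obtain a where a: "a \<in> gr A (n + 1)" "bar_lift ?F y = word A [a]" by blast
    have lin: "bar_lift ?F (fscale c x + y) = fscale c (?F w) + word A [a]"
      by (simp only: lin_simps[OF lin_bar_lift] w(1) P a(2))
    show ?case
    proof (cases "length w = 1")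
      case True
      then obtain b where b: "w = [b]" by (auto simp: length_Suc_conv)
      then have bg: "b \<in> gr A (n + 1)" using w(2) by (simp add: hword_single_iff)
      show ?thesis
        using lin b word_Cons_add[OF gr_scale[OF A bg] a(1)] word_Cons_scale[OF bg]
        by (intro bexI[of _ "smult A c b + a"]) (simp_all add: gr_add[OF A gr_scale[OF A bg] a(1)])
    next
      case False
      then show ?thesis using lin a by auto
    qed
  qed
  show "gmap (bar A) A 1 (bar_tau A)"
    unfolding gmap_def
  proof (intro allI ballI conjI)
    fix n x assume "x \<in> gr (bar A) n"
    then obtain a where a: "a \<in> gr A (n + 1)" "bar_lift ?F x = word A [a]" using ex by blast
    have x: "bar_tau A x = a" by (rule bar_tau_eq[OF A homogI[OF a(1)] a(2)])
    then show "bar_tau A x \<in> gr A (n + 1)" using a by simp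
    show "bar_tau A (smult (bar A) c x) = smult A c (bar_tau A x)" for c
      unfolding x by (rule bar_tau_eq[OF A homogI[OF gr_scale[OF A a(1)]]])
        (use a(2) in \<open>simp add: lin_scale[OF lin_bar_lift] word_Cons_scale[OF a(1)]\<close>)
    fix y assume "y \<in> gr (bar A) n"
    then obtain b where b: "b \<in> gr A (n + 1)" "bar_lift ?F y = word A [b]" using ex by blast
    have y: "bar_tau A y = b" by (rule bar_tau_eq[OF A homogI[OF b(1)] b(2)])
    show "bar_tau A (x + y) = bar_tau A x + bar_tau A y"
      unfolding x y by (rule bar_tau_eq[OF A homogI[OF gr_add[OF A a(1) b(1)]]])
        (use a(2) b(2) in \<open>simp add: lin_add[OF lin_bar_lift] word_Cons_add[OF a(1) b(1)]\<close>)
  qed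
qed

locale curved_algebra =
  fixes A :: "('k::field, 'a::ab_group_add) cdg_alg"
  assumes alg: "cdg_algebra A"
begin

lemma graded_A: "graded_space A"
  and gmap_mul_left: "a \<in> gr A p \<Longrightarrow> gmap A A p (amul A a)"
  and gmap_mul_right: "b \<in> gr A q \<Longrightarrow> gmap A A q (\<lambda>a. amul A a b)"
  and mul_assoc: "a \<in> gr A p \<Longrightarrow> b \<in> gr A q \<Longrightarrow> e \<in> gr A r \<Longrightarrow>
        amul A (amul A a b) e = amul A a (amul A b e)"
  and gmap_adiff: "gmap A A 1 (adiff A)"
  and diff_mul: "a \<in> gr A p \<Longrightarrow> b \<in> gr A q \<Longrightarrow>
        adiff A (amul A a b) = amul A (adiff A a) b + sg p (amul A a (adiff A b))"
  and curv_gr: "curv A \<in> gr A 2"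
  and diff_curv: "adiff A (curv A) = 0"
  and diff_diff: "a \<in> gr A p \<Longrightarrow> adiff A (adiff A a) = amul A (curv A) a - amul A a (curv A)"
  using alg unfolding cdg_algebra_def gbilinear_def by blast+

lemma mul_gr: "a \<in> gr A p \<Longrightarrow> b \<in> gr A q \<Longrightarrow> amul A a b \<in> gr A (p + q)"
  using gmapD(1)[OF gmap_mul_left, of a p b q] by (simp add: add.commute)

lemma diff_gr: "a \<in> gr A p \<Longrightarrow> adiff A a \<in> gr A (p + 1)"
  by (rule gmapD(1)[OF gmap_adiff])

lemma curv_homog: "curv A \<in> homog A"
  by (rule homogI[OF curv_gr])

lemma homog_mul: "a \<in> homog A \<Longrightarrow> b \<in> homog A \<Longrightarrow> amul A a b \<in> homog A"
  by (meson homogE homogI mul_gr)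

lemma homog_diff: "a \<in> homog A \<Longrightarrow> adiff A a \<in> homog A"
  by (meson homogE homogI diff_gr)

lemma lin_bar_diff: "lin (bar_diff A)"
  unfolding bar_diff_def by (rule lin_bar_lift)

text \<open>
  The summand of the bar codifferential of \<open>a w\<close> that multiplies the first two letters; the number
  \<open>r\<close> stands for the degree of \<open>a\<close> in \<open>A\<close>.
\<close>

definition merge :: "int \<Rightarrow> 'a \<Rightarrow> 'a list \<Rightarrow> ('a list \<Rightarrow> 'k) \<Rightarrow> 'k" where
  "merge r a w = (case w of [] \<Rightarrow> 0 | b # w' \<Rightarrow> sg (r + 1) (word A (amul A a b # w')))"

definition bar_terms :: "'a list \<Rightarrow> ('a list \<Rightarrow> 'k) \<Rightarrow> 'k" where
  "bar_terms w = (\<Sum>i\<le>length w. \<Sum>j\<le>length w - i.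
     sg (wdeg A (take i w))
       (word A (take i w @ bar_b A (take j (drop i w)) # drop (i + j) w)))"

text \<open>
  The summands in which some \<open>b\<^sub>j\<close> is applied at the front; those with \<open>j \<ge> 3\<close> vanish.
\<close>

lemma bar_terms_head:
  assumes a: "a \<in> homog A" and w: "set w \<subseteq> homog A"
  shows "(\<Sum>j\<le>Suc (length w). word A (bar_b A (take j (a # w)) # drop j (a # w))) =
    word A (curv A # a # w) - word A (adiff A a # w) + merge (deg A a) a w"
proof -
  obtain p where p: "a \<in> gr A p" using a by (rule homogE)
  have neg: "word A (- adiff A a # w) = - word A (adiff A a # w)"
    by (rule word_Cons_neg[OF graded_A diff_gr[OF p] w])
  show ?thesis
  proof (cases w)
    case Nil
    then show ?thesis using neg by (simp add: merge_def)
  next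
    case (Cons b w')
    let ?g = "\<lambda>j. word A (bar_b A (a # b # take j w') # drop j w')"
    obtain q where q: "b \<in> gr A q" using w Cons homogE[of b A] by auto
    have "?g j = 0" if j: "j \<le> length w'" "j \<noteq> 0" for j
    proof -
      obtain e w'' where "take j w' = e # w''" using j by (cases "take j w'") auto
      moreover have "set (drop j w') \<subseteq> homog A"
        using w Cons set_drop_subset[of j w'] by auto
      ultimately show ?thesis by (simp add: word_Cons_zero[OF graded_A])
    qed
    then have "(\<Sum>j\<le>length w'. ?g j) = (\<Sum>j\<in>{0}. ?g j)"
      by (intro sum.mono_neutral_right) auto
    moreover have "word A (sg r (amul A a b) # w') = sg r (word A (amul A a b # w'))" for r
      using word_Cons_neg[OF graded_A mul_gr[OF p q], of w'] w Cons by (simp add: sg_def)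
    ultimately show ?thesis
      using neg Cons by (simp add: sum.atMost_Suc_shift merge_def del: sum.atMost_Suc)
  qed
qed

text \<open>
  Either \<open>b\<^sub>j\<close> is applied at the front, or it passes the first letter and contributes its Koszul
  sign.
\<close>

lemma bar_terms_Cons:
  assumes a: "a \<in> homog A" and w: "set w \<subseteq> homog A"
  shows "bar_terms (a # w) = sg (deg A a - 1) (bar_cons A a (bar_terms w)) +
    (word A (curv A # a # w) - word A (adiff A a # w) + merge (deg A a) a w)"
proof -
  have "(\<Sum>i\<le>length w. \<Sum>j\<le>length w - i. sg (wdeg A (a # take i w))
       (word A (a # take i w @ bar_b A (take j (drop i w)) # drop (i + j) w))) =
     sg (deg A a - 1) (bar_cons A a (bar_terms w))"
    by (simp add: bar_terms_def lin_simps[OF lin_bar_cons] lin_simps[OF lin_sgn[OF lin_ident]]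
        bar_cons_word[OF a] wdeg_def)
  then show ?thesis
    using bar_terms_head[OF a w]
    by (simp add: bar_terms_def[of "a # w"] sum.atMost_Suc_shift wdeg_def[of A "[]"] add.commute
        del: sum.atMost_Suc)
qed

lemma merge_eq:
  assumes a: "a \<in> gr A p" and w: "set w \<subseteq> homog A"
  shows "merge (deg A a) a w = merge p a w"
proof (cases w)
  case (Cons b w')
  obtain q where "b \<in> gr A q" using w Cons homogE[of b A] by auto
  then have "a = 0 \<Longrightarrow> amul A a b = 0"
    using gmap_zero[OF gmap_mul_right gr_zero[OF graded_A]] by simp
  then show ?thesis
    using Cons w sg_deg_word[OF graded_A a, of "amul A a b # w'" 1]
    by (simp add: merge_def word_Cons_zero[OF graded_A])
qed (simp add: merge_def)

lemma bar_terms_gr: "hword A w n \<Longrightarrow> bar_terms w \<in> gr (bar A) (n + 1)"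
proof (induction rule: hword.induct)
  case hword_Nil
  show ?case
    using word_in_gr[OF hword_single[OF curv_gr]] by (simp add: bar_terms_def wdeg_def)
next
  case (hword_Cons a p w n)
  note a = hword_Cons(1) and w = hword_Cons(2)
  have "bar_cons A a (bar_terms w) \<in> gr (bar A) (p - 1 + n + 1)"
    using gmapD(1)[OF gmap_bar_cons[OF a] hword_Cons.IH] by (simp add: algebra_simps)
  moreover have "word A (curv A # a # w) \<in> gr (bar A) (p - 1 + n + 1)"
    using word_in_gr[OF hword.hword_Cons[OF curv_gr hword.hword_Cons[OF a w]]]
    by (simp add: algebra_simps)
  moreover have "word A (adiff A a # w) \<in> gr (bar A) (p - 1 + n + 1)"
    using word_in_gr[OF hword.hword_Cons[OF diff_gr[OF a] w]]
    by (simp add: algebra_simps)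
  moreover have "merge (deg A a) a w \<in> gr (bar A) (p - 1 + n + 1)"
    using w
  proof cases
    case hword_Nil
    then show ?thesis by (simp add: merge_def gr_bar fs.span_zero)
  next
    case (hword_Cons b q w' m)
    have e: "p + q - 1 + m = p - 1 + n + 1" using hword_Cons(2) by simp
    show ?thesis
      using hword_Cons(1) gr_sg[OF graded_bar[OF graded_A]
          word_in_gr[OF hword.hword_Cons[OF mul_gr[OF a hword_Cons(3)] hword_Cons(4)], unfolded e]]
      by (simp add: merge_def)
  qed
  ultimately show ?case
    unfolding bar_terms_Cons[OF homogI[OF a] hword_homog[OF w]]
    by (simp only: gr_add[OF graded_bar[OF graded_A]] gr_diff[OF graded_bar[OF graded_A]]
        gr_sg[OF graded_bar[OF graded_A]])
qed

lemma multilinear_merge: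
  assumes a: "a \<in> homog A"
  shows "multilinear A (merge r a)"
  unfolding merge_def[abs_def]
proof (rule multilinear_case)
  obtain p where p: "a \<in> gr A p" using a by (rule homogE)
  show "multilinear A (\<lambda>w. sg (r + 1) (word A (amul A a b # w)))" if "b \<in> homog A" for b
    by (rule multilinear_lin[OF lin_sgn[OF lin_ident] multilinear_word_Cons[OF homog_mul[OF a that]]])
  show "sg (r + 1) (word A (amul A a (x + y) # w)) =
      sg (r + 1) (word A (amul A a x # w)) + sg (r + 1) (word A (amul A a y # w))"
    if xy: "x \<in> gr A q" "y \<in> gr A q" and w: "set w \<subseteq> homog A" for q x y w
    using word_Cons_add[OF mul_gr[OF p xy(1)] mul_gr[OF p xy(2)] w] gmapD(2)[OF gmap_mul_left[OF p] xy]
    by (simp add: sg_distrib)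
  show "sg (r + 1) (word A (amul A a (smult A c x) # w)) =
      fscale c (sg (r + 1) (word A (amul A a x # w)))"
    if x: "x \<in> gr A q" and w: "set w \<subseteq> homog A" for q x c w
    using word_Cons_scale[OF mul_gr[OF p x] w] gmapD(3)[OF gmap_mul_left[OF p] x]
    by (simp add: sg_fscale)
qed

lemma merge_add:
  assumes ab: "a \<in> gr A p" "b \<in> gr A p" and w: "set w \<subseteq> homog A"
  shows "merge r (a + b) w = merge r a w + merge r b w"
proof (cases w)
  case (Cons e w')
  obtain q where q: "e \<in> gr A q" using w Cons homogE[of e A] by auto
  show ?thesis
    using word_Cons_add[OF mul_gr[OF ab(1) q] mul_gr[OF ab(2) q]] gmapD(2)[OF gmap_mul_right[OF q] ab] w
    by (simp add: merge_def Cons sg_distrib)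
qed (simp add: merge_def)

lemma merge_scale:
  assumes a: "a \<in> gr A p" and w: "set w \<subseteq> homog A"
  shows "merge r (smult A c a) w = fscale c (merge r a w)"
proof (cases w)
  case (Cons e w')
  obtain q where q: "e \<in> gr A q" using w Cons homogE[of e A] by auto
  show ?thesis
    using word_Cons_scale[OF mul_gr[OF a q]] gmapD(3)[OF gmap_mul_right[OF q] a] w
    by (simp add: merge_def Cons sg_fscale)
qed (simp add: merge_def)

lemma multilinear_bar_terms: "multilinear A bar_terms"
proof (rule multilinear_rec[where K = "\<lambda>a t. sg (deg A a - 1) (bar_cons A a t)" and
      R = "\<lambda>a w. word A (curv A # a # w) - word A (adiff A a # w) + merge (deg A a) a w",
      OF bar_terms_Cons _ _ _ _ _ _ graded_A])
  show "lin (\<lambda>t. sg (deg A a - 1) (bar_cons A a t))" for a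
    by (rule lin_sgn[OF lin_bar_cons])
  fix p a b and w :: "'a list"
  assume ab: "a \<in> gr A p" "b \<in> gr A p" and w: "set w \<subseteq> homog A"
  obtain n where n: "hword A w n" using homog_hword[OF w] by blast
  have d: "sg (deg A a - 1) (bar_cons A a (bar_terms w)) = sg (p - 1) (bar_cons A a (bar_terms w))"
    if "a \<in> gr A p" for a
    using sg_deg_bar_cons[OF graded_A that bar_terms_gr[OF n], of "- 1"] by simp
  show "sg (deg A (a + b) - 1) (bar_cons A (a + b) (bar_terms w)) =
      sg (deg A a - 1) (bar_cons A a (bar_terms w)) + sg (deg A b - 1) (bar_cons A b (bar_terms w))"
    unfolding d[OF ab(1)] d[OF ab(2)] d[OF gr_add[OF graded_A ab]]
    by (simp only: bar_cons_add[OF graded_A ab bar_terms_gr[OF n]] sg_distrib)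
  show "sg (deg A (smult A c a) - 1) (bar_cons A (smult A c a) (bar_terms w)) =
      fscale c (sg (deg A a - 1) (bar_cons A a (bar_terms w)))" for c
    unfolding d[OF ab(1)] d[OF gr_scale[OF graded_A ab(1)]]
    by (simp only: bar_cons_scale[OF graded_A ab(1) bar_terms_gr[OF n]] sg_fscale)
  have cw: "word A (curv A # (a + b) # w) = word A (curv A # a # w) + word A (curv A # b # w)"
    using multilinearD(1)[OF multilinear_word, of "[curv A]" A w a p b] curv_homog w ab by simp
  show "word A (curv A # (a + b) # w) - word A (adiff A (a + b) # w) + merge (deg A (a + b)) (a + b) w =
      word A (curv A # a # w) - word A (adiff A a # w) + merge (deg A a) a w +
      (word A (curv A # b # w) - word A (adiff A b # w) + merge (deg A b) b w)"
    unfolding merge_eq[OF ab(1) w] merge_eq[OF ab(2) w] merge_eq[OF gr_add[OF graded_A ab] w]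
    by (simp only: cw gmapD(2)[OF gmap_adiff ab] word_Cons_add[OF diff_gr[OF ab(1)] diff_gr[OF ab(2)] w]
        merge_add[OF ab w]) simp
  fix c
  have cw: "word A (curv A # smult A c a # w) = fscale c (word A (curv A # a # w))"
    using multilinearD(2)[OF multilinear_word, of "[curv A]" A w a p c] curv_homog w ab by simp
  show "word A (curv A # smult A c a # w) - word A (adiff A (smult A c a) # w) +
      merge (deg A (smult A c a)) (smult A c a) w =
      fscale c (word A (curv A # a # w) - word A (adiff A a # w) + merge (deg A a) a w)"
    unfolding merge_eq[OF ab(1) w] merge_eq[OF gr_scale[OF graded_A ab(1)] w]
    by (simp only: cw gmapD(3)[OF gmap_adiff ab(1)] word_Cons_scale[OF diff_gr[OF ab(1)] w]
        merge_scale[OF ab(1) w] fs.scale_right_distrib fs.scale_right_diff_distrib)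
next
  fix a assume a: "a \<in> homog A"
  show "multilinear A (\<lambda>w. word A (curv A # a # w) - word A (adiff A a # w) + merge (deg A a) a w)"
    using multilinear_append[OF multilinear_word, of "[curv A, a]" A] a curv_homog
    by (intro multilinear_plus multilinear_sub multilinear_merge[OF a]
        multilinear_word_Cons[OF homog_diff[OF a]]) simp
qed

lemma bar_diff_word: "bar_diff A (word A w) = bar_terms w"
  unfolding bar_diff_def
  using bar_lift_multilinear[OF multilinear_bar_terms] by (simp add: bar_terms_def[abs_def])

lemma bar_diff_Nil: "bar_diff A (word A []) = word A [curv A]"
  by (simp add: bar_diff_word bar_terms_def wdeg_def)

lemma bar_diff_Cons:
  assumes a: "a \<in> gr A p" and w: "hword A w n"
  shows "bar_diff A (word A (a # w)) =
    word A (curv A # a # w) - word A (adiff A a # w) + merge p a w +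
    sg (p - 1) (bar_cons A a (bar_diff A (word A w)))"
  using bar_terms_Cons[OF homogI[OF a] hword_homog[OF w]] merge_eq[OF a hword_homog[OF w]]
    sg_deg_bar_cons[OF graded_A a bar_terms_gr[OF w], of "- 1"]
  by (simp add: bar_diff_word add.commute)

lemma gmap_bar_diff: "gmap (bar A) (bar A) 1 (bar_diff A)"
  by (rule gmap_barI[OF lin_bar_diff _ gr_bar]) (simp_all add: bar_diff_word bar_terms_gr)

end

section \<open>The comodule of a module on generators\<close>

lemma span_ext:
  assumes "\<And>s t. s \<in> fs.span S \<Longrightarrow> t \<in> fs.span S \<Longrightarrow> f (s + t) = f s + f t"
    and "\<And>c t. t \<in> fs.span S \<Longrightarrow> f (fscale c t) = fscale c (f t)"
    and "\<And>s t. s \<in> fs.span S \<Longrightarrow> t \<in> fs.span S \<Longrightarrow> g (s + t) = g s + g t"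
    and "\<And>c t. t \<in> fs.span S \<Longrightarrow> g (fscale c t) = fscale c (g t)"
    and "\<And>t. t \<in> S \<Longrightarrow> f t = g t" and t: "t \<in> fs.span S"
  shows "f t = g t"
proof -
  have "t \<in> fs.span S \<and> f t = g t"
    using t
  proof (induction rule: fs.span_induct_alt)
    case base
    have "f 0 = 0" "g 0 = 0"
      using assms(1)[of 0 0] assms(3)[of 0 0] fs.span_zero[of S] by simp_all
    then show ?case by (simp add: fs.span_zero)
  next
    case (step c x y)
    have x: "fscale c x \<in> fs.span S" "x \<in> fs.span S"
      using step(1) by (simp_all add: fs.span_base fs.span_scale)
    then show ?case
      using step fs.span_add[OF x(1), of y] assms(1)[of "fscale c x" y] assms(2)[of x c] assms(3)[of "fscale c x" y]
        assms(4)[of x c] assms(5)[of x] by simp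
  qed
  then show ?thesis ..
qed

lemma gr_bar_tensor:
  "gr (tensor (bar A) W) n =
    fs.span {tens (bar A) W (word A w) y | w y p q. hword A w p \<and> y \<in> gr W q \<and> p + q = n}"
    (is "_ = fs.span ?S")
proof
  show "fs.span ?S \<subseteq> gr (tensor (bar A) W) n"
    unfolding gr_tensor by (rule fs.span_mono) (blast intro: word_in_gr)
  have "tens (bar A) W x y \<in> fs.span ?S"
    if x: "x \<in> gr (bar A) p" and y: "y \<in> gr W q" and pq: "p + q = n" for x y p q
  proof -
    have "x \<in> gr (bar A) p \<and> tens (bar A) W x y \<in> fs.span ?S"
      using x[unfolded gr_bar]
    proof (induction rule: fs.span_induct_alt)
      case base
      have 0: "0 \<in> gr (bar A) p" by (simp add: gr_bar fs.span_zero)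
      show ?case using 0 tens_zero_left[OF 0 y] by (simp add: fs.span_zero)
    next
      case (step c x x')
      from step(1) obtain w where w: "x = word A w" "hword A w p" by blast
      note x = word_in_gr[OF w(2), folded w(1)]
      have cx: "fscale c x \<in> gr (bar A) p" using x by (simp add: gr_bar fs.span_scale)
      have "tens (bar A) W (fscale c x) y = fscale c (tens (bar A) W x y)"
        using tens_scale_left[OF x y, of c] by simp
      moreover have "tens (bar A) W x y \<in> fs.span ?S"
        by (rule fs.span_base) (use w y pq in blast)
      ultimately show ?case
        using cx step(2) tens_add_left[OF cx conjunct1[OF step(2)] y]
        by (simp add: fs.span_add fs.span_scale gr_bar)
    qed
    then show ?thesis ..
  qed
  then show "gr (tensor (bar A) W) n \<subseteq> fs.span ?S"
    unfolding gr_tensor by (intro fs.span_minimal fs.subspace_span) blast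
qed

lemma bar_tensor_eqI:
  assumes "t \<in> gr (tensor (bar A) W) n" "lin f" "lin g"
    and "\<And>w y p q. hword A w p \<Longrightarrow> y \<in> gr W q \<Longrightarrow> p + q = n \<Longrightarrow>
      f (tens (bar A) W (word A w) y) = g (tens (bar A) W (word A w) y)"
  shows "f t = g t"
  using assms(1) unfolding gr_bar_tensor
  by (rule lin_eq_on_span[OF assms(2,3), rotated]) (use assms(4) in blast)

text \<open>
  For maps such as \<open>t \<mapsto> x \<otimes> t\<close>, which are linear on each homogeneous component only.
\<close>

lemma bar_tensor_ext:
  fixes A :: "('k::field, 'a::ab_group_add, 'y) gspace_scheme"
    and W :: "('k, 'w::ab_group_add, 'z) gspace_scheme"
  defines "T \<equiv> tensor (bar A) W"
  assumes "\<And>s t. s \<in> gr T n \<Longrightarrow> t \<in> gr T n \<Longrightarrow> f (s + t) = f s + f t"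
    and "\<And>c t. t \<in> gr T n \<Longrightarrow> f (fscale c t) = fscale c (f t)"
    and "\<And>s t. s \<in> gr T n \<Longrightarrow> t \<in> gr T n \<Longrightarrow> g (s + t) = g s + g t"
    and "\<And>c t. t \<in> gr T n \<Longrightarrow> g (fscale c t) = fscale c (g t)"
    and "\<And>w y p q. hword A w p \<Longrightarrow> y \<in> gr W q \<Longrightarrow> p + q = n \<Longrightarrow>
      f (tens (bar A) W (word A w) y) = g (tens (bar A) W (word A w) y)"
    and "t \<in> gr T n"
  shows "f t = g t"
  by (rule span_ext[OF assms(2-5)[unfolded T_def gr_bar_tensor] _ assms(7)[unfolded T_def gr_bar_tensor]])
    (use assms(6) in auto)

lemma bar_tensor_grI:
  assumes "t \<in> gr (tensor (bar A) W) n" "lin f" and U: "gr U k = fs.span S"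
    and "\<And>w y p q. hword A w p \<Longrightarrow> y \<in> gr W q \<Longrightarrow> p + q = n \<Longrightarrow>
      f (tens (bar A) W (word A w) y) \<in> gr U k"
  shows "f t \<in> gr U k"
  using assms(1) unfolding gr_bar_tensor[of A W] U
  by (rule lin_span_mem[OF assms(2), rotated]) (use assms(4)[unfolded U] in blast)

lemma gr_tensor_closed:
  shows "s \<in> gr (tensor V W) n \<Longrightarrow> t \<in> gr (tensor V W) n \<Longrightarrow> s + t \<in> gr (tensor V W) n"
    and "s \<in> gr (tensor V W) n \<Longrightarrow> t \<in> gr (tensor V W) n \<Longrightarrow> s - t \<in> gr (tensor V W) n"
    and "s \<in> gr (tensor V W) n \<Longrightarrow> sg r s \<in> gr (tensor V W) n"
    and "s \<in> gr (tensor V W) n \<Longrightarrow> fscale c s \<in> gr (tensor V W) n"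
  by (simp_all add: gr_tensor fs.span_add fs.span_diff fs.span_scale span_sg)

lemma lcons_word:
  assumes "graded_space A" "a \<in> gr A p" "hword A w n" "y \<in> gr W q"
  shows "lcons A W a (tens (bar A) W (word A w) y) = tens (bar A) W (word A (a # w)) y"
  using lcons_tens[OF assms(1,2) word_in_gr[OF assms(3)] assms(4)]
  by (simp add: bar_cons_word[OF homogI[OF assms(2)]])

lemma tens_diff_left:
  assumes "graded_space V" "x \<in> gr V p" "x' \<in> gr V p" "y \<in> gr W q"
  shows "tens V W (x - x') y = tens V W x y - tens V W x' y"
  using tens_add_left[OF gr_diff[OF assms(1-3)] assms(3,4)] by simp

lemma tens_sg_left:
  assumes "graded_space V" "x \<in> gr V p" "y \<in> gr W q"
  shows "tens V W (sg r x) y = sg r (tens V W x y)"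
  using tens_diff_left[OF assms(1) gr_zero[OF assms(1)] assms(2,3)]
    tens_zero_left[OF gr_zero[OF assms(1)] assms(3)] by (simp add: sg_def)

locale curved_module = curved_algebra A
  for A :: "('k::field, 'a::ab_group_add) cdg_alg" +
  fixes M :: "('k, 'a, 'm::ab_group_add) cdg_mod"
  assumes module: "cdg_module A M"
begin

lemma graded_M: "graded_space M"
  and gmap_act: "a \<in> gr A p \<Longrightarrow> gmap M M p (act M a)"
  and gmap_act_right: "m \<in> gr M q \<Longrightarrow> gmap A M q (\<lambda>a. act M a m)"
  and act_mul: "a \<in> gr A p \<Longrightarrow> b \<in> gr A q \<Longrightarrow> m \<in> gr M r \<Longrightarrow>
        act M (amul A a b) m = act M a (act M b m)"
  and gmap_mdiff: "gmap M M 1 (mdiff M)"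
  and mdiff_act: "a \<in> gr A p \<Longrightarrow> m \<in> gr M q \<Longrightarrow>
        mdiff M (act M a m) = act M (adiff A a) m + sg p (act M a (mdiff M m))"
  and mdiff_mdiff: "m \<in> gr M q \<Longrightarrow> mdiff M (mdiff M m) = act M (curv A) m"
  using module unfolding cdg_module_def gbilinear_def by blast+

lemma act_gr: "a \<in> gr A p \<Longrightarrow> m \<in> gr M q \<Longrightarrow> act M a m \<in> gr M (p + q)"
  using gmapD(1)[OF gmap_act, of a p m q] by (simp add: add.commute)

lemma mdiff_gr: "m \<in> gr M q \<Longrightarrow> mdiff M m \<in> gr M (q + 1)"
  by (rule gmapD(1)[OF gmap_mdiff])

abbreviation "BM \<equiv> bar_mod A M"

abbreviation gen :: "'a list \<Rightarrow> 'm \<Rightarrow> ((('a list \<Rightarrow> 'k) \<Rightarrow> 'k) \<Rightarrow> 'm \<Rightarrow> 'k) \<Rightarrow> 'k" where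
  "gen w m \<equiv> tens (bar A) M (word A w) m"

abbreviation "L \<equiv> lcons A M"

lemmas graded_BA = graded_bar[OF graded_A]

lemma gen_gr: "hword A w n \<Longrightarrow> m \<in> gr M q \<Longrightarrow> n + q = N \<Longrightarrow> gen w m \<in> gr BM N"
  using tens_in_gr[OF word_in_gr] by blast

lemma L_gen: "a \<in> gr A p \<Longrightarrow> hword A w n \<Longrightarrow> m \<in> gr M q \<Longrightarrow> L a (gen w m) = gen (a # w) m"
  by (rule lcons_word[OF graded_A])

lemma L_gr: "a \<in> gr A p \<Longrightarrow> t \<in> gr BM n \<Longrightarrow> L a t \<in> gr BM (p - 1 + n)"
  by (rule lcons_gr[OF graded_A])

lemma gen_Nil_gr: "m \<in> gr M q \<Longrightarrow> gen [] m \<in> gr BM q"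
  by (rule gen_gr[OF hword_Nil]) simp_all

lemma gen_Nil_add: "m \<in> gr M q \<Longrightarrow> m' \<in> gr M q \<Longrightarrow> gen [] (m + m') = gen [] m + gen [] m'"
  by (rule tens_add_right[OF gr_word_Nil])

lemma gen_Nil_scale: "m \<in> gr M q \<Longrightarrow> gen [] (smult M c m) = fscale c (gen [] m)"
  by (rule tens_scale_right[OF gr_word_Nil])

lemma gen_Nil_zero: "gen [] 0 = 0"
  by (rule tens_zero_right[OF gr_word_Nil gr_zero[OF graded_M]])

lemma gen_Nil_sg: "m \<in> gr M q \<Longrightarrow> gen [] (sg r m) = sg r (gen [] m)"
  using gen_Nil_add[of m q "- m"] gr_neg[OF graded_M, of m q] gen_Nil_zero
  by (simp add: sg_def eq_neg_iff_add_eq_0 add.commute)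

section \<open>The coaction\<close>

text \<open>
  The coaction is this map applied to the comultiplication; for fixed \<open>m\<close> it sends \<open>y \<otimes> z\<close> to
  \<open>y \<otimes> (z \<otimes> m)\<close>.
\<close>

definition coact_on :: "'m \<Rightarrow> _" where
  "coact_on m = tlift (\<lambda>y z. tens (bar A) BM y (tens (bar A) M z m))"

lemma lin_coact_on: "lin (coact_on m)"
  unfolding coact_on_def by (rule lin_tlift)

lemma coact_on_tens:
  assumes m: "m \<in> gr M q"
  shows "coact_on m (tens (bar A) (bar A) y z) = tens (bar A) BM y (tens (bar A) M z m)"
  unfolding coact_on_def
proof (rule tlift_bilinear[OF bilinear_mapI])
  fix p r x x' y assume *: "x \<in> gr (bar A) p" "x' \<in> gr (bar A) p" "y \<in> gr (bar A) r"
  show "tens (bar A) BM (x + x') (tens (bar A) M y m) =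
      tens (bar A) BM x (tens (bar A) M y m) + tens (bar A) BM x' (tens (bar A) M y m)"
    by (rule tens_add_left[OF *(1,2) tens_in_gr[OF *(3) m]])
next
  fix p r x y c assume *: "x \<in> gr (bar A) p" "y \<in> gr (bar A) r"
  show "tens (bar A) BM (smult (bar A) c x) (tens (bar A) M y m) =
      fscale c (tens (bar A) BM x (tens (bar A) M y m))"
    by (rule tens_scale_left[OF *(1) tens_in_gr[OF *(2) m]])
  show "tens (bar A) BM x (tens (bar A) M (smult (bar A) c y) m) =
      fscale c (tens (bar A) BM x (tens (bar A) M y m))"
    unfolding tens_scale_left[OF *(2) m]
    using tens_scale_right[OF *(1) tens_in_gr[OF *(2) m], of c] by simp
next
  fix p r x y y' assume *: "x \<in> gr (bar A) p" "y \<in> gr (bar A) r" "y' \<in> gr (bar A) r"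
  show "tens (bar A) BM x (tens (bar A) M (y + y') m) =
      tens (bar A) BM x (tens (bar A) M y m) + tens (bar A) BM x (tens (bar A) M y' m)"
    unfolding tens_add_left[OF *(2,3) m]
    by (rule tens_add_right[OF *(1) tens_in_gr[OF *(2) m] tens_in_gr[OF *(3) m]])
qed

lemma lin_coact: "lin (bar_coact A M)"
  unfolding bar_coact_def by (rule lin_tlift)

lemma coact_tens:
  assumes x: "x \<in> gr (bar A) p" and m: "m \<in> gr M q"
  shows "bar_coact A M (tens (bar A) M x m) = coact_on m (bar_comult A x)"
proof -
  have "bilinear_map (bar A) M (\<lambda>x m. coact_on m (bar_comult A x))"
  proof (rule bilinear_mapI)
    fix p q x y y' assume *: "x \<in> gr (bar A) p" "y \<in> gr M q" "y' \<in> gr M q"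
    have C: "bar_comult A x \<in> gr (tensor (bar A) (bar A)) (p + 0)"
      by (rule gmapD(1)[OF gmap_bar_comult[OF graded_A] *(1)])
    show "coact_on (y + y') (bar_comult A x) = coact_on y (bar_comult A x) + coact_on y' (bar_comult A x)"
    proof (rule tensor_eqI[OF C lin_coact_on lin_plus[OF lin_coact_on lin_coact_on]])
      fix a b r s assume ab: "a \<in> gr (bar A) r" "b \<in> gr (bar A) s"
      show "coact_on (y + y') (tens (bar A) (bar A) a b) =
          coact_on y (tens (bar A) (bar A) a b) + coact_on y' (tens (bar A) (bar A) a b)"
        unfolding coact_on_tens[OF *(2)] coact_on_tens[OF *(3)]
          coact_on_tens[OF gr_add[OF graded_M *(2,3)]] tens_add_right[OF ab(2) *(2,3)]
        by (rule tens_add_right[OF ab(1) tens_in_gr[OF ab(2) *(2)] tens_in_gr[OF ab(2) *(3)]])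
    qed
  next
    fix p q x y c assume *: "x \<in> gr (bar A) p" "y \<in> gr M q"
    have C: "bar_comult A x \<in> gr (tensor (bar A) (bar A)) (p + 0)"
      by (rule gmapD(1)[OF gmap_bar_comult[OF graded_A] *(1)])
    show "coact_on (smult M c y) (bar_comult A x) = fscale c (coact_on y (bar_comult A x))"
    proof (rule tensor_eqI[OF C lin_coact_on lin_fscale[OF lin_coact_on]])
      fix a b r s assume ab: "a \<in> gr (bar A) r" "b \<in> gr (bar A) s"
      show "coact_on (smult M c y) (tens (bar A) (bar A) a b) =
          fscale c (coact_on y (tens (bar A) (bar A) a b))"
        unfolding coact_on_tens[OF *(2)] coact_on_tens[OF gr_scale[OF graded_M *(2)]]
          tens_scale_right[OF ab(2) *(2)]
        by (rule tens_scale_right[OF ab(1) tens_in_gr[OF ab(2) *(2)], unfolded smult_tensor])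
    qed
  qed (simp_all add: lin_simps[OF lin_bar_comult] lin_simps[OF lin_coact_on])
  from tlift_bilinear[OF this] show ?thesis
    unfolding bar_coact_def coact_on_def .
qed

lemma coact_Nil: "m \<in> gr M q \<Longrightarrow> bar_coact A M (gen [] m) = tens (bar A) BM (word A []) (gen [] m)"
  by (simp add: coact_tens[OF gr_word_Nil] bar_comult_Nil[OF graded_A] coact_on_tens)

lemma coact_Cons:
  assumes a: "a \<in> gr A p" and w: "hword A w n" and m: "m \<in> gr M q"
  shows "bar_coact A M (gen (a # w) m) =
    tens (bar A) BM (word A []) (gen (a # w) m) + lcons A BM a (bar_coact A M (gen w m))"
proof -
  have C: "bar_comult A (word A w) \<in> gr (tensor (bar A) (bar A)) (n + 0)"
    by (rule gmapD(1)[OF gmap_bar_comult[OF graded_A] word_in_gr[OF w]])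
  have "coact_on m (lcons A (bar A) a (bar_comult A (word A w))) =
      lcons A BM a (coact_on m (bar_comult A (word A w)))"
  proof (rule tensor_eqI[OF C lin_compose[OF lin_coact_on lin_lcons]
        lin_compose[OF lin_lcons lin_coact_on]])
    fix x y r s assume xy: "x \<in> gr (bar A) r" "y \<in> gr (bar A) s"
    show "coact_on m (lcons A (bar A) a (tens (bar A) (bar A) x y)) =
        lcons A BM a (coact_on m (tens (bar A) (bar A) x y))"
      unfolding lcons_tens[OF graded_A a xy] coact_on_tens[OF m]
        lcons_tens[OF graded_A a xy(1) tens_in_gr[OF xy(2) m]] ..
  qed
  then show ?thesis
    unfolding coact_tens[OF word_in_gr[OF hword_Cons[OF a w]] m] coact_tens[OF word_in_gr[OF w] m]
      bar_comult_Cons[OF graded_A homogI[OF a] hword_homog[OF w]] lin_add[OF lin_coact_on]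
      coact_on_tens[OF m] by simp
qed

lemma coact_gen_gr:
  "hword A w n \<Longrightarrow> m \<in> gr M q \<Longrightarrow> bar_coact A M (gen w m) \<in> gr (tensor (bar A) BM) (n + q)"
proof (induction rule: hword.induct)
  case hword_Nil
  then show ?case
    using tens_in_gr[OF gr_word_Nil gen_Nil_gr, of m q A] by (simp add: coact_Nil)
next
  case (hword_Cons a p w n)
  note a = hword_Cons(1) and w = hword_Cons(2) and m = hword_Cons.prems
  have "tens (bar A) BM (word A []) (gen (a # w) m) \<in> gr (tensor (bar A) BM) (p - 1 + n + q)"
    using tens_in_gr[OF gr_word_Nil gen_gr[OF hword.hword_Cons[OF a w] m HOL.refl], of A] by simp
  moreover have "lcons A BM a (bar_coact A M (gen w m)) \<in> gr (tensor (bar A) BM) (p - 1 + n + q)"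
    using lcons_gr[OF graded_A a hword_Cons.IH[OF m]] by (simp add: add.assoc)
  ultimately show ?case
    unfolding coact_Cons[OF a w m] by (rule gr_tensor_closed)
qed

lemma coact_gr: "t \<in> gr BM n \<Longrightarrow> bar_coact A M t \<in> gr (tensor (bar A) BM) n"
  by (erule bar_tensor_grI[OF _ lin_coact gr_tensor]) (use coact_gen_gr in blast)

lemma coact_L:
  assumes a: "a \<in> gr A p" and t: "t \<in> gr BM n"
  shows "bar_coact A M (L a t) =
    tens (bar A) BM (word A []) (L a t) + lcons A BM a (bar_coact A M t)"
proof (rule bar_tensor_ext[where f = "\<lambda>t. bar_coact A M (L a t)" and
      g = "\<lambda>t. tens (bar A) BM (word A []) (L a t) + lcons A BM a (bar_coact A M t)",
      OF _ _ _ _ _ t])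
  fix s t assume st: "s \<in> gr BM n" "t \<in> gr BM n"
  show "bar_coact A M (L a (s + t)) = bar_coact A M (L a s) + bar_coact A M (L a t)"
    by (simp only: lin_simps[OF lin_lcons] lin_simps[OF lin_coact])
  show "tens (bar A) BM (word A []) (L a (s + t)) + lcons A BM a (bar_coact A M (s + t)) =
    tens (bar A) BM (word A []) (L a s) + lcons A BM a (bar_coact A M s) +
    (tens (bar A) BM (word A []) (L a t) + lcons A BM a (bar_coact A M t))"
    by (simp add: lin_simps[OF lin_lcons] lin_simps[OF lin_coact]
        tens_add_right[OF gr_word_Nil L_gr[OF a st(1)] L_gr[OF a st(2)]])
next
  fix c t assume t: "t \<in> gr BM n"
  show "bar_coact A M (L a (fscale c t)) = fscale c (bar_coact A M (L a t))"
    by (simp only: lin_simps[OF lin_lcons] lin_simps[OF lin_coact])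
  show "tens (bar A) BM (word A []) (L a (fscale c t)) + lcons A BM a (bar_coact A M (fscale c t)) =
      fscale c (tens (bar A) BM (word A []) (L a t) + lcons A BM a (bar_coact A M t))"
    using tens_scale_right[OF gr_word_Nil L_gr[OF a t], of A c]
    by (simp add: lin_simps[OF lin_lcons] lin_simps[OF lin_coact] fs.scale_right_distrib)
next
  fix w y r q assume t: "hword A w r" "y \<in> gr M q"
  show "bar_coact A M (L a (gen w y)) =
      tens (bar A) BM (word A []) (L a (gen w y)) + lcons A BM a (bar_coact A M (gen w y))"
    unfolding L_gen[OF a t] by (rule coact_Cons[OF a t])
qed

end

section \<open>Twisted terms and the codifferential\<close>

context curved_module
begin

text \<open>
  The twisting term of the codifferential with an arbitrary pairing \<open>\<beta>\<close> in place of the action: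
  \<open>twisted \<beta>\<close> sends \<open>a\<^sub>1 \<dots> a\<^sub>n \<otimes> m\<close> to \<open>\<plusminus> a\<^sub>1 \<dots> a\<^bsub>n-1\<^esub> \<otimes> \<beta> a\<^sub>n m\<close>.  For the action itself this is a
  summand of the codifferential; for \<open>\<beta> a m = \<xi>(a) m\<close>, of degree \<open>-2\<close>, it is the homotopy \<open>h\<close>.
\<close>

definition twist :: "('a \<Rightarrow> 'm \<Rightarrow> 'm) \<Rightarrow> _" where
  "twist \<beta> = tlift (\<lambda>x. tlift (\<lambda>y m.
     sg (deg (bar A) x) (tens (bar A) M x (\<beta> (bar_tau A y) m))))"

definition twisted :: "('a \<Rightarrow> 'm \<Rightarrow> 'm) \<Rightarrow> _" where
  "twisted \<beta> t = twist \<beta> (bar_coact A M t)"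

definition shifted_action :: "int \<Rightarrow> ('a \<Rightarrow> 'm \<Rightarrow> 'm) \<Rightarrow> bool" where
  "shifted_action s \<beta> \<longleftrightarrow>
     (\<forall>p. \<forall>a\<in>gr A p. gmap M M (p + s) (\<beta> a)) \<and> (\<forall>q. \<forall>m\<in>gr M q. gmap A M (q + s) (\<lambda>a. \<beta> a m))"

lemma lin_twisted: "lin (twisted \<beta>)"
  unfolding twisted_def twist_def by (rule lin_compose[OF lin_tlift lin_coact])

lemma
  assumes "shifted_action s \<beta>"
  shows shifted_left: "a \<in> gr A p \<Longrightarrow> gmap M M (p + s) (\<beta> a)"
    and shifted_right: "m \<in> gr M q \<Longrightarrow> gmap A M (q + s) (\<lambda>a. \<beta> a m)"
    and shifted_gr: "a \<in> gr A p \<Longrightarrow> m \<in> gr M q \<Longrightarrow> \<beta> a m \<in> gr M (p + q + s)"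
  using assms gmapD(1)[of M M "p + s" "\<beta> a" m q]
  by (auto simp: shifted_action_def algebra_simps)

text \<open>
  The twisting acts on the last two tensor factors, so it commutes with operations on the first one
  up to the Koszul sign of an operator of odd degree.
\<close>

lemma
  assumes \<beta>: "shifted_action s \<beta>"
  shows twist_tens: "x \<in> gr (bar A) p \<Longrightarrow> y \<in> gr (bar A) r \<Longrightarrow> m \<in> gr M q \<Longrightarrow>
      twist \<beta> (tens (bar A) BM x (tens (bar A) M y m)) = sg p (tens (bar A) M x (\<beta> (bar_tau A y) m))"
    and twist_lcons: "a \<in> gr A p \<Longrightarrow> t \<in> gr (tensor (bar A) BM) n \<Longrightarrow>
      twist \<beta> (lcons A BM a t) = sg (p - 1) (L a (twist \<beta> t))"
proof -
  define I where "I x = tlift (\<lambda>y m. sg (deg (bar A) x) (tens (bar A) M x (\<beta> (bar_tau A y) m)))" for x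
  have lin_I: "lin (I x)" for x unfolding I_def by (rule lin_tlift)
  note \<tau> = gmap_bar_tau[OF graded_A]
  have \<tau>gr: "bar_tau A y \<in> gr A (r + 1)" if "y \<in> gr (bar A) r" for y r
    by (rule gmapD(1)[OF \<tau> that])
  have B: "\<beta> (bar_tau A y) m \<in> gr M (r + 1 + q + s)" if "y \<in> gr (bar A) r" "m \<in> gr M q" for y m r q
    by (rule shifted_gr[OF \<beta> \<tau>gr[OF that(1)] that(2)])
  have I: "I x (tens (bar A) M y m) = sg p (tens (bar A) M x (\<beta> (bar_tau A y) m))"
    if x: "x \<in> gr (bar A) p" and ym: "y \<in> gr (bar A) r" "m \<in> gr M q" for x y m p r q
  proof -
    have "bilinear_map (bar A) M (\<lambda>y m. sg (deg (bar A) x) (tens (bar A) M x (\<beta> (bar_tau A y) m)))"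
    proof (rule bilinear_mapI)
      fix r q y y' m assume *: "y \<in> gr (bar A) r" "y' \<in> gr (bar A) r" "m \<in> gr M q"
      show "sg (deg (bar A) x) (tens (bar A) M x (\<beta> (bar_tau A (y + y')) m)) =
          sg (deg (bar A) x) (tens (bar A) M x (\<beta> (bar_tau A y) m)) +
          sg (deg (bar A) x) (tens (bar A) M x (\<beta> (bar_tau A y') m))"
        unfolding gmapD(2)[OF \<tau> *(1,2)]
          gmapD(2)[OF shifted_right[OF \<beta> *(3)] \<tau>gr[OF *(1)] \<tau>gr[OF *(2)]]
          tens_add_right[OF x B[OF *(1,3)] B[OF *(2,3)]] sg_distrib ..
    next
      fix r q y c m assume *: "y \<in> gr (bar A) r" "m \<in> gr M q"
      show "sg (deg (bar A) x) (tens (bar A) M x (\<beta> (bar_tau A (smult (bar A) c y)) m)) =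
          fscale c (sg (deg (bar A) x) (tens (bar A) M x (\<beta> (bar_tau A y) m)))"
        unfolding gmapD(3)[OF \<tau> *(1)] gmapD(3)[OF shifted_right[OF \<beta> *(2)] \<tau>gr[OF *(1)]]
          tens_scale_right[OF x B[OF *]] sg_fscale ..
      show "sg (deg (bar A) x) (tens (bar A) M x (\<beta> (bar_tau A y) (smult M c m))) =
          fscale c (sg (deg (bar A) x) (tens (bar A) M x (\<beta> (bar_tau A y) m)))"
        unfolding gmapD(3)[OF shifted_left[OF \<beta> \<tau>gr[OF *(1)]] *(2)]
          tens_scale_right[OF x B[OF *]] sg_fscale ..
    next
      fix r q y m m' assume *: "y \<in> gr (bar A) r" "m \<in> gr M q" "m' \<in> gr M q"
      show "sg (deg (bar A) x) (tens (bar A) M x (\<beta> (bar_tau A y) (m + m'))) =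
          sg (deg (bar A) x) (tens (bar A) M x (\<beta> (bar_tau A y) m)) +
          sg (deg (bar A) x) (tens (bar A) M x (\<beta> (bar_tau A y) m'))"
        unfolding gmapD(2)[OF shifted_left[OF \<beta> \<tau>gr[OF *(1)]] *(2,3)]
          tens_add_right[OF x B[OF *(1,2)] B[OF *(1,3)]] sg_distrib ..
    qed
    from tlift_bilinear[OF this] show ?thesis
      using sg_deg_tens[OF graded_BA x B[OF ym], of 1] by (simp add: I_def)
  qed
  have I_lin: "I (x + x') z = I x z + I x' z" "I (fscale c x) z = fscale c (I x z)"
    if x: "x \<in> gr (bar A) p" "x' \<in> gr (bar A) p" and z: "z \<in> gr BM q" for x x' z p q c
  proof -
    have c: "fscale c x \<in> gr (bar A) p" using gr_scale[OF graded_BA x(1), of c] by simp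
    show "I (x + x') z = I x z + I x' z"
    proof (rule tensor_eqI[OF z lin_I lin_plus[OF lin_I lin_I]])
      fix y m r q assume ym: "y \<in> gr (bar A) r" "m \<in> gr M q"
      show "I (x + x') (tens (bar A) M y m) = I x (tens (bar A) M y m) + I x' (tens (bar A) M y m)"
        unfolding I[OF x(1) ym] I[OF x(2) ym] I[OF gr_add[OF graded_BA x] ym]
          tens_add_left[OF x B[OF ym]] sg_distrib ..
    qed
    show "I (fscale c x) z = fscale c (I x z)"
    proof (rule tensor_eqI[OF z lin_I lin_fscale[OF lin_I]])
      fix y m r q assume ym: "y \<in> gr (bar A) r" "m \<in> gr M q"
      show "I (fscale c x) (tens (bar A) M y m) = fscale c (I x (tens (bar A) M y m))"
        unfolding I[OF x(1) ym] I[OF c ym] tens_scale_left[OF x(1) B[OF ym], unfolded smult_bar]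
          sg_fscale ..
    qed
  qed
  have "bilinear_map (bar A) BM I"
  proof (rule bilinear_mapI)
    fix p q x x' y assume *: "x \<in> gr (bar A) p" "x' \<in> gr (bar A) p" "y \<in> gr BM q"
    show "I (x + x') y = I x y + I x' y" by (rule I_lin(1)[OF *])
  next
    fix p q x y c assume *: "x \<in> gr (bar A) p" "y \<in> gr BM q"
    show "I (smult (bar A) c x) y = fscale c (I x y)" using I_lin(2)[OF *(1,1,2)] by simp
    show "I x (smult BM c y) = fscale c (I x y)" by (simp add: lin_scale[OF lin_I])
  qed (rule lin_add[OF lin_I])
  then have tw: "twist \<beta> (tens (bar A) BM x z) = I x z" for x z
    unfolding twist_def I_def[symmetric, abs_def] by (rule tlift_bilinear)
  show "twist \<beta> (tens (bar A) BM x (tens (bar A) M y m)) = sg p (tens (bar A) M x (\<beta> (bar_tau A y) m))"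
    if "x \<in> gr (bar A) p" "y \<in> gr (bar A) r" "m \<in> gr M q"
    unfolding tw by (rule I[OF that])
  show "twist \<beta> (lcons A BM a t) = sg (p - 1) (L a (twist \<beta> t))"
    if a: "a \<in> gr A p" and t: "t \<in> gr (tensor (bar A) BM) n"
  proof (rule tensor_eqI[OF t])
    show "lin (\<lambda>t. twist \<beta> (lcons A BM a t))" "lin (\<lambda>t. sg (p - 1) (L a (twist \<beta> t)))"
      unfolding twist_def
      by (rule lin_compose[OF lin_tlift lin_lcons] lin_sgn[OF lin_compose[OF lin_lcons lin_tlift]])+
    fix x z k l assume x: "x \<in> gr (bar A) k" and z: "z \<in> gr BM l"
    have ax: "bar_cons A a x \<in> gr (bar A) (k + (p - 1))" by (rule gmapD(1)[OF gmap_bar_cons[OF a] x])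
    have "I (bar_cons A a x) z = sg (p - 1) (L a (I x z))"
    proof (rule tensor_eqI[OF z lin_I lin_sgn[OF lin_compose[OF lin_lcons lin_I]]])
      fix y m r q assume ym: "y \<in> gr (bar A) r" "m \<in> gr M q"
      show "I (bar_cons A a x) (tens (bar A) M y m) = sg (p - 1) (L a (I x (tens (bar A) M y m)))"
        unfolding I[OF x ym] I[OF ax ym] lin_sg[OF lin_lcons] lcons_tens[OF graded_A a x B[OF ym]]
        by (simp add: add.commute)
    qed
    then show "twist \<beta> (lcons A BM a (tens (bar A) BM x z)) = sg (p - 1) (L a (twist \<beta> (tens (bar A) BM x z)))"
      unfolding lcons_tens[OF graded_A a x z] tw .
  qed
qed

lemma twisted_Nil:
  assumes \<beta>: "shifted_action s \<beta>" and m: "m \<in> gr M q"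
  shows "twisted \<beta> (gen [] m) = 0"
  unfolding twisted_def coact_Nil[OF m] twist_tens[OF \<beta> gr_word_Nil gr_word_Nil m]
    bar_tau_Nil[OF graded_A] gmap_zero[OF shifted_right[OF \<beta> m] gr_zero[OF graded_A]]
  by (simp add: gen_Nil_zero)

text \<open>
  The cochain \<open>\<tau>\<close> vanishes on all words except those of length one, so only the cut in front of the
  last letter contributes.
\<close>

lemma
  assumes \<beta>: "shifted_action s \<beta>" and a: "a \<in> gr A p" and m: "m \<in> gr M q"
  shows twisted_single: "twisted \<beta> (gen [a] m) = gen [] (\<beta> a m)"
    and twisted_Cons: "b \<in> gr A r \<Longrightarrow> hword A w n \<Longrightarrow>
      twisted \<beta> (gen (a # b # w) m) = sg (p - 1) (L a (twisted \<beta> (gen (b # w) m)))"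
proof -
  have step: "twisted \<beta> (gen (a # w) m) =
      gen [] (\<beta> (bar_tau A (word A (a # w))) m) + sg (p - 1) (L a (twisted \<beta> (gen w m)))"
    if w: "hword A w n" for w n
    using twist_tens[OF \<beta> gr_word_Nil word_in_gr[OF hword_Cons[OF a w]] m]
      twist_lcons[OF \<beta> a coact_gen_gr[OF w m]] lin_add[OF lin_tlift, folded twist_def]
    by (simp add: twisted_def coact_Cons[OF a w m] twist_def lin_add[OF lin_tlift])
  show "twisted \<beta> (gen [a] m) = gen [] (\<beta> a m)"
    using step[OF hword_Nil]
    by (simp add: twisted_Nil[OF \<beta> m] bar_tau_single[OF graded_A homogI[OF a]] lin_zero[OF lin_lcons])
  show "twisted \<beta> (gen (a # b # w) m) = sg (p - 1) (L a (twisted \<beta> (gen (b # w) m)))"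
    if "b \<in> gr A r" "hword A w n"
    using step[OF hword_Cons[OF that]] gmap_zero[OF shifted_right[OF \<beta> m] gr_zero[OF graded_A]]
    by (simp add: bar_tau_long[OF graded_A] gen_Nil_zero)
qed

lemma twisted_gr:
  assumes \<beta>: "shifted_action s \<beta>" and t: "t \<in> gr BM n"
  shows "twisted \<beta> t \<in> gr BM (n + s + 1)"
proof (rule bar_tensor_grI[OF t lin_twisted gr_tensor])
  fix w m p q assume w: "hword A w p" and m: "m \<in> gr M q" and n: "p + q = n"
  have "twisted \<beta> (gen w m) \<in> gr BM (p + (q + s + 1))"
    using w
  proof induction
    case hword_Nil
    show ?case by (simp add: twisted_Nil[OF \<beta> m] tensor_zero)
  next
    case (hword_Cons a r w k)
    show ?case
      using hword_Cons(2)
    proof cases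
      case hword_Nil
      have "r + q + s = r - 1 + k + (q + s + 1)" using hword_Nil by simp
      then show ?thesis
        using gen_Nil_gr[OF shifted_gr[OF \<beta> hword_Cons(1) m]] hword_Nil
        by (simp only: twisted_single[OF \<beta> hword_Cons(1) m])
    next
      case (hword_Cons b l v j)
      show ?thesis
        using L_gr[OF \<open>a \<in> gr A r\<close> hword_Cons.IH] 
        unfolding \<open>w = b # v\<close> twisted_Cons[OF \<beta> \<open>a \<in> gr A r\<close> m hword_Cons(3,4)]
        by (simp add: gr_tensor_closed add.assoc)
    qed
  qed
  then show "twisted \<beta> (gen w m) \<in> gr BM (n + s + 1)"
    unfolding n[symmetric] by (simp add: algebra_simps)
qed

lemma shifted_act: "shifted_action 0 (act M)"
  by (simp add: shifted_action_def gmap_act gmap_act_right)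

abbreviation "d \<equiv> bar_mod_diff A M"

abbreviation "d_bar_part \<equiv> tmap (bar A) (bar A) M 0 (bar_diff A) id"

abbreviation "d_mod_part \<equiv> tmap (bar A) (bar A) M 1 id (mdiff M)"

lemma d_eq: "d t = d_bar_part t + d_mod_part t - twisted (act M) t"
  by (simp add: bar_mod_diff_def twisted_def twist_def bar_twist_def)

lemma lin_d: "lin d"
  unfolding d_eq[abs_def] by (intro lin_plus lin_sub lin_tmap lin_twisted)

lemma d_gr: "t \<in> gr BM n \<Longrightarrow> d t \<in> gr BM (n + 1)"
  unfolding d_eq
  using tmap_gr[OF graded_BA gmap_bar_diff gmap_id, of t M n 0]
    tmap_gr[OF graded_BA gmap_id gmap_mdiff, of t n 1] twisted_gr[OF shifted_act, of t n]
  by (simp add: gr_tensor_closed)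

lemma d_bar_part_gen:
  "hword A w n \<Longrightarrow> m \<in> gr M q \<Longrightarrow> d_bar_part (gen w m) = tens (bar A) M (bar_diff A (word A w)) m"
  using tmap_tens[OF graded_BA gmap_bar_diff gmap_id word_in_gr, of w n m M q 0] by simp

lemma d_mod_part_gen:
  "hword A w n \<Longrightarrow> m \<in> gr M q \<Longrightarrow> d_mod_part (gen w m) = sg n (gen w (mdiff M m))"
  using tmap_tens[OF graded_BA gmap_id gmap_mdiff word_in_gr, of w n m q 1] by simp

lemma d_Nil: "m \<in> gr M q \<Longrightarrow> d (gen [] m) = gen [curv A] m + gen [] (mdiff M m)"
  by (simp add: d_eq d_bar_part_gen[OF hword_Nil] d_mod_part_gen[OF hword_Nil] bar_diff_Nil
      twisted_Nil[OF shifted_act])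

lemma d_mod_part_Cons:
  assumes a: "a \<in> gr A p" and w: "hword A w n" and m: "m \<in> gr M q"
  shows "d_mod_part (gen (a # w) m) = sg (p - 1) (L a (d_mod_part (gen w m)))"
  using L_gen[OF a w mdiff_gr[OF m]]
  by (simp add: d_mod_part_gen[OF hword_Cons[OF a w] m] d_mod_part_gen[OF w m] lin_sg[OF lin_lcons])

lemma d_bar_part_Cons:
  assumes a: "a \<in> gr A p" and w: "hword A w n" and m: "m \<in> gr M q"
  shows "d_bar_part (gen (a # w) m) = gen (curv A # a # w) m - gen (adiff A a # w) m +
    tens (bar A) M (merge p a w) m + sg (p - 1) (L a (d_bar_part (gen w m)))"
proof -
  let ?n = "p - 1 + n + 1"
  have 1: "word A (curv A # a # w) \<in> gr (bar A) ?n"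
    using word_in_gr[OF hword_Cons[OF curv_gr hword_Cons[OF a w]]] by (simp add: algebra_simps)
  have 2: "word A (adiff A a # w) \<in> gr (bar A) ?n"
    using word_in_gr[OF hword_Cons[OF diff_gr[OF a] w]] by (simp add: algebra_simps)
  have D: "bar_diff A (word A w) \<in> gr (bar A) (n + 1)"
    by (rule gmapD(1)[OF gmap_bar_diff word_in_gr[OF w]])
  have 4: "bar_cons A a (bar_diff A (word A w)) \<in> gr (bar A) ?n"
    using gmapD(1)[OF gmap_bar_cons[OF a] D] by (simp add: algebra_simps)
  have 3: "merge p a w \<in> gr (bar A) ?n"
  proof -
    have "merge p a w = bar_diff A (word A (a # w)) - word A (curv A # a # w) + word A (adiff A a # w)
        - sg (p - 1) (bar_cons A a (bar_diff A (word A w)))"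
      by (simp add: bar_diff_Cons[OF a w])
    then show ?thesis
      using 1 2 4 gmapD(1)[OF gmap_bar_diff word_in_gr[OF hword_Cons[OF a w]]]
        gr_add[OF graded_BA, of _ ?n] gr_diff[OF graded_BA, of _ ?n] gr_sg[OF graded_BA, of _ ?n] by simp
  qed
  note s = gr_add[OF graded_BA, of _ ?n] gr_diff[OF graded_BA, of _ ?n] gr_sg[OF graded_BA, of _ ?n]
  show ?thesis
    unfolding d_bar_part_gen[OF hword_Cons[OF a w] m] d_bar_part_gen[OF w m] bar_diff_Cons[OF a w]
      lcons_tens[OF graded_A a D m]
    using 1 2 3 4 m
    by (simp only: tens_add_left[OF _ _ m, of _ "bar A" ?n] tens_diff_left[OF graded_BA _ _ m, of _ ?n]
        tens_sg_left[OF graded_BA _ m, of _ ?n] s)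
qed

text \<open>
  The codifferential of \<open>a w \<otimes> m\<close> inserts \<open>c\<close> in front, differentiates \<open>a\<close>, lets \<open>a\<close> meet what
  follows it, or passes \<open>a\<close>.  What follows \<open>a\<close> is the module element if \<open>w\<close> is empty, and the next
  letter otherwise.
\<close>

lemma d_single:
  assumes a: "a \<in> gr A p" and m: "m \<in> gr M q"
  shows "d (gen [a] m) = gen [curv A, a] m - gen [adiff A a] m - gen [] (act M a m) +
    sg (p - 1) (L a (d (gen [] m)))"
  using d_bar_part_Cons[OF a hword_Nil m] d_mod_part_Cons[OF a hword_Nil m]
    tens_zero_left[OF gr_zero[OF graded_BA] m]
  by (simp add: d_eq[of "gen [a] m"] d_eq[of "gen [] m"] twisted_single[OF shifted_act a m]
      twisted_Nil[OF shifted_act m] merge_def lin_simps[OF lin_lcons] sg_distrib)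

lemma sg_minus: "sg r (x - y) = sg r x - sg r y"
  by (simp add: sg_def)

lemma d_Cons:
  assumes a: "a \<in> gr A p" and b: "b \<in> gr A r" and w: "hword A w n" and m: "m \<in> gr M q"
  shows "d (gen (a # b # w) m) = gen (curv A # a # b # w) m - gen (adiff A a # b # w) m +
    sg (p + 1) (gen (amul A a b # w) m) + sg (p - 1) (L a (d (gen (b # w) m)))"
  using d_bar_part_Cons[OF a hword_Cons[OF b w] m] d_mod_part_Cons[OF a hword_Cons[OF b w] m]
    tens_sg_left[OF graded_BA word_in_gr[OF hword_Cons[OF mul_gr[OF a b] w]] m]
  by (simp add: d_eq[of "gen (a # b # w) m"] d_eq[of "gen (b # w) m"]
      twisted_Cons[OF shifted_act a m b w] merge_def lin_simps[OF lin_lcons] sg_distrib sg_minus)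

end

section \<open>The codifferential squares to zero\<close>

context curved_module
begin

text \<open>
  The part of \<open>d(a t)\<close> in which \<open>a\<close> meets what follows it, for \<open>a\<close> of degree \<open>p\<close>: the
  multiplication with the next letter of \<open>t\<close>, or with the module element if \<open>t = 1 \<otimes> m\<close> (\<open>mu_Cons\<close>,
  \<open>mu_Nil\<close>).  Defining it as the remainder of \<open>d(a t)\<close> makes it linear in \<open>t\<close> at once and turns the
  recursion \<open>d_L\<close> into an identity for all \<open>t\<close>.
\<close>

definition mu :: "int \<Rightarrow> 'a \<Rightarrow> _" where
  "mu p a t = d (L a t) - L (curv A) (L a t) + L (adiff A a) t - sg (p - 1) (L a (d t))"

lemma lin_mu: "lin (mu p a)"
  unfolding mu_def[abs_def]
  by (intro lin_plus lin_sub lin_sgn lin_compose[OF lin_d lin_lcons]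
      lin_compose[OF lin_lcons lin_lcons] lin_compose[OF lin_lcons lin_d] lin_lcons)

lemma d_L: "d (L a t) = L (curv A) (L a t) - L (adiff A a) t + mu p a t + sg (p - 1) (L a (d t))"
  by (simp add: mu_def)

lemma mu_Nil:
  assumes a: "a \<in> gr A p" and m: "m \<in> gr M q"
  shows "mu p a (gen [] m) = - gen [] (act M a m)"
  using d_single[OF a m]
  by (simp add: mu_def L_gen[OF a hword_Nil m] L_gen[OF diff_gr[OF a] hword_Nil m]
      L_gen[OF curv_gr hword_single[OF a] m])

lemma mu_Cons:
  assumes a: "a \<in> gr A p" and b: "b \<in> gr A r" and w: "hword A w n" and m: "m \<in> gr M q"
  shows "mu p a (gen (b # w) m) = sg (p + 1) (gen (amul A a b # w) m)"
  using d_Cons[OF a b w m]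
  by (simp add: mu_def L_gen[OF a hword_Cons[OF b w] m] L_gen[OF diff_gr[OF a] hword_Cons[OF b w] m]
      L_gen[OF curv_gr hword_Cons[OF a hword_Cons[OF b w]] m])

lemma mu_L:
  assumes a: "a \<in> gr A p" and b: "b \<in> gr A r" and t: "t \<in> gr BM n"
  shows "mu p a (L b t) = sg (p + 1) (L (amul A a b) t)"
proof (rule bar_tensor_eqI[OF t lin_compose[OF lin_mu lin_lcons] lin_sgn[OF lin_lcons]])
  fix w m k q assume *: "hword A w k" "m \<in> gr M q"
  show "mu p a (L b (gen w m)) = sg (p + 1) (L (amul A a b) (gen w m))"
    unfolding L_gen[OF b *] L_gen[OF mul_gr[OF a b] *] by (rule mu_Cons[OF a b *])
qed

text \<open>
  This is the associativity of \<open>A\<close> and of its action on \<open>M\<close>; the minus sign is due to the shift.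
\<close>

lemma mu_mu:
  assumes a: "a \<in> gr A p" and b: "b \<in> gr A r" and t: "t \<in> gr BM n"
  shows "mu p a (mu r b t) = - mu (p + r) (amul A a b) t"
proof (rule bar_tensor_eqI[OF t lin_compose[OF lin_mu lin_mu]])
  show "lin (\<lambda>t. - mu (p + r) (amul A a b) t)"
    using lin_sub[OF lin_null lin_mu] by simp
  fix w m k q assume w: "hword A w k" and m: "m \<in> gr M q"
  show "mu p a (mu r b (gen w m)) = - mu (p + r) (amul A a b) (gen w m)"
    using w
  proof cases
    case hword_Nil
    then show ?thesis
      by (simp add: mu_Nil[OF b m] mu_Nil[OF mul_gr[OF a b] m] lin_minus[OF lin_mu]
          mu_Nil[OF a act_gr[OF b m]] act_mul[OF a b m])
  next
    case (hword_Cons e l v j)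
    then show ?thesis
      by (simp add: mu_Cons[OF b hword_Cons(3,4) m] lin_sg[OF lin_mu]
          mu_Cons[OF a mul_gr[OF b hword_Cons(3)] hword_Cons(4) m]
          mu_Cons[OF mul_gr[OF a b] hword_Cons(3,4) m] mul_assoc[OF a b hword_Cons(3)])
        (simp add: sg_def)
  qed
qed

lemma L_add: "a \<in> gr A p \<Longrightarrow> b \<in> gr A p \<Longrightarrow> t \<in> gr BM n \<Longrightarrow> L (a + b) t = L a t + L b t"
  by (rule lcons_add[OF graded_A])

lemma L_diff: "a \<in> gr A p \<Longrightarrow> b \<in> gr A p \<Longrightarrow> t \<in> gr BM n \<Longrightarrow> L (a - b) t = L a t - L b t"
  using L_add[of "a - b" p b t n] gr_diff[OF graded_A, of a p b] by simp

lemma L_zero: "t \<in> gr BM n \<Longrightarrow> L 0 t = 0"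
  using L_diff[OF gr_zero[OF graded_A] gr_zero[OF graded_A]] by simp

lemma L_sg: "a \<in> gr A p \<Longrightarrow> t \<in> gr BM n \<Longrightarrow> L (sg r a) t = sg r (L a t)"
  using L_diff[OF gr_zero[OF graded_A], of a p t n] L_zero by (simp add: sg_def)

text \<open>
  The Leibniz rules of \<open>A\<close> and \<open>M\<close>.  In \<open>\<mu>\<^sub>a(d(t))\<close> the letter \<open>a\<close> is also multiplied with the
  copy of \<open>c\<close> that \<open>d\<close> inserts in front of \<open>t\<close>; the term with \<open>a c\<close> cancels this summand, which has
  no counterpart on the left.
\<close>

lemma d_mu:
  assumes a: "a \<in> gr A p" and t: "t \<in> gr BM n"
  shows "d (mu p a t) = L (amul A a (curv A)) t + L (curv A) (mu p a t) + mu (p + 1) (adiff A a) t +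
    sg p (mu p a (d t))"
proof (rule bar_tensor_eqI[where g = "\<lambda>t. L (amul A a (curv A)) t + L (curv A) (mu p a t) +
      mu (p + 1) (adiff A a) t + sg p (mu p a (d t))", OF t lin_compose[OF lin_d lin_mu]])
  show "lin (\<lambda>t. L (amul A a (curv A)) t + L (curv A) (mu p a t) + mu (p + 1) (adiff A a) t +
      sg p (mu p a (d t)))"
    by (intro lin_plus lin_sgn lin_lcons lin_mu lin_compose[OF lin_lcons lin_mu]
        lin_compose[OF lin_mu lin_d])
  fix w m k q assume w: "hword A w k" and m: "m \<in> gr M q"
  show "d (mu p a (gen w m)) = L (amul A a (curv A)) (gen w m) + L (curv A) (mu p a (gen w m)) +
      mu (p + 1) (adiff A a) (gen w m) + sg p (mu p a (d (gen w m)))"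
    using w
  proof cases
    case hword_Nil
    note am = act_gr[OF a m]
    have 1: "act M (adiff A a) m \<in> gr M (p + q + 1)"
      using act_gr[OF diff_gr[OF a] m] by (simp add: algebra_simps)
    have 2: "act M a (mdiff M m) \<in> gr M (p + q + 1)"
      using act_gr[OF a mdiff_gr[OF m]] by (simp add: algebra_simps)
    have "d (mu p a (gen [] m)) = - gen [curv A] (act M a m) - gen [] (act M (adiff A a) m)
        - sg p (gen [] (act M a (mdiff M m)))"
      by (simp add: mu_Nil[OF a m] lin_minus[OF lin_d] d_Nil[OF am] mdiff_act[OF a m]
          gen_Nil_add[OF 1 gr_sg[OF graded_M 2]] gen_Nil_sg[OF 2])
    moreover have "L (curv A) (mu p a (gen [] m)) = - gen [curv A] (act M a m)"
      by (simp add: mu_Nil[OF a m] lin_minus[OF lin_lcons] L_gen[OF curv_gr hword.hword_Nil am])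
    moreover have "sg p (mu p a (d (gen [] m))) =
        - gen [amul A a (curv A)] m - sg p (gen [] (act M a (mdiff M m)))"
      by (simp add: d_Nil[OF m] lin_add[OF lin_mu] mu_Nil[OF a mdiff_gr[OF m]]
          mu_Cons[OF a curv_gr hword.hword_Nil m]) (simp add: sg_def)
    ultimately show ?thesis
      by (simp add: hword_Nil mu_Nil[OF diff_gr[OF a] m]
          L_gen[OF mul_gr[OF a curv_gr] hword.hword_Nil m])
  next
    case (hword_Cons b r v j)
    note b = hword_Cons(3) and v = hword_Cons(4)
    let ?u = "gen v m"
    have u: "?u \<in> gr BM (j + q)" by (rule gen_gr[OF v m HOL.refl])
    have g: "gen w m = L b ?u" by (simp add: hword_Cons(1) L_gen[OF b v m])
    note Lbu = L_gr[OF b u] and du = d_gr[OF u] and ab = mul_gr[OF a b]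
    have 1: "amul A (adiff A a) b \<in> gr A (p + r + 1)"
      using mul_gr[OF diff_gr[OF a] b] by (simp add: algebra_simps)
    have 2: "amul A a (adiff A b) \<in> gr A (p + r + 1)"
      using mul_gr[OF a diff_gr[OF b]] by (simp add: algebra_simps)
    have e1: "d (mu p a (L b ?u)) = sg (p + 1) (L (curv A) (L (amul A a b) ?u)
        - L (amul A (adiff A a) b) ?u - sg p (L (amul A a (adiff A b)) ?u)
        + mu (p + r) (amul A a b) ?u + sg (p + r - 1) (L (amul A a b) (d ?u)))"
      by (simp add: mu_L[OF a b u] lin_sg[OF lin_d] d_L[of "amul A a b" ?u "p + r"] diff_mul[OF a b]
          L_add[OF 1 gr_sg[OF graded_A 2] u] L_sg[OF 2 u] diff_diff_eq)
    have e2: "L (curv A) (mu p a (L b ?u)) = sg (p + 1) (L (curv A) (L (amul A a b) ?u))"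
      by (simp add: mu_L[OF a b u] lin_sg[OF lin_lcons])
    have e3: "mu (p + 1) (adiff A a) (L b ?u) = sg p (L (amul A (adiff A a) b) ?u)"
      using mu_L[OF diff_gr[OF a] b u] by (simp add: sg_def)
    have e4: "mu p a (d (L b ?u)) = sg (p + 1) (L (amul A a (curv A)) (L b ?u))
        - sg (p + 1) (L (amul A a (adiff A b)) ?u) - mu (p + r) (amul A a b) ?u
        + sg (p + r) (L (amul A a b) (d ?u))"
      by (simp add: d_L[of b ?u r] lin_simps[OF lin_mu] mu_L[OF a curv_gr Lbu]
          mu_L[OF a diff_gr[OF b] u] mu_mu[OF a b u] mu_L[OF a b du]) (simp add: add.commute)
    show ?thesis
      unfolding g e1 e2 e3 e4
      by (cases "even p"; cases "even r") (simp_all add: sg_def algebra_simps)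
  qed
qed

text \<open>
  Applying \<open>d\<close> to \<open>d(a t) = c a t - (da) t + \<mu>\<^sub>a t \<plusminus> a d(t)\<close> and using the induction hypothesis
  \<open>d(d(t)) = 0\<close>, everything cancels in pairs except for \<open>(d(da)) t - (c a) t + (a c) t\<close>, which is zero
  since \<open>d\<^sup>2\<close> is the commutator with \<open>c\<close> on \<open>A\<close>.
\<close>

lemma d_d: "t \<in> gr BM n \<Longrightarrow> d (d t) = 0"
proof (rule bar_tensor_eqI[OF _ lin_compose[OF lin_d lin_d] lin_null])
  fix w m k q assume w: "hword A w k" and m: "m \<in> gr M q"
  from w show "d (d (gen w m)) = 0"
  proof induction
    case hword_Nil
    note dm = mdiff_gr[OF m]
    have 0: "gen [adiff A (curv A)] m = 0"
      using word_Cons_zero[OF graded_A, of "[]"] tens_zero_left[OF gr_zero[OF graded_BA] m]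
      by (simp add: diff_curv)
    show ?case
      by (simp add: d_Nil[OF m] lin_simps[OF lin_d] d_Nil[OF dm] d_single[OF curv_gr m] 0
          lin_simps[OF lin_lcons] L_gen[OF curv_gr hword.hword_Nil m]
          L_gen[OF curv_gr hword.hword_Nil dm] L_gen[OF curv_gr hword_single[OF curv_gr] m]
          mdiff_mdiff[OF m]) (simp add: sg_def)
  next
    case (hword_Cons a p w k)
    note a = hword_Cons(1)
    let ?u = "gen w m"
    have u: "?u \<in> gr BM (k + q)" by (rule gen_gr[OF hword_Cons(2) m HOL.refl])
    note Lau = L_gr[OF a u] and du = d_gr[OF u]
    have ca: "amul A (curv A) a \<in> gr A (p + 2)" "amul A a (curv A) \<in> gr A (p + 2)"
      using mul_gr[OF curv_gr a] mul_gr[OF a curv_gr] by (simp_all add: add.commute)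
    have "d (L (curv A) (L a ?u)) = L (curv A) (L (curv A) (L a ?u)) - L (amul A (curv A) a) ?u
        - L (curv A) (d (L a ?u))"
      by (simp add: d_L[of "curv A" _ 2] diff_curv L_zero[OF Lau] mu_L[OF curv_gr a u])
        (simp add: sg_def)
    moreover have "d (L (adiff A a) ?u) = L (curv A) (L (adiff A a) ?u) - L (amul A (curv A) a) ?u
        + L (amul A a (curv A)) ?u + mu (p + 1) (adiff A a) ?u + sg p (L (adiff A a) (d ?u))"
      by (simp add: d_L[of "adiff A a" _ "p + 1"] diff_diff[OF a] L_diff[OF ca u])
    moreover have "d (L a (d ?u)) = L (curv A) (L a (d ?u)) - L (adiff A a) (d ?u) + mu p a (d ?u)"
      by (simp add: d_L[of a "d ?u" p] hword_Cons.IH lin_zero[OF lin_lcons])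
    moreover note d_mu[OF a u]
    ultimately have "d (d (L a ?u)) = 0"
      unfolding d_L[of a ?u p] lin_simps[OF lin_d] lin_simps[OF lin_lcons]
      by (cases "even p") (simp_all add: sg_def)
    then show ?case by (simp add: L_gen[OF a hword_Cons(2) m])
  qed
qed

end

section \<open>A homotopy from a functional on the curvature\<close>

locale curvature_functional = curved_module A M
  for A :: "('k::field, 'a::ab_group_add) cdg_alg"
    and M :: "('k, 'a, 'm::ab_group_add) cdg_mod" +
  fixes \<xi> :: "'a \<Rightarrow> 'k"
  assumes \<xi>_add: "a \<in> gr A p \<Longrightarrow> b \<in> gr A p \<Longrightarrow> \<xi> (a + b) = \<xi> a + \<xi> b"
    and \<xi>_scale: "a \<in> gr A p \<Longrightarrow> \<xi> (smult A c a) = c * \<xi> a"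
    and \<xi>_degree: "a \<in> gr A p \<Longrightarrow> p \<noteq> 2 \<Longrightarrow> \<xi> a = 0"
    and \<xi>_curv: "\<xi> (curv A) = 1"
begin

lemma shifted_\<xi>: "shifted_action (- 2) (\<lambda>a. smult M (\<xi> a))"
proof -
  interpret vector_space "smult M" using graded_M by (simp add: graded_space_def)
  have gr: "smult M (\<xi> a) m \<in> gr M (q + (p - 2))" if "a \<in> gr A p" "m \<in> gr M q" for a m p q
    using gr_scale[OF graded_M that(2), of "\<xi> a"] gr_zero[OF graded_M] \<xi>_degree[OF that(1)]
    by (cases "p = 2") simp_all
  have gr': "smult M (\<xi> a) m \<in> gr M (p + (q - 2))" if "a \<in> gr A p" "m \<in> gr M q" for a m p q
    using gr[OF that] by (simp add: algebra_simps)
  show ?thesis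
    unfolding shifted_action_def gmap_def
    by (auto simp: scale_right_distrib scale_left_distrib \<xi>_add \<xi>_scale mult.commute gr gr')
qed

definition h where "h = twisted (\<lambda>a. smult M (\<xi> a))"

lemma lin_h: "lin h"
  unfolding h_def by (rule lin_twisted)

lemma h_gr: "t \<in> gr BM n \<Longrightarrow> h t \<in> gr BM (n - 1)"
  using twisted_gr[OF shifted_\<xi>, of t n] by (simp add: h_def)

lemma h_Nil: "m \<in> gr M q \<Longrightarrow> h (gen [] m) = 0"
  unfolding h_def by (rule twisted_Nil[OF shifted_\<xi>])

lemma h_single: "a \<in> gr A p \<Longrightarrow> m \<in> gr M q \<Longrightarrow> h (gen [a] m) = fscale (\<xi> a) (gen [] m)"
  by (simp add: h_def twisted_single[OF shifted_\<xi>] gen_Nil_scale)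

lemma h_Cons:
  "a \<in> gr A p \<Longrightarrow> b \<in> gr A r \<Longrightarrow> hword A w n \<Longrightarrow> m \<in> gr M q \<Longrightarrow>
    h (gen (a # b # w) m) = sg (p - 1) (L a (h (gen (b # w) m)))"
  unfolding h_def by (rule twisted_Cons[OF shifted_\<xi>])

text \<open>
  The part of \<open>h(a t)\<close> in which \<open>a\<close> is cut off; it is zero unless \<open>t = 1 \<otimes> m\<close>.
\<close>

definition \<kappa> where "\<kappa> p a t = h (L a t) - sg (p - 1) (L a (h t))"

lemma h_L: "h (L a t) = sg (p - 1) (L a (h t)) + \<kappa> p a t"
  by (simp add: \<kappa>_def)

lemma lin_\<kappa>: "lin (\<kappa> p a)"
  unfolding \<kappa>_def[abs_def]
  by (intro lin_sub lin_sgn lin_compose[OF lin_h lin_lcons] lin_compose[OF lin_lcons lin_h])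

lemma \<kappa>_Nil: "a \<in> gr A p \<Longrightarrow> m \<in> gr M q \<Longrightarrow> \<kappa> p a (gen [] m) = fscale (\<xi> a) (gen [] m)"
  by (simp add: \<kappa>_def L_gen[OF _ hword_Nil] h_single h_Nil lin_zero[OF lin_lcons])

lemma \<kappa>_L:
  assumes a: "a \<in> gr A p" and b: "b \<in> gr A r" and t: "t \<in> gr BM n"
  shows "\<kappa> p a (L b t) = 0"
proof (rule bar_tensor_eqI[OF t lin_compose[OF lin_\<kappa> lin_lcons] lin_null])
  fix w m k q assume *: "hword A w k" "m \<in> gr M q"
  show "\<kappa> p a (L b (gen w m)) = 0"
    by (simp add: \<kappa>_def L_gen[OF b *] L_gen[OF a hword_Cons[OF b *(1)] *(2)] h_Cons[OF a b *])
qed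

definition G where "G t = d (h t) + h (d t)"

lemma lin_G: "lin G"
  unfolding G_def[abs_def] by (intro lin_plus lin_compose[OF lin_d lin_h] lin_compose[OF lin_h lin_d])

lemma G_gr: "t \<in> gr BM n \<Longrightarrow> G t \<in> gr BM n"
  using d_gr[OF h_gr, of t n] h_gr[OF d_gr, of t n] by (simp add: G_def gr_tensor_closed)

lemma G_d: "t \<in> gr BM n \<Longrightarrow> G (d t) = d (G t)"
  by (simp add: G_def lin_add[OF lin_d] d_d[OF h_gr] d_d lin_zero[OF lin_h])

lemma G_Nil: "m \<in> gr M q \<Longrightarrow> G (gen [] m) = gen [] m"
  by (simp add: G_def h_Nil lin_zero[OF lin_d] d_Nil lin_add[OF lin_h] h_single[OF curv_gr] \<xi>_curv
      h_Nil[OF mdiff_gr] fscale_def fun_eq_iff fun_simps)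

text \<open>
  The sign matters only where \<open>\<xi>(a)\<close> is non-zero, that is, for \<open>p = 2\<close>.
\<close>

lemma fscale_sg_\<xi>: "a \<in> gr A p \<Longrightarrow> sg (p - 1) (fscale (\<xi> a) t) = - fscale (\<xi> a) t"
  by (cases "p = 2") (simp_all add: sg_def \<xi>_degree)

lemma G_single:
  assumes a: "a \<in> gr A p" and m: "m \<in> gr M q"
  shows "G (gen [a] m) = gen [a] m - fscale (\<xi> (adiff A a)) (gen [] m)"
proof -
  note dm = mdiff_gr[OF m]
  have "sg (p - 1) (h (L a (d (gen [] m)))) = gen [a] m - fscale (\<xi> a) (gen [] (mdiff M m))"
    by (simp add: d_Nil[OF m] lin_simps[OF lin_lcons] lin_simps[OF lin_h] L_gen[OF a hword_Nil dm]
        L_gen[OF a hword_single[OF curv_gr] m] h_Cons[OF a curv_gr hword_Nil m] h_single[OF curv_gr m]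
        \<xi>_curv h_single[OF a dm] sg_distrib fscale_sg_\<xi>[OF a] L_gen[OF a hword_Nil m]) (simp add: sg_def)
  moreover have "h (gen [curv A, a] m) = - fscale (\<xi> a) (gen [curv A] m)"
    by (simp add: h_Cons[OF curv_gr a hword_Nil m] h_single[OF a m] lin_simps[OF lin_lcons]
        L_gen[OF curv_gr hword_Nil m]) (simp add: sg_def)
  ultimately show ?thesis
    by (simp add: G_def h_single[OF a m] lin_simps[OF lin_d] d_Nil[OF m] d_single[OF a m]
        lin_simps[OF lin_h] h_single[OF diff_gr[OF a] m] h_Nil[OF act_gr[OF a m]]
        fs.scale_right_distrib)
qed

text \<open>
  Both \<open>d\<close> and \<open>h\<close> pass the letter \<open>a\<close> up to sign, and since \<open>G\<close> is even it passes \<open>a\<close> without sign.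
  The corrections that survive are those in which one of \<open>d\<close> and \<open>h\<close> lets a letter meet what follows
  it and the other one cuts off a letter.
\<close>

lemma G_L_L:
  assumes a: "a \<in> gr A p" and b: "b \<in> gr A r" and u: "u \<in> gr BM n"
  shows "G (L a (L b u)) = L a (G (L b u)) +
    sg (p + 1) (mu p a (\<kappa> r b u) + \<kappa> (p + r) (amul A a b) u + \<kappa> p a (mu r b u))"
proof -
  note t = L_gr[OF b u] and ab = mul_gr[OF a b]
  have hd: "h (L (curv A) (L a (L b u))) = - L (curv A) (h (L a (L b u)))"
    by (simp add: h_L[of "curv A" _ 2] \<kappa>_L[OF curv_gr a t]) (simp add: sg_def)
  have ha: "h (L a (L b u)) = sg (p - 1) (L a (h (L b u)))"
    by (simp add: h_L[of a _ p] \<kappa>_L[OF a b u])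
  have hda: "h (L (adiff A a) (L b u)) = sg p (L (adiff A a) (h (L b u)))"
    by (simp add: h_L[of "adiff A a" _ "p + 1"] \<kappa>_L[OF diff_gr[OF a] b u])
  have hdt: "h (L a (d (L b u))) = sg (p - 1) (L a (h (d (L b u)))) + \<kappa> p a (mu r b u)"
    by (simp add: h_L[of a _ p] d_L[of b u r] lin_simps[OF lin_\<kappa>] \<kappa>_L[OF a curv_gr t]
        \<kappa>_L[OF a diff_gr[OF b] u] \<kappa>_L[OF a b d_gr[OF u]])
  have hmu: "h (mu p a (L b u)) = sg (p + 1) (sg (p + r - 1) (L (amul A a b) (h u)) + \<kappa> (p + r) (amul A a b) u)"
    by (simp only: mu_L[OF a b u] lin_sg[OF lin_h] h_L[of "amul A a b" _ "p + r"])
  have muh: "mu p a (h (L b u)) = sg (r - 1) (sg (p + 1) (L (amul A a b) (h u))) + mu p a (\<kappa> r b u)"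
    by (simp only: h_L[of b _ r] lin_simps[OF lin_mu] mu_L[OF a b h_gr[OF u]])
  have e1: "G (L a (L b u)) = sg (p - 1) (d (L a (h (L b u)))) + h (d (L a (L b u)))"
    by (simp add: G_def ha lin_sg[OF lin_d])
  have e2: "sg (p - 1) (d (L a (h (L b u)))) + h (d (L a (L b u))) =
      L a (G (L b u)) + (sg (p - 1) (mu p a (h (L b u))) + h (mu p a (L b u))) +
      sg (p - 1) (\<kappa> p a (mu r b u))"
    unfolding d_L[of a _ p] lin_simps[OF lin_h] hd hda hdt G_def lin_simps[OF lin_lcons] ha
    by (cases "even p") (simp_all add: sg_def)
  have e3: "sg (p - 1) (mu p a (h (L b u))) + h (mu p a (L b u)) =
      sg (p + 1) (mu p a (\<kappa> r b u)) + sg (p + 1) (\<kappa> (p + r) (amul A a b) u)"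
    unfolding muh hmu by (cases "even p"; cases "even r") (simp_all add: sg_def)
  have e4: "sg (p - 1) (\<kappa> p a (mu r b u)) = sg (p + 1) (\<kappa> p a (mu r b u))"
    by (simp add: sg_def)
  show ?thesis
    unfolding e1 e2 e3 e4 sg_distrib by (simp only: add.assoc)
qed

lemma \<xi>_gr: "a \<in> gr A p \<Longrightarrow> m \<in> gr M q \<Longrightarrow> smult M (\<xi> a) m \<in> gr M (p + q - 2)"
  using shifted_gr[OF shifted_\<xi>, of a p m q] by simp

text \<open>
  The corrections to \<open>G(a t) = a G(t)\<close> only arise for words of length at most two, and they leave the
  empty word.
\<close>

lemma G_Cons:
  assumes a: "a \<in> gr A p" and w: "hword A w n" and m: "m \<in> gr M q"
  shows "\<exists>m'\<in>gr M (p - 1 + n + q). G (gen (a # w) m) = L a (G (gen w m)) + gen [] m'"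
  using w
proof cases
  case hword_Nil
  let ?m = "- smult M (\<xi> (adiff A a)) m"
  have m': "smult M (\<xi> (adiff A a)) m \<in> gr M (p - 1 + n + q)"
    using \<xi>_gr[OF diff_gr[OF a] m] hword_Nil by (simp add: algebra_simps)
  have "gen [] ?m = - fscale (\<xi> (adiff A a)) (gen [] m)"
    using gen_Nil_sg[OF m', of 1] by (simp add: sg_def gen_Nil_scale[OF m])
  then show ?thesis
    using gr_neg[OF graded_M m'] hword_Nil
    by (intro bexI[of _ ?m]) (simp_all add: G_single[OF a m] G_Nil[OF m] L_gen[OF a hword.hword_Nil m])
next
  case (hword_Cons b r v j)
  note b = hword_Cons(3) and v = hword_Cons(4)
  let ?u = "gen v m"
  have u: "?u \<in> gr BM (j + q)" by (rule gen_gr[OF v m HOL.refl])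
  let ?R = "mu p a (\<kappa> r b ?u) + \<kappa> (p + r) (amul A a b) ?u + \<kappa> p a (mu r b ?u)"
  have "\<exists>m'\<in>gr M (p - 1 + n + q). ?R = gen [] m'"
    using v
  proof cases
    case hword_Nil
    let ?x = "smult M (\<xi> b) (act M a m)" and ?y = "smult M (\<xi> (amul A a b)) m"
      and ?z = "smult M (\<xi> a) (act M b m)"
    have n: "p - 1 + n + q = p + q + r - 2" using hword_Nil hword_Cons(2) by simp
    have x: "?x \<in> gr M (p - 1 + n + q)" and y: "?y \<in> gr M (p - 1 + n + q)"
      and z: "?z \<in> gr M (p - 1 + n + q)"
      using \<xi>_gr[OF b act_gr[OF a m]] \<xi>_gr[OF mul_gr[OF a b] m] \<xi>_gr[OF a act_gr[OF b m]]
      unfolding n by (simp_all add: algebra_simps)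
    note s = gen_Nil_scale[OF act_gr[OF a m]] gen_Nil_scale[OF m] gen_Nil_scale[OF act_gr[OF b m]]
    have "gen [] (?y - ?x - ?z) = gen [] ?y - gen [] ?x - gen [] ?z"
      using gen_Nil_add[OF gr_diff[OF graded_M y x] gr_neg[OF graded_M z]]
        gen_Nil_add[OF y gr_neg[OF graded_M x]] gen_Nil_sg[OF x, of 1] gen_Nil_sg[OF z, of 1]
      by (simp add: sg_def)
    moreover have "?R = gen [] ?y - gen [] ?x - gen [] ?z"
      by (simp add: s hword_Nil \<kappa>_Nil[OF b m] \<kappa>_Nil[OF mul_gr[OF a b] m] lin_simps[OF lin_mu]
          lin_simps[OF lin_\<kappa>] mu_Nil[OF a m] mu_Nil[OF b m] \<kappa>_Nil[OF a act_gr[OF b m]])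
    ultimately show ?thesis
      using gr_diff[OF graded_M gr_diff[OF graded_M y x] z] by (intro bexI[of _ "?y - ?x - ?z"]) simp_all
  next
    case (hword_Cons e k v' l)
    note e = hword_Cons(3) and v' = hword_Cons(4)
    have u': "gen v' m \<in> gr BM (l + q)" by (rule gen_gr[OF v' m HOL.refl])
    have "?u = L e (gen v' m)" by (simp add: hword_Cons(1) L_gen[OF e v' m])
    then have "?R = 0"
      by (simp add: \<kappa>_L[OF b e u'] \<kappa>_L[OF mul_gr[OF a b] e u'] mu_L[OF b e u'] lin_simps[OF lin_mu]
          lin_simps[OF lin_\<kappa>] \<kappa>_L[OF a mul_gr[OF b e] u'])
    then show ?thesis
      using gr_zero[OF graded_M] gen_Nil_zero by (intro bexI[of _ 0]) simp_all
  qed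
  then obtain m' where m': "m' \<in> gr M (p - 1 + n + q)" "?R = gen [] m'" by blast
  have "G (gen (a # w) m) = L a (G (gen w m)) + gen [] (sg (p + 1) m')"
    using G_L_L[OF a b u] hword_Cons(1) m'(2)
    by (simp add: L_gen[OF b v m] L_gen[OF a hword.hword_Cons[OF b v] m] gen_Nil_sg[OF m'(1)])
  then show ?thesis
    using gr_sg[OF graded_M m'(1)] by blast
qed

end

section \<open>Inverting a unipotent operator\<close>

text \<open>
  The inverse is the Neumann series \<open>\<Sum> N\<^sup>i t\<close> of \<open>N = 1 - G\<close>, a finite sum for each \<open>t\<close>.  Its linearity
  is a consequence of the injectivity of \<open>G\<close>: if \<open>G s = 0\<close> then \<open>N s = s\<close>, and \<open>s = 0\<close> by nilpotence.
\<close>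

lemma unipotent_inverse:
  fixes V W and G :: "(('v::ab_group_add \<Rightarrow> 'w::ab_group_add \<Rightarrow> 'k::field) \<Rightarrow> 'k) \<Rightarrow> _"
  defines "T \<equiv> tensor V W"
  assumes G: "lin G" and G_gr: "\<And>n t. t \<in> gr T n \<Longrightarrow> G t \<in> gr T n"
    and nil: "\<And>n t. t \<in> gr T n \<Longrightarrow> \<exists>k. ((\<lambda>t. t - G t) ^^ k) t = 0"
  shows "\<exists>P. gmap T T 0 P \<and> (\<forall>n. \<forall>t\<in>gr T n. G (P t) = t \<and> P (G t) = t)"
proof -
  define N where "N t = t - G t" for t
  have lin_N: "lin (N ^^ k)" for k
    by (induction k) (auto simp: N_def intro!: lin_intros lin_compose[OF G] simp: id_def
        lin_def lin_simps[OF G] algebra_simps fs.scale_right_diff_distrib)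
  have N_gr: "(N ^^ k) t \<in> gr T n" if "t \<in> gr T n" for k t n
    using that G_gr by (induction k) (simp_all add: N_def T_def gr_tensor_closed)
  define P where "P t = (\<Sum>i<(LEAST k. (N ^^ k) t = 0). (N ^^ i) t)" for t
  have P_gr: "P t \<in> gr T n" if "t \<in> gr T n" for t n
    using N_gr[OF that] unfolding P_def T_def gr_tensor by (intro fs.span_sum)
  have GP: "G (P t) = t" if t: "t \<in> gr T n" for t n
  proof -
    let ?k = "LEAST k. (N ^^ k) t = 0"
    have k: "(N ^^ ?k) t = 0"
      using nil[OF t, folded N_def[abs_def]] by (rule LeastI_ex)
    have "G (P t) = (\<Sum>i<?k. (N ^^ i) t - (N ^^ Suc i) t)"
      unfolding P_def lin_sum[OF G] by (intro sum.cong) (simp_all add: N_def)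
    also have "\<dots> = t - (N ^^ ?k) t" using sum_lessThan_telescope'[of "\<lambda>i. (N ^^ i) t" ?k] by simp
    finally show ?thesis by (simp add: k)
  qed
  have inj: "s = t" if s: "s \<in> gr T n" and t: "t \<in> gr T n" and eq: "G s = G t" for s t n
  proof -
    have st: "s - t \<in> gr T n" using s t by (simp add: T_def gr_tensor_closed)
    have "(N ^^ k) (s - t) = s - t" for k
      by (induction k) (simp_all add: N_def lin_diff[OF G] eq)
    then show ?thesis using nil[OF st, folded N_def[abs_def]] by simp
  qed
  have closed: "s + t \<in> gr T n" "fscale c s \<in> gr T n" if "s \<in> gr T n" "t \<in> gr T n" for s t n c
    using that by (simp_all add: T_def gr_tensor_closed)
  have "gmap T T 0 P"
    unfolding gmap_def
  proof (intro allI ballI conjI)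
    fix n s assume s: "s \<in> gr T n"
    show "P s \<in> gr T (n + 0)" using P_gr[OF s] by simp
    show "P (smult T c s) = smult T c (P s)" for c
      using inj[OF P_gr[OF closed(2)[OF s s]] closed(2)[OF P_gr[OF s] P_gr[OF s]], of c c]
        GP[OF closed(2)[OF s s], of c] GP[OF s] by (simp add: T_def lin_scale[OF G])
    fix t assume t: "t \<in> gr T n"
    show "P (s + t) = P s + P t"
      using inj[OF P_gr[OF closed(1)[OF s t]] closed(1)[OF P_gr[OF s] P_gr[OF t]]]
        GP[OF closed(1)[OF s t]] GP[OF s] GP[OF t] by (simp add: lin_add[OF G])
  qed
  moreover have "G (P t) = t \<and> P (G t) = t" if t: "t \<in> gr T n" for t n
    using GP[OF t] inj[OF P_gr[OF G_gr[OF t]] t] GP[OF G_gr[OF t]] by simp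
  ultimately show ?thesis by blast
qed


section \<open>Comodule maps\<close>

lemma tens_sg_right:
  assumes "x \<in> gr V p" "z \<in> gr (tensor X Y) q"
  shows "tens V (tensor X Y) x (sg r z) = sg r (tens V (tensor X Y) x z)"
  using tens_scale_right[OF assms, of "- 1"] by (simp add: sg_def)

lemma gmap_comp:
  assumes g: "gmap U V s g" and f: "gmap V W r f"
  shows "gmap U W (s + r) (\<lambda>x. f (g x))"
  unfolding gmap_def
proof (intro allI ballI conjI)
  fix n x assume x: "x \<in> gr U n"
  show "f (g x) \<in> gr W (n + (s + r))"
    using gmapD(1)[OF f gmapD(1)[OF g x]] by (simp add: add.assoc)
  show "f (g (smult U c x)) = smult W c (f (g x))" for c
    by (simp only: gmapD(3)[OF g x] gmapD(3)[OF f gmapD(1)[OF g x]])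
  fix y assume y: "y \<in> gr U n"
  show "f (g (x + y)) = f (g x) + f (g y)"
    by (simp only: gmapD(2)[OF g x y] gmapD(2)[OF f gmapD(1)[OF g x] gmapD(1)[OF g y]])
qed

context curved_module
begin

text \<open>
  A linear map of degree \<open>r\<close> that passes a letter with its Koszul sign, up to an element \<open>1 \<otimes> m'\<close>, is a
  comodule map: this describes the maps \<open>\<Sum> \<plusminus> a\<^sub>1 \<dots> a\<^sub>i \<otimes> f(a\<^bsub>i+1\<^esub> \<dots> a\<^sub>n \<otimes> m)\<close> corestricting to
  \<open>f : BA \<otimes> M \<rightarrow> M\<close>, where \<open>1 \<otimes> m'\<close> is the summand with \<open>i = 0\<close>.
\<close>

lemma comodule_mapI:
  assumes T: "lin T" and T_gr: "\<And>n t. t \<in> gr BM n \<Longrightarrow> T t \<in> gr BM (n + r)"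
    and T_Nil: "\<And>q m. m \<in> gr M q \<Longrightarrow> \<exists>m'\<in>gr M (q + r). T (gen [] m) = gen [] m'"
    and T_Cons: "\<And>a p w n m q. a \<in> gr A p \<Longrightarrow> hword A w n \<Longrightarrow> m \<in> gr M q \<Longrightarrow>
      \<exists>m'\<in>gr M (p - 1 + n + q + r). T (gen (a # w) m) = sg (r * (p - 1)) (L a (T (gen w m))) + gen [] m'"
  shows "comodule_map A M M r T"
  unfolding comodule_map_def
proof (intro conjI allI ballI)
  show gT: "gmap BM BM r T" by (rule lin_gmap[OF T T_gr])
  let ?I = "tmap (bar A) (bar A) BM r id T"
  have I: "?I (tens (bar A) BM x z) = sg (r * p) (tens (bar A) BM x (T z))"
    if "x \<in> gr (bar A) p" "z \<in> gr BM q" for x z p q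
    using tmap_tens[OF graded_BA gmap_id gT that] by simp
  have I_lcons: "?I (lcons A BM a t) = sg (r * (p - 1)) (lcons A BM a (?I t))"
    if a: "a \<in> gr A p" and t: "t \<in> gr (tensor (bar A) BM) n" for a p t n
  proof (rule tensor_eqI[OF t lin_compose[OF lin_tmap lin_lcons] lin_sgn[OF lin_compose[OF lin_lcons lin_tmap]]])
    fix x z k l assume x: "x \<in> gr (bar A) k" and z: "z \<in> gr BM l"
    show "?I (lcons A BM a (tens (bar A) BM x z)) =
        sg (r * (p - 1)) (lcons A BM a (?I (tens (bar A) BM x z)))"
      using I[OF gmapD(1)[OF gmap_bar_cons[OF a] x] z]
      by (simp add: lcons_tens[OF graded_A a x z] I[OF x z] lin_sg[OF lin_lcons]
          lcons_tens[OF graded_A a x T_gr[OF z]] algebra_simps)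
  qed
  fix n t assume "t \<in> gr BM n"
  then show "bar_coact A M (T t) = ?I (bar_coact A M t)"
  proof (rule bar_tensor_eqI[OF _ lin_compose[OF lin_coact T] lin_compose[OF lin_tmap lin_coact]])
    fix w m k q assume w: "hword A w k" and m: "m \<in> gr M q"
    from w show "bar_coact A M (T (gen w m)) = ?I (bar_coact A M (gen w m))"
    proof induction
      case hword_Nil
      obtain m' where m': "m' \<in> gr M (q + r)" "T (gen [] m) = gen [] m'" using T_Nil[OF m] by blast
      show ?case
        unfolding coact_Nil[OF m] I[OF gr_word_Nil gen_Nil_gr[OF m]] m'(2) coact_Nil[OF m'(1)]
        by simp
    next
      case (hword_Cons a p w k)
      note a = hword_Cons(1) and w = hword_Cons(2)
      obtain m' where m': "m' \<in> gr M (p - 1 + k + q + r)"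
        "T (gen (a # w) m) = sg (r * (p - 1)) (L a (T (gen w m))) + gen [] m'"
        using T_Cons[OF a w m] by blast
      let ?g = "gen w m"
      have g: "?g \<in> gr BM (k + q)" by (rule gen_gr[OF w m HOL.refl])
      have LT: "L a (T ?g) \<in> gr BM (p - 1 + k + q + r)"
        using L_gr[OF a T_gr[OF g]] by (simp add: algebra_simps)
      have e1: "bar_coact A M (T (gen (a # w) m)) =
          sg (r * (p - 1)) (tens (bar A) BM (word A []) (L a (T ?g))) +
          tens (bar A) BM (word A []) (gen [] m') +
          sg (r * (p - 1)) (lcons A BM a (bar_coact A M (T ?g)))"
        by (simp add: m'(2) lin_simps[OF lin_coact] coact_L[OF a T_gr[OF g]] coact_Nil[OF m'(1)]
            sg_distrib)
      have e2: "sg (r * (p - 1)) (tens (bar A) BM (word A []) (L a (T ?g))) +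
          tens (bar A) BM (word A []) (gen [] m') = tens (bar A) BM (word A []) (T (gen (a # w) m))"
        by (simp only: m'(2) tens_add_right[OF gr_word_Nil gr_tensor_closed(3)[OF LT] gen_Nil_gr[OF m'(1)]]
          tens_sg_right[OF gr_word_Nil LT])
      have i: "?I (tens (bar A) BM (word A []) (gen (a # w) m)) =
          tens (bar A) BM (word A []) (T (gen (a # w) m))"
        using I[OF gr_word_Nil gen_gr[OF hword.hword_Cons[OF a w] m HOL.refl]] by simp
      show ?case
        unfolding e1 e2 coact_Cons[OF a w m] lin_add[OF lin_tmap] i I_lcons[OF a coact_gen_gr[OF w m]]
          hword_Cons.IH ..
    qed
  qed
qed

lemma tmap_comp:
  assumes f: "gmap BM BM r f" and g: "gmap BM BM s g" and t: "t \<in> gr (tensor (bar A) BM) n"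
  shows "tmap (bar A) (bar A) BM r id f (tmap (bar A) (bar A) BM s id g t) =
    tmap (bar A) (bar A) BM (r + s) id (\<lambda>x. f (g x)) t"
proof (rule tensor_eqI[OF t lin_compose[OF lin_tmap lin_tmap] lin_tmap])
  have fg: "gmap BM BM (s + r) (\<lambda>x. f (g x))"
    by (rule gmap_comp[OF g f])
  fix x z p q assume x: "x \<in> gr (bar A) p" and z: "z \<in> gr BM q"
  show "tmap (bar A) (bar A) BM r id f (tmap (bar A) (bar A) BM s id g (tens (bar A) BM x z)) =
      tmap (bar A) (bar A) BM (r + s) id (\<lambda>x. f (g x)) (tens (bar A) BM x z)"
    using tmap_tens[OF graded_BA gmap_id f x gmapD(1)[OF g z], of r]
    by (simp add: tmap_tens[OF graded_BA gmap_id g x z] tmap_tens[OF graded_BA gmap_id fg x z]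
        lin_sg[OF lin_tmap] distrib_right add.commute)
qed

lemma comodule_map_comp:
  assumes f: "comodule_map A M M r f" and g: "comodule_map A M M s g"
  shows "comodule_map A M M (r + s) (\<lambda>t. f (g t))"
proof -
  note f' = f[unfolded comodule_map_def] and g' = g[unfolded comodule_map_def]
  have "gmap BM BM (r + s) (\<lambda>x. f (g x))"
    using gmap_comp[OF conjunct1[OF g'] conjunct1[OF f']] by (simp add: add.commute)
  moreover have "bar_coact A M (f (g t)) =
      tmap (bar A) (bar A) BM (r + s) id (\<lambda>x. f (g x)) (bar_coact A M t)" if t: "t \<in> gr BM n" for t n
    using f' g' t gmapD(1)[OF conjunct1[OF g'] t]
      tmap_comp[OF conjunct1[OF f'] conjunct1[OF g'] coact_gr[OF t]] by simp
  ultimately show ?thesis by (simp add: comodule_map_def)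
qed

lemma comodule_map_inverse:
  assumes f: "comodule_map A M M 0 f" and g: "gmap BM BM 0 g"
    and inv: "\<And>n t. t \<in> gr BM n \<Longrightarrow> f (g t) = t \<and> g (f t) = t"
  shows "comodule_map A M M 0 g"
proof -
  note f' = f[unfolded comodule_map_def]
  have fg: "gmap BM BM 0 f" using f' ..
  have "bar_coact A M (g t) = tmap (bar A) (bar A) BM 0 id g (bar_coact A M t)"
    if t: "t \<in> gr BM n" for t n
  proof -
    have gt: "g t \<in> gr BM n" using gmapD(1)[OF g t] by simp
    have C: "bar_coact A M (g t) \<in> gr (tensor (bar A) BM) n" by (rule coact_gr[OF gt])
    have gf: "gmap BM BM 0 (\<lambda>x. g (f x))"
      using gmap_comp[OF fg g] by simp
    have "tmap (bar A) (bar A) BM 0 id g (bar_coact A M t) =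
        tmap (bar A) (bar A) BM 0 id g (tmap (bar A) (bar A) BM 0 id f (bar_coact A M (g t)))"
      using f' gt inv[OF t] by metis
    also have "\<dots> = tmap (bar A) (bar A) BM 0 id (\<lambda>x. g (f x)) (bar_coact A M (g t))"
      using tmap_comp[OF g fg C] by simp
    also have "\<dots> = bar_coact A M (g t)"
    proof (rule tensor_eqI[OF C lin_tmap lin_ident])
      fix x z p q assume x: "x \<in> gr (bar A) p" and z: "z \<in> gr BM q"
      show "tmap (bar A) (bar A) BM 0 id (\<lambda>x. g (f x)) (tens (bar A) BM x z) = tens (bar A) BM x z"
        using tmap_tens[OF graded_BA gmap_id gf x z, of 0] inv[OF z] by simp
    qed
    finally show ?thesis by simp
  qed
  with g show ?thesis by (simp add: comodule_map_def)
qed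

end

section \<open>Bar acyclicity\<close>

context curvature_functional
begin

text \<open>
  The filtration by word length, with all degrees taken together.
\<close>

definition short_gens :: "nat \<Rightarrow> _ set" where
  "short_gens j = {gen w m | w m n q. hword A w n \<and> m \<in> gr M q \<and> length w \<le> j}"

definition filt :: "nat \<Rightarrow> _ set" where
  "filt j = fs.span (short_gens j)"

lemma filt_gen: "hword A w n \<Longrightarrow> m \<in> gr M q \<Longrightarrow> length w \<le> j \<Longrightarrow> gen w m \<in> filt j"
  unfolding filt_def short_gens_def by (rule fs.span_base) blast

lemma filt_mono: "i \<le> j \<Longrightarrow> filt i \<subseteq> filt j"
  unfolding filt_def short_gens_def by (rule fs.span_mono) (use le_trans in blast)

lemma lin_filt:
  assumes f: "lin f" and t: "t \<in> filt i"
    and "\<And>w n m q. hword A w n \<Longrightarrow> m \<in> gr M q \<Longrightarrow> length w \<le> i \<Longrightarrow> f (gen w m) \<in> filt j"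
  shows "f t \<in> filt j"
  using t unfolding filt_def
proof (rule lin_span_mem[OF f, rotated])
  fix x assume "x \<in> short_gens i"
  then obtain w m n q where "x = gen w m" "hword A w n" "m \<in> gr M q" "length w \<le> i"
    unfolding short_gens_def by blast
  then show "f x \<in> fs.span (short_gens j)"
    using assms(3)[of w n m q] by (simp add: filt_def)
qed

lemma L_filt:
  assumes a: "a \<in> gr A p" and t: "t \<in> filt j"
  shows "L a t \<in> filt (Suc j)"
proof (rule lin_filt[OF lin_lcons t])
  fix w n m q assume w: "hword A w n" "m \<in> gr M q" and "length w \<le> j"
  then show "L a (gen w m) \<in> filt (Suc j)"
    unfolding L_gen[OF a w] by (intro filt_gen[OF hword_Cons[OF a w(1)] w(2)]) simp
qed

lemma gr_filt: "t \<in> gr BM n \<Longrightarrow> \<exists>j. t \<in> filt j"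
  unfolding gr_bar_tensor
proof (induction rule: fs.span_induct_alt)
  case base
  then show ?case by (auto simp: filt_def fs.span_zero)
next
  case (step c x y)
  then obtain w m k q where x: "x = gen w m" "hword A w k" "m \<in> gr M q" by blast
  from step obtain j where j: "y \<in> filt j" by blast
  let ?j = "max j (length w)"
  have "x \<in> filt ?j" "y \<in> filt ?j"
    using x filt_gen[of w k m q ?j] j filt_mono[of j ?j] by auto
  then show ?case
    unfolding filt_def by (meson fs.span_add fs.span_scale)
qed

text \<open>
  The operator \<open>1 - G\<close> shortens words: by \<open>G_Cons\<close>, prepending a letter raises the length of
  \<open>(1 - G) t\<close> by at most one, and what is added has length zero.
\<close>

lemma unipotent_gen:
  assumes w: "hword A w n" and m: "m \<in> gr M q"
  shows "gen w m - G (gen w m) \<in> (if w = [] then {0} else filt (length w - 1))"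
  using w
proof induction
  case hword_Nil
  show ?case by (simp add: G_Nil[OF m])
next
  case (hword_Cons a p w n)
  note a = hword_Cons(1) and w = hword_Cons(2)
  obtain m' where m': "m' \<in> gr M (p - 1 + n + q)" "G (gen (a # w) m) = L a (G (gen w m)) + gen [] m'"
    using G_Cons[OF a w m] by blast
  have "gen (a # w) m - G (gen (a # w) m) = L a (gen w m - G (gen w m)) - gen [] m'"
    by (simp add: m'(2) lin_diff[OF lin_lcons] L_gen[OF a w m])
  moreover have "L a (gen w m - G (gen w m)) \<in> filt (length w)"
  proof (cases "w = []")
    case True
    then show ?thesis using hword_Cons.IH by (simp add: lin_zero[OF lin_lcons] filt_def fs.span_zero)
  next
    case False
    then show ?thesis using hword_Cons.IH L_filt[OF a, of _ "length w - 1"] by simp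
  qed
  moreover have "gen [] m' \<in> filt (length w)"
    by (rule filt_gen[OF hword_Nil m'(1)]) simp
  ultimately show ?case
    unfolding filt_def by (simp add: fs.span_diff)
qed

lemma lin_unipotent: "lin (\<lambda>t. t - G t)"
  by (intro lin_sub lin_ident lin_G)

lemma unipotent_filt:
  "t \<in> filt j \<Longrightarrow> ((\<lambda>t. t - G t) ^^ Suc j) t = 0"
proof (induction j arbitrary: t)
  case 0
  have "t - G t = 0"
  proof (rule lin_eq_on_span[OF lin_unipotent lin_null _ 0[unfolded filt_def]])
    fix t assume "t \<in> short_gens 0"
    then show "t - G t = 0" using unipotent_gen unfolding short_gens_def by fastforce
  qed
  then show ?case by simp
next
  case (Suc j)
  have "t - G t \<in> filt j"
  proof (rule lin_filt[OF lin_unipotent Suc.prems])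
    fix w n m q assume t: "hword A w n" "m \<in> gr M q" and "length w \<le> Suc j"
    then have "filt (length w - 1) \<subseteq> filt j" by (intro filt_mono) simp
    moreover have "0 \<in> filt j" by (simp add: filt_def fs.span_zero)
    ultimately show "gen w m - G (gen w m) \<in> filt j"
      using unipotent_gen[OF t] by (cases "w = []") (simp_all add: subset_iff)
  qed
  from Suc.IH[OF this] show ?case by (simp only: funpow_Suc_right o_apply)
qed

lemma comodule_h: "comodule_map A M M (- 1) h"
proof (rule comodule_mapI[OF lin_h])
  show "h t \<in> gr BM (n + - 1)" if "t \<in> gr BM n" for t n
    using h_gr[OF that] by simp
  show "\<exists>m'\<in>gr M (q + - 1). h (gen [] m) = gen [] m'" if "m \<in> gr M q" for m q
    using that gr_zero[OF graded_M] by (intro bexI[of _ 0]) (simp_all add: h_Nil gen_Nil_zero)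
  fix a p w n m q
  assume a: "a \<in> gr A p" and w: "hword A w n" and m: "m \<in> gr M q"
  show "\<exists>m'\<in>gr M (p - 1 + n + q + - 1). h (gen (a # w) m) = sg (- 1 * (p - 1)) (L a (h (gen w m))) + gen [] m'"
    using w
  proof cases
    case hword_Nil
    then show ?thesis
      using \<xi>_gr[OF a m]
      by (intro bexI[of _ "smult M (\<xi> a) m"])
        (simp_all add: h_single[OF a m] h_Nil[OF m] lin_zero[OF lin_lcons] gen_Nil_scale[OF m] algebra_simps)
  next
    case (hword_Cons b r v j)
    then show ?thesis
      using gr_zero[OF graded_M]
      by (intro bexI[of _ 0]) (simp_all add: h_Cons[OF a hword_Cons(3,4) m] gen_Nil_zero sg_def)
  qed
qed

lemma comodule_G: "comodule_map A M M 0 G"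
  by (rule comodule_mapI[OF lin_G]) (use G_gr G_Nil G_Cons in auto)

text \<open>
  The contraction is \<open>hP\<close> with \<open>P = G\<^sup>-\<^sup>1\<close>.
\<close>

lemma bar_acyclic: "bar_acyclic A M"
proof -
  obtain P where P: "gmap BM BM 0 P" and inv: "\<And>n t. t \<in> gr BM n \<Longrightarrow> G (P t) = t \<and> P (G t) = t"
    using unipotent_inverse[OF lin_G G_gr] gr_filt unipotent_filt by blast
  have P_gr: "P t \<in> gr BM n" if "t \<in> gr BM n" for t n
    using gmapD(1)[OF P that] by simp
  have Pd: "P (d t) = d (P t)" if t: "t \<in> gr BM n" for t n
    using G_d[OF P_gr[OF t]] inv[OF t] inv[OF d_gr[OF P_gr[OF t]]] by metis
  have "comodule_map A M M (- 1) (\<lambda>t. h (P t))"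
    using comodule_map_comp[OF comodule_h comodule_map_inverse[OF comodule_G P inv]] by simp
  moreover have "h (P (d t)) + d (h (P t)) = t" if t: "t \<in> gr BM n" for t n
    using inv[OF t] Pd[OF t] by (simp add: G_def add.commute)
  ultimately show ?thesis
    unfolding bar_acyclic_def by blast
qed

end

section \<open>Cones\<close>

lemma sg_Pair: "sg n (x, y) = (sg n x, sg n y)"
  by (simp add: sg_def)

lemma
  assumes "graded_space V"
  shows smult_add: "smult V c (x + y) = smult V c x + smult V c y"
    and smult_zero_right: "smult V c 0 = 0"
    and smult_minus: "smult V c (- x) = - smult V c x"
    and smult_sg: "smult V c (sg r x) = sg r (smult V c x)"
proof -
  interpret vector_space "smult V" using assms by (simp add: graded_space_def)
  show "smult V c (x + y) = smult V c x + smult V c y" "smult V c 0 = 0"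
    "smult V c (- x) = - smult V c x" "smult V c (sg r x) = sg r (smult V c x)"
    by (simp_all add: scale_right_distrib sg_def)
qed

lemma graded_sum_zero:
  "graded_space V \<Longrightarrow> finite J \<Longrightarrow> \<forall>n\<in>J. y n \<in> gr V n \<Longrightarrow> (\<Sum>n\<in>J. y n) = 0 \<Longrightarrow> \<forall>n\<in>J. y n = 0"
  unfolding graded_space_def by blast

lemma graded_cone:
  assumes M: "graded_space M" and N: "graded_space N"
  shows "graded_space (cdg_cone A M N f)" (is "graded_space ?C")
proof -
  interpret M: vector_space "smult M" using M by (simp add: graded_space_def)
  interpret N: vector_space "smult N" using N by (simp add: graded_space_def)
  have C: "vector_space (smult ?C)"
    by unfold_locales
      (auto simp: cdg_cone_def M.scale_right_distrib N.scale_right_distrib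
        M.scale_left_distrib N.scale_left_distrib)
  interpret C: vector_space "smult ?C" by (rule C)
  have "module.subspace (smult ?C) (gr ?C n)" for n
    by (rule C.subspaceI)
      (auto simp: cdg_cone_def zero_prod_def gr_zero[OF M] gr_zero[OF N] gr_add[OF M] gr_add[OF N]
        gr_scale[OF M] gr_scale[OF N])
  moreover have "\<forall>n\<in>I. x n = 0"
    if I: "finite I" and x: "\<forall>n\<in>I. x n \<in> gr ?C n" and s: "(\<Sum>n\<in>I. x n) = 0" for I x
  proof -
    have "\<forall>n\<in>I. fst (x n) = 0"
    proof (rule graded_sum_zero[OF N I])
      show "\<forall>n\<in>I. fst (x n) \<in> gr N n" using x by (auto simp: cdg_cone_def)
      show "(\<Sum>n\<in>I. fst (x n)) = 0" using s by (simp flip: fst_sum)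
    qed
    moreover have "\<forall>n\<in>(\<lambda>n. n + 1) ` I. snd (x (n - 1)) = 0"
    proof (rule graded_sum_zero[OF M])
      show "finite ((\<lambda>n. n + 1) ` I)" using I by simp
      show "\<forall>n\<in>(\<lambda>n. n + 1) ` I. snd (x (n - 1)) \<in> gr M n" using x by (auto simp: cdg_cone_def)
      have "(\<Sum>n\<in>(\<lambda>n. n + 1) ` I. snd (x (n - 1))) = (\<Sum>n\<in>I. snd (x n))"
        by (subst sum.reindex) (auto simp: inj_on_def)
      also have "\<dots> = 0" using s by (simp flip: snd_sum)
      finally show "(\<Sum>n\<in>(\<lambda>n. n + 1) ` I. snd (x (n - 1))) = 0" .
    qed
    ultimately show ?thesis by (auto simp: prod_eq_iff)
  qed
  ultimately show ?thesis
    unfolding graded_space_def using C by blast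
qed

lemma closed_mapD:
  assumes "closed_map A M N f"
  shows "gmap M N 0 f"
    and "a \<in> gr A p \<Longrightarrow> m \<in> gr M q \<Longrightarrow> f (act M a m) = act N a (f m)"
    and "m \<in> gr M q \<Longrightarrow> f (mdiff M m) = mdiff N (f m)"
    and "m \<in> gr M q \<Longrightarrow> f m \<in> gr N q"
  using assms gmapD(1)[of M N 0 f m q] by (simp_all add: closed_map_def)

text \<open>
  The action on \<open>M[1]\<close> carries the sign of \<open>deg A a\<close>, unspecified at \<open>a = 0\<close>, where the action is
  zero anyway; otherwise the axioms are those of \<open>M\<close> and \<open>N\<close> with Koszul signs.
\<close>

lemma cdg_module_cone:
  assumes A: "cdg_algebra A" and M: "cdg_module A M" and N: "cdg_module A N"
    and f: "closed_map A M N f"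
  shows "cdg_module A (cdg_cone A M N f)"
proof -
  interpret M: curved_module A M by unfold_locales (fact A M)+
  interpret N: curved_module A N by unfold_locales (fact N)
  let ?C = "cdg_cone A M N f"
  have grC: "gr ?C n = gr N n \<times> gr M (n + 1)" for n by (simp add: cdg_cone_def)
  have smC: "smult ?C c (y, x) = (smult N c y, smult M c x)" for c y x by (simp add: cdg_cone_def)
  have dC: "mdiff ?C (y, x) = (mdiff N y + f x, - mdiff M x)" for y x by (simp add: cdg_cone_def)
  have aC: "act ?C a (y, x) = (act N a y, sg p (act M a x))"
    if a: "a \<in> gr A p" and x: "x \<in> gr M q" for a y x p q
  proof (cases "a = 0")
    case True
    then have "act M a x = 0"
      using gmap_zero[OF M.gmap_act_right[OF x] gr_zero[OF M.graded_A]] by simp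
    then show ?thesis by (simp add: cdg_cone_def)
  qed (simp add: cdg_cone_def deg_eq[OF M.graded_A a])
  note f' = closed_mapD(1)[OF f] and f_act = closed_mapD(2)[OF f] and f_d = closed_mapD(3)[OF f]
  have f_gr: "f x \<in> gr N q" if "x \<in> gr M q" for x q using gmapD(1)[OF f' that] by simp
  note add = smult_add[OF N.graded_M] and neg = smult_minus[OF M.graded_M] and sM = smult_sg[OF M.graded_M]
  have c1: "gmap ?C ?C p (act ?C a)" if a: "a \<in> gr A p" for a p
    unfolding gmap_def grC
  proof (intro allI ballI conjI)
    fix n z assume "z \<in> gr N n \<times> gr M (n + 1)"
    then obtain y x where z: "z = (y, x)" "y \<in> gr N n" "x \<in> gr M (n + 1)" by auto
    have "act M a x \<in> gr M (n + p + 1)" using M.act_gr[OF a z(3)] by (simp add: algebra_simps)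
    then show "act ?C a z \<in> gr N (n + p) \<times> gr M (n + p + 1)"
      using N.act_gr[OF a z(2)] gr_sg[OF M.graded_M] by (simp add: z(1) aC[OF a z(3)] add.commute)
    show "act ?C a (smult ?C c z) = smult ?C c (act ?C a z)" for c
      by (simp add: z(1) smC aC[OF a z(3)] aC[OF a gr_scale[OF M.graded_M z(3)]] sM
          gmapD(3)[OF N.gmap_act[OF a] z(2)] gmapD(3)[OF M.gmap_act[OF a] z(3)])
    fix z' assume "z' \<in> gr N n \<times> gr M (n + 1)"
    then obtain y' x' where z': "z' = (y', x')" "y' \<in> gr N n" "x' \<in> gr M (n + 1)" by auto
    show "act ?C a (z + z') = act ?C a z + act ?C a z'"
      by (simp add: z(1) z'(1) aC[OF a z(3)] aC[OF a z'(3)] aC[OF a gr_add[OF M.graded_M z(3) z'(3)]]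
          sg_distrib gmapD(2)[OF N.gmap_act[OF a] z(2) z'(2)] gmapD(2)[OF M.gmap_act[OF a] z(3) z'(3)])
  qed
  have c2: "gmap A ?C q (\<lambda>a. act ?C a z)" if zq: "z \<in> gr ?C q" for q z
    unfolding gmap_def grC
  proof (intro allI ballI conjI)
    from zq obtain y x where z: "z = (y, x)" "y \<in> gr N q" "x \<in> gr M (q + 1)" by (auto simp: grC)
    fix p a assume a: "a \<in> gr A p"
    have "act M a x \<in> gr M (p + q + 1)" using M.act_gr[OF a z(3)] by (simp add: algebra_simps)
    then show "act ?C a z \<in> gr N (p + q) \<times> gr M (p + q + 1)"
      using N.act_gr[OF a z(2)] gr_sg[OF M.graded_M] by (simp add: z(1) aC[OF a z(3)])
    show "act ?C (smult A c a) z = smult ?C c (act ?C a z)" for c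
      by (simp add: z(1) smC aC[OF a z(3)] aC[OF gr_scale[OF M.graded_A a] z(3)] sM
          gmapD(3)[OF N.gmap_act_right[OF z(2)] a] gmapD(3)[OF M.gmap_act_right[OF z(3)] a])
    fix b assume b: "b \<in> gr A p"
    show "act ?C (a + b) z = act ?C a z + act ?C b z"
      by (simp add: z(1) aC[OF a z(3)] aC[OF b z(3)] aC[OF gr_add[OF M.graded_A a b] z(3)]
          sg_distrib gmapD(2)[OF N.gmap_act_right[OF z(2)] a b] gmapD(2)[OF M.gmap_act_right[OF z(3)] a b])
  qed
  have c3: "act ?C (amul A a b) z = act ?C a (act ?C b z)"
    if a: "a \<in> gr A p" and b: "b \<in> gr A q" and "z \<in> gr ?C r" for a b z p q r
  proof -
    from that(3) obtain y x where z: "z = (y, x)" "y \<in> gr N r" "x \<in> gr M (r + 1)" by (auto simp: grC)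
    note bx = M.act_gr[OF b z(3)]
    show ?thesis
      by (simp add: z(1) aC[OF b z(3)] aC[OF a gr_sg[OF M.graded_M bx]] aC[OF M.mul_gr[OF a b] z(3)]
          M.act_mul[OF a b z(3)] N.act_mul[OF a b z(2)] gmap_sg[OF M.gmap_act[OF a] M.graded_M bx])
  qed
  have c4: "act ?C (aone A) z = z" if "z \<in> gr ?C q" for z q
  proof -
    from that obtain y x where z: "z = (y, x)" "y \<in> gr N q" "x \<in> gr M (q + 1)" by (auto simp: grC)
    have one: "aone A \<in> gr A 0" using A by (simp add: cdg_algebra_def)
    have "act N (aone A) y = y" "act M (aone A) x = x"
      using M N z(2,3) by (simp_all add: cdg_module_def)
    then show ?thesis by (simp add: z(1) aC[OF one z(3)])
  qed
  have c5: "gmap ?C ?C 1 (mdiff ?C)"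
    unfolding gmap_def grC
  proof (intro allI ballI conjI)
    fix n z assume "z \<in> gr N n \<times> gr M (n + 1)"
    then obtain y x where z: "z = (y, x)" "y \<in> gr N n" "x \<in> gr M (n + 1)" by auto
    show "mdiff ?C z \<in> gr N (n + 1) \<times> gr M (n + 1 + 1)"
      using gr_add[OF N.graded_M N.mdiff_gr[OF z(2)] f_gr[OF z(3)]] gr_neg[OF M.graded_M M.mdiff_gr[OF z(3)]]
      by (simp add: z(1) dC)
    show "mdiff ?C (smult ?C c z) = smult ?C c (mdiff ?C z)" for c
      by (simp add: z(1) smC dC gmapD(3)[OF N.gmap_mdiff z(2)] gmapD(3)[OF M.gmap_mdiff z(3)]
          gmapD(3)[OF f' z(3)] neg add)
    fix z' assume "z' \<in> gr N n \<times> gr M (n + 1)"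
    then obtain y' x' where z': "z' = (y', x')" "y' \<in> gr N n" "x' \<in> gr M (n + 1)" by auto
    show "mdiff ?C (z + z') = mdiff ?C z + mdiff ?C z'"
      by (simp add: z(1) z'(1) dC gmapD(2)[OF N.gmap_mdiff z(2) z'(2)]
          gmapD(2)[OF M.gmap_mdiff z(3) z'(3)] gmapD(2)[OF f' z(3) z'(3)])
  qed
  have c6: "mdiff ?C (act ?C a z) = act ?C (adiff A a) z + sg p (act ?C a (mdiff ?C z))"
    if a: "a \<in> gr A p" and zq: "z \<in> gr ?C q" for a z p q
  proof -
    from zq obtain y x where z: "z = (y, x)" "y \<in> gr N q" "x \<in> gr M (q + 1)" by (auto simp: grC)
    note ax = M.act_gr[OF a z(3)] and dx = M.mdiff_gr[OF z(3)] and da = M.diff_gr[OF a]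
    show ?thesis
      by (simp add: z(1) dC aC[OF a z(3)] aC[OF da z(3)] aC[OF a gr_neg[OF M.graded_M dx]]
          gmap_sg[OF f' M.graded_M ax] gmap_sg[OF M.gmap_mdiff M.graded_M ax] f_act[OF a z(3)]
          N.mdiff_act[OF a z(2)] M.mdiff_act[OF a z(3)] gmap_neg[OF M.gmap_act[OF a] M.graded_M dx]
          gmapD(2)[OF N.gmap_act[OF a] N.mdiff_gr[OF z(2)] f_gr[OF z(3)]] sg_Pair sg_distrib)
        (simp add: sg_def)
  qed
  have c7: "mdiff ?C (mdiff ?C z) = act ?C (curv A) z" if "z \<in> gr ?C q" for z q
  proof -
    from that obtain y x where z: "z = (y, x)" "y \<in> gr N q" "x \<in> gr M (q + 1)" by (auto simp: grC)
    note dx = M.mdiff_gr[OF z(3)]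
    show ?thesis
      using gmapD(2)[OF N.gmap_mdiff N.mdiff_gr[OF z(2)] f_gr[OF z(3)]]
      by (simp add: z(1) dC aC[OF M.curv_gr z(3)] N.mdiff_mdiff[OF z(2)] M.mdiff_mdiff[OF z(3)]
          gmap_neg[OF f' M.graded_M dx] f_d[OF z(3)] gmap_neg[OF M.gmap_mdiff M.graded_M dx])
        (simp add: sg_def)
  qed
  show ?thesis
    unfolding cdg_module_def gbilinear_def
    by (intro conjI allI ballI)
      (rule graded_cone[OF M.graded_M N.graded_M] c1 c2 c3 c4 c5 c6 c7; assumption)+
qed

section \<open>Vanishing of a localization\<close>

text \<open>
  The zero endomorphism of \<open>X\<close> is idempotent, so it becomes the identity when it is inverted.  Hence
  each step of a zigzag may be followed by a zero map, and thereby be replaced by one.  For a formal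
  inverse \<open>s\<^sup>-\<^sup>1 : Y \<rightarrow> X\<close> of \<open>s : X \<rightarrow> Y\<close>, the zero map that follows is factored through \<open>s\<close>, which
  cancels.  So there is exactly one morphism between any two objects.
\<close>

lemma localization_zero:
  assumes z: "\<And>X Y. X \<in> Obj C \<Longrightarrow> Y \<in> Obj C \<Longrightarrow> z X Y \<in> Hom C X Y"
    and absorb: "\<And>X Y Z f. X \<in> Obj C \<Longrightarrow> Y \<in> Obj C \<Longrightarrow> Z \<in> Obj C \<Longrightarrow> f \<in> Hom C X Y \<Longrightarrow>
        Cmp C X Y Z (z Y Z) f = z X Z"
    and inverted: "\<And>X. X \<in> Obj C \<Longrightarrow> z X X \<in> S X X"
    and S: "\<And>X Y s. s \<in> S X Y \<Longrightarrow> s \<in> Hom C X Y"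
  shows "zero_category (localization C S)"
proof -
  let ?z = "\<lambda>X Y. [Fwd X (z X Y) Y]"
  have path: "zpath C S X Y (?z X Y)" if "X \<in> Obj C" "Y \<in> Obj C" for X Y
    using that by (intro zpath.fwd zpath.nil z)
  have comp: "zeq C S X Z [Fwd X f Y, Fwd Y (z Y Z) Z] (?z X Z)"
    if "X \<in> Obj C" "Y \<in> Obj C" "Z \<in> Obj C" "f \<in> Hom C X Y" for X Y Z f
    using zeq.cmp[OF that z[OF that(2,3)], of S] absorb[OF that] by simp
  have idz: "zeq C S X X (?z X X) []" if X: "X \<in> Obj C" for X
  proof -
    let ?b = "[Bwd X (z X X) X]"
    have b: "zpath C S X X ?b" using X inverted by (intro zpath.bwd zpath.nil)
    have inv: "zeq C S X X [Fwd X (z X X) X, Bwd X (z X X) X] []"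
      by (rule zeq.inv_right[where S = S, OF X X]) (rule inverted[OF X])
    have "zeq C S X X (?z X X @ []) (?z X X @ [Fwd X (z X X) X, Bwd X (z X X) X])"
      by (rule zeq.append[OF zeq.refl[OF path[OF X X]] zeq.sym[OF inv]])
    moreover have "zeq C S X X ([Fwd X (z X X) X, Fwd X (z X X) X] @ ?b) (?z X X @ ?b)"
      by (rule zeq.append[OF comp[OF X X X z[OF X X]] zeq.refl[OF b]])
    ultimately have "zeq C S X X (?z X X) (?z X X @ ?b)"
      by (auto intro: zeq.trans)
    then show ?thesis using zeq.trans[OF _ inv] by simp
  qed
  have all: "X \<in> Obj C \<and> Y \<in> Obj C \<and> zeq C S X Y p (?z X Y)" if "zpath C S X Y p" for X Y p
    using that
  proof induction
    case (nil X)
    then show ?case using zeq.sym[OF idz] by blast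
  next
    case (fwd X Y f Z p)
    have "zpath C S X Y [Fwd X f Y]"
      by (rule zpath.fwd[OF fwd(1,2,3) zpath.nil[OF fwd(2)]])
    then have "zeq C S X Z ([Fwd X f Y] @ p) ([Fwd X f Y] @ ?z Y Z)"
      by (rule zeq.append[OF zeq.refl conjunct2[OF conjunct2[OF fwd.IH]]])
    moreover have "zeq C S X Z ([Fwd X f Y] @ ?z Y Z) (?z X Z)"
      using comp[of X Y Z f] fwd by simp
    ultimately show ?case using fwd zeq.trans by fastforce
  next
    case (bwd X Y s Z p)
    note XY = bwd(1,2) and s = bwd(3)
    have Z: "Z \<in> Obj C" and p: "zeq C S X Z p (?z X Z)" using bwd.IH by auto
    have b: "zpath C S Y X [Bwd X s Y]" using XY s by (intro zpath.bwd zpath.nil)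
    have "zeq C S Y Z ([Bwd X s Y] @ p) ([Bwd X s Y] @ ?z X Z)"
      by (rule zeq.append[OF zeq.refl[OF b] p])
    moreover have "zeq C S Y Z ([Bwd X s Y] @ ?z X Z) ([Bwd X s Y] @ [Fwd X s Y, Fwd Y (z Y Z) Z])"
      by (rule zeq.append[OF zeq.refl[OF b] zeq.sym[OF comp[OF XY Z S[OF s]]]])
    moreover have "zeq C S Y Z ([Bwd X s Y, Fwd X s Y] @ ?z Y Z) ([] @ ?z Y Z)"
      by (rule zeq.append[OF zeq.inv_left[where S = S, OF XY s] zeq.refl[OF path[OF XY(2) Z]]])
    ultimately have "zeq C S Y Z ([Bwd X s Y] @ p) (?z Y Z)"
      using zeq.trans by (metis append_Cons append_Nil)
    with XY Z show ?case by simp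
  qed
  have hom: "\<exists>!F. F \<in> Hom (localization C S) X Y" if XY: "X \<in> Obj C" "Y \<in> Obj C" for X Y
  proof (rule ex1I)
    show "{q. zeq C S X Y (?z X Y) q} \<in> Hom (localization C S) X Y"
      using path[OF XY] by (auto simp: localization_def quotient_def Image_def)
    fix F assume "F \<in> Hom (localization C S) X Y"
    then obtain p where p: "zpath C S X Y p" "F = {q. zeq C S X Y p q}"
      by (auto simp: localization_def quotient_def Image_def)
    have e: "zeq C S X Y p (?z X Y)" using all[OF p(1)] by blast
    show "F = {q. zeq C S X Y (?z X Y) q}"
      unfolding p(2)
      by (intro Collect_cong iffI)
        (erule zeq.trans[OF zeq.sym[OF e]], erule zeq.trans[OF e])
  qed
  show ?thesis
    unfolding zero_category_def zero_object_def
    using hom by (simp add: localization_def)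
qed

section \<open>The bar derived category\<close>

lemma closed_map_comp:
  assumes f: "closed_map A L M f" and g: "closed_map A M N g"
  shows "closed_map A L N (g \<circ> f)"
  unfolding closed_map_def comp_def
proof (intro conjI allI ballI)
  show "gmap L N 0 (\<lambda>x. g (f x))"
    using gmap_comp[OF closed_mapD(1)[OF f] closed_mapD(1)[OF g]] by simp
  fix q m assume m: "m \<in> gr L q"
  note fm = closed_mapD(4)[OF f m]
  show "g (f (act L a m)) = act N a (g (f m))" if "a \<in> gr A p" for a p
    by (simp only: closed_mapD(2)[OF f that m] closed_mapD(2)[OF g that fm])
  show "g (f (mdiff L m)) = mdiff N (g (f m))"
    by (simp only: closed_mapD(3)[OF f m] closed_mapD(3)[OF g fm])
qed

context curved_module
begin

lemma gmap_into_zero: "gmap V M r (\<lambda>_. 0)"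
  by (simp add: gmap_def gr_zero[OF graded_M] smult_zero_right[OF graded_M])

lemma act_zero: "a \<in> gr A p \<Longrightarrow> act M a 0 = 0"
  by (rule gmap_zero[OF gmap_act gr_zero[OF graded_M]])

lemma closed_map_zero: "closed_map A K M (\<lambda>_. 0)"
  using gmap_zero[OF gmap_mdiff gr_zero[OF graded_M]]
  by (auto simp: closed_map_def gmap_into_zero act_zero)

lemma homotopic_refl: "closed_map A K M f \<Longrightarrow> homotopic A K M f f"
  using gmap_zero[OF gmap_mdiff gr_zero[OF graded_M]] unfolding homotopic_def
  by (intro conjI exI[of _ "\<lambda>_. 0"]) (auto simp: gmap_into_zero act_zero)

lemma homotopic_trans:
  assumes fg: "homotopic A K M f g" and gh: "homotopic A K M g h"
  shows "homotopic A K M f h"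
proof -
  obtain s where s: "gmap K M (- 1) s"
    "\<And>p q a m. a \<in> gr A p \<Longrightarrow> m \<in> gr K q \<Longrightarrow> s (act K a m) = sg p (act M a (s m))"
    "\<And>q m. m \<in> gr K q \<Longrightarrow> f m - g m = mdiff M (s m) + s (mdiff K m)"
    using fg unfolding homotopic_def by blast
  obtain t where t: "gmap K M (- 1) t"
    "\<And>p q a m. a \<in> gr A p \<Longrightarrow> m \<in> gr K q \<Longrightarrow> t (act K a m) = sg p (act M a (t m))"
    "\<And>q m. m \<in> gr K q \<Longrightarrow> g m - h m = mdiff M (t m) + t (mdiff K m)"
    using gh unfolding homotopic_def by blast
  have "gmap K M (- 1) (\<lambda>m. s m + t m)"
    using s(1) t(1) by (simp add: gmap_def gr_add[OF graded_M] smult_add[OF graded_M] ac_simps)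
  moreover have "s (act K a m) + t (act K a m) = sg p (act M a (s m + t m))"
    if "a \<in> gr A p" "m \<in> gr K q" for a m p q
    by (simp add: s(2)[OF that] t(2)[OF that] sg_distrib
        gmapD(2)[OF gmap_act[OF that(1)] gmapD(1)[OF s(1) that(2)] gmapD(1)[OF t(1) that(2)]])
  moreover have "f m - h m = mdiff M (s m + t m) + (s (mdiff K m) + t (mdiff K m))"
    if "m \<in> gr K q" for m q
    using s(3)[OF that] t(3)[OF that]
      gmapD(2)[OF gmap_mdiff gmapD(1)[OF s(1) that] gmapD(1)[OF t(1) that]]
    by (simp add: algebra_simps)
  ultimately show ?thesis
    using fg gh unfolding homotopic_def by (intro conjI exI[of _ "\<lambda>m. s m + t m"]) blast+
qed

end

lemma homotopic_zero_comp:
  assumes L: "cdg_module A L" and f: "closed_map A L M f" and g: "homotopic A M N (\<lambda>_. 0) g"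
  shows "homotopic A L N (\<lambda>_. 0) (g \<circ> f)"
proof -
  have dL: "gmap L L 1 (mdiff L)" using L by (simp add: cdg_module_def)
  obtain s where s: "gmap M N (- 1) s"
    "\<And>p q a m. a \<in> gr A p \<Longrightarrow> m \<in> gr M q \<Longrightarrow> s (act M a m) = sg p (act N a (s m))"
    "\<And>q m. m \<in> gr M q \<Longrightarrow> 0 - g m = mdiff N (s m) + s (mdiff M m)"
    using g unfolding homotopic_def by blast
  have c0: "closed_map A M N (\<lambda>_. 0)" and cg: "closed_map A M N g"
    using g unfolding homotopic_def by blast+
  have "gmap L N (- 1) (\<lambda>m. s (f m))"
    using gmap_comp[OF closed_mapD(1)[OF f] s(1)] by simp
  moreover have "s (f (act L a m)) = sg p (act N a (s (f m)))" if "a \<in> gr A p" "m \<in> gr L q" for a m p q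
    using closed_mapD(2)[OF f that] s(2)[OF that(1) closed_mapD(4)[OF f that(2)]] by simp
  moreover have "0 - (g \<circ> f) m = mdiff N (s (f m)) + s (f (mdiff L m))" if "m \<in> gr L q" for m q
    using s(3)[OF closed_mapD(4)[OF f that]] closed_mapD(3)[OF f that] by simp
  moreover have "closed_map A L N (\<lambda>_. 0)"
    using closed_map_comp[OF f c0] by (simp add: comp_def)
  ultimately show ?thesis
    unfolding homotopic_def using closed_map_comp[OF f cg]
    by (intro conjI exI[of _ "\<lambda>m. s (f m)"]) blast+
qed

text \<open>
  A linear form with value \<open>1\<close> on the curvature exists because \<open>c \<noteq> 0\<close>; it is cut off outside
  degree \<open>2\<close> to become homogeneous.
\<close>

lemma bar_acyclic_of_curvature:
  fixes A :: "('k::field, 'a::ab_group_add) cdg_alg"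
    and M :: "('k, 'a, 'm::ab_group_add) cdg_mod"
  assumes A: "cdg_algebra A" and c: "curv A \<noteq> 0" and M: "cdg_module A M"
  shows "bar_acyclic A M"
proof -
  have gA: "graded_space A" and cA: "curv A \<in> gr A 2" using A by (simp_all add: cdg_algebra_def)
  obtain l where l: "Vector_Spaces.linear (smult A) (*) l" "l (curv A) = (1::'k)"
    using linear_form_separates[OF _ c, of "smult A"] gA by (auto simp: graded_space_def)
  interpret l: Vector_Spaces.linear "smult A" "(*)" l by (rule l(1))
  interpret curvature_functional A M "\<lambda>a. if a \<in> gr A 2 then l a else 0"
  proof unfold_locales
    have 0: "a \<in> gr A 2 \<Longrightarrow> l a = 0" if "a \<in> gr A p" "p \<noteq> 2" for a p
      using gr_unique[OF gA that(1), of 2] that(2) by (cases "a = 0") (auto simp: l.zero)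
    show "(if a + b \<in> gr A 2 then l (a + b) else 0) =
        (if a \<in> gr A 2 then l a else 0) + (if b \<in> gr A 2 then l b else 0)"
      if "a \<in> gr A p" "b \<in> gr A p" for a b p
      using that 0[of a p] 0[of b p] 0[OF gr_add[OF gA that]] gr_add[OF gA, of a 2 b]
      by (cases "p = 2") (auto simp: l.add)
    show "(if smult A c a \<in> gr A 2 then l (smult A c a) else 0) = c * (if a \<in> gr A 2 then l a else 0)"
      if "a \<in> gr A p" for a c p
      using that 0[of a p] 0[OF gr_scale[OF gA that, of c]] gr_scale[OF gA, of a 2 c]
      by (cases "p = 2") (auto simp: l.scale)
    show "(if a \<in> gr A 2 then l a else 0) = 0" if "a \<in> gr A p" "p \<noteq> 2" for a p
      using 0[OF that] by simp
  qed (use A M cA l(2) in auto)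
  show ?thesis by (rule bar_acyclic)
qed

theorem corollary5p7:
  fixes A :: "('k::field, 'a::ab_group_add) cdg_alg"
  assumes "cdg_algebra A"
    and "curv A \<noteq> 0"
  shows "zero_category (D_bar TYPE('m::ab_group_add) A)"
  unfolding D_bar_def
proof (rule localization_zero)
  note A = assms(1)
  let ?C = "Mod_htpy TYPE('m) A"
  let ?z = "\<lambda>M N. {f. homotopic A M N (\<lambda>_. 0) f}"
  have loc: "curved_module A M" if "M \<in> Obj ?C" for M
    using that A by unfold_locales (auto simp: Mod_htpy_def)
  have ob: "cdg_module A M" if "M \<in> Obj ?C" for M using that by (simp add: Mod_htpy_def)
  fix X Y Z :: "('k, 'a, 'm) cdg_mod"
  show z: "?z X Y \<in> Hom ?C X Y" if "X \<in> Obj ?C" "Y \<in> Obj ?C" for X Y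
  proof -
    interpret curved_module A Y by (rule loc[OF that(2)])
    show ?thesis
      using closed_map_zero by (auto simp: Mod_htpy_def quotient_def)
  qed
  show "?z X X \<in> {F \<in> Hom ?C X X. \<exists>f\<in>F. bar_acyclic A (cdg_cone A X X f)}" if X: "X \<in> Obj ?C"
  proof -
    interpret curved_module A X by (rule loc[OF X])
    have "bar_acyclic A (cdg_cone A X X (\<lambda>_. 0))"
      by (rule bar_acyclic_of_curvature[OF A assms(2) cdg_module_cone[OF A ob[OF X] ob[OF X] closed_map_zero]])
    then show ?thesis
      using z[OF X X] homotopic_refl[OF closed_map_zero] by blast
  qed
  show "Cmp ?C X Y Z (?z Y Z) F = ?z X Z"
    if X: "X \<in> Obj ?C" and Y: "Y \<in> Obj ?C" and Z: "Z \<in> Obj ?C" and F: "F \<in> Hom ?C X Y" for F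
  proof -
    interpret Y: curved_module A Y by (rule loc[OF Y])
    interpret Z: curved_module A Z by (rule loc[OF Z])
    obtain f where f: "closed_map A X Y f" "F = {g. homotopic A X Y f g}"
      using F by (auto simp: Mod_htpy_def quotient_def)
    have F_closed: "closed_map A X Y g" if "g \<in> F" for g
      using that f(2) by (simp add: homotopic_def)
    have fF: "f \<in> F" using f Y.homotopic_refl by simp
    have "homotopic A X Z (\<lambda>_. 0) e"
      if "g \<in> F" "homotopic A Y Z (\<lambda>_. 0) k" "homotopic A X Z (k \<circ> g) e" for g k e
      using Z.homotopic_trans[OF homotopic_zero_comp[OF ob[OF X] F_closed[OF that(1)] that(2)] that(3)] .
    moreover have "\<exists>g\<in>F. \<exists>k. homotopic A Y Z (\<lambda>_. 0) k \<and> homotopic A X Z (k \<circ> g) e"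
      if "homotopic A X Z (\<lambda>_. 0) e" for e
      using that fF Z.homotopic_refl[OF Z.closed_map_zero]
      by (intro bexI[of _ f] exI[of _ "\<lambda>_. 0"]) (simp_all add: comp_def)
    ultimately show ?thesis
      by (auto simp: Mod_htpy_def)
  qed
qed simp

end
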